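(* Let $(R,\mathfrak m)$ be a local ring. Then for every $n\ge 3$, $$\operatorname{Sp}_{2n}(R[X],\mathfrak m[X])\cap\operatorname{ESp}_{2n}(R[X])=\operatorname{ESp}_{2n}(R[X],\mathfrak m[X]).$$
   Context: Rings are commutative with $1$; $\mathfrak m[X]=\mathfrak m R[X]$. Let $\chi_1=\begin{pmatrix}0&1\\-1&0\end{pmatrix}$, $\chi_{n+1}=\chi_n\perp\chi_1$ (block diagonal sum). For an ideal $J$ of a ring $A$, $\operatorname{Sp}_{2n}(A,J)$ is the group of $\alpha\in\operatorname{GL}_{2n}(A)$ with $\alpha\equiv\mathrm I_{2n}\pmod J$ and $\alpha^T\chi_n\alpha=\chi_n$. Let $\sigma$ be the permutation of $\{1,\dots,2n\}$ with $\sigma(2i)=2i-1$, $\sigma(2i-1)=2i$; for $i\neq j$, $\lambda\in A$, put $se_{ij}(\lambda)=\mathrm I_{2n}+\lambda E_{ij}$ if $i=\sigma(j)$ and $se_{ij}(\lambda)=\mathrm I_{2n}+\lambda E_{ij}-(-1)^{i+j}\lambda E_{\sigma(j)\sigma(i)}$ if $i\neq\sigma(j)$, where $E_{ij}$ are the matrix units. $\operatorname{ESp}_{2n}(A)$ is generated by all $se_{ij}(\lambda)$, $\lambda\in A$, and $\operatorname{ESp}_{2n}(A,J)$ is generated by all $\alpha\,se_{ij}(x)\,\alpha^{-1}$ with $\alpha\in\operatorname{ESp}_{2n}(A)$, $x\in J$. *)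

theory Defs
  imports "Jordan_Normal_Form.VS_Connect" "HOL-Algebra.Ideal" "HOL-Algebra.Generated_Groups"
begin

text \<open>
  Ideals of a type-class ring are the \<^const>\<open>ideal\<close>s of HOL-Algebra in \<^term>\<open>class_ring\<close>, the
  record with carrier \<^term>\<open>UNIV\<close>. Matrices have entries indexed from \<open>0\<close>, so all indices
  are shifted by one against the usual \<open>1, \<dots>, 2n\<close>; this does not affect \<open>(-1)\<^sup>i\<^sup>+\<^sup>j\<close>.
\<close>

definition local_ring :: "'a::comm_ring_1 set \<Rightarrow> bool" where
  "local_ring m \<longleftrightarrow> (\<forall>I. maximalideal I (class_ring :: 'a ring) \<longleftrightarrow> I = m)"

definition poly_ideal :: "'a::comm_ring_1 set \<Rightarrow> 'a poly set" where
  "poly_ideal I = genideal (class_ring :: 'a poly ring) ((\<lambda>a. [:a:]) ` I)"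

abbreviation GL :: "nat \<Rightarrow> 'a::comm_ring_1 mat monoid" where
  "GL k \<equiv> units_of (ring_mat TYPE('a) k ())"

definition chi1 :: "'a::comm_ring_1 mat" where
  "chi1 = mat_of_rows_list 2 [[0, 1], [- 1, 0]]"

primrec chi :: "nat \<Rightarrow> 'a::comm_ring_1 mat" where
  "chi 0 = 0\<^sub>m 0 0"
| "chi (Suc n) = diag_block_mat [chi n, chi1]"

definition mat_cong_one :: "nat \<Rightarrow> 'a::comm_ring_1 set \<Rightarrow> 'a mat \<Rightarrow> bool" where
  "mat_cong_one k J A \<longleftrightarrow> (\<forall>i<k. \<forall>j<k. A $$ (i, j) - 1\<^sub>m k $$ (i, j) \<in> J)"

definition Sp_rel :: "nat \<Rightarrow> 'a::comm_ring_1 set \<Rightarrow> 'a mat set" where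
  "Sp_rel n J = {A \<in> carrier (GL (2 * n)).
     mat_cong_one (2 * n) J A \<and> transpose_mat A * chi n * A = chi n}"

definition sigma :: "nat \<Rightarrow> nat" where
  "sigma i = (if even i then i + 1 else i - 1)"

definition mat_unit :: "nat \<Rightarrow> nat \<Rightarrow> nat \<Rightarrow> 'a::comm_ring_1 mat" where
  "mat_unit k i j = mat k k (\<lambda>(r, s). if r = i \<and> s = j then 1 else 0)"

definition se :: "nat \<Rightarrow> nat \<Rightarrow> nat \<Rightarrow> 'a::comm_ring_1 \<Rightarrow> 'a mat" where
  "se n i j x =
     (if i = sigma j then 1\<^sub>m (2 * n) + x \<cdot>\<^sub>m mat_unit (2 * n) i j
      else 1\<^sub>m (2 * n) + x \<cdot>\<^sub>m mat_unit (2 * n) i j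
             - ((- 1) ^ (i + j) * x) \<cdot>\<^sub>m mat_unit (2 * n) (sigma j) (sigma i))"

definition ESp :: "nat \<Rightarrow> 'a::comm_ring_1 mat set" where
  "ESp n = generate (GL (2 * n)) {se n i j x | i j x. i < 2 * n \<and> j < 2 * n \<and> i \<noteq> j}"

definition ESp_rel :: "nat \<Rightarrow> 'a::comm_ring_1 set \<Rightarrow> 'a mat set" where
  "ESp_rel n J = generate (GL (2 * n))
     {A * se n i j x * inv\<^bsub>GL (2 * n)\<^esub> A | A i j x.
        A \<in> ESp n \<and> i < 2 * n \<and> j < 2 * n \<and> i \<noteq> j \<and> x \<in> J}"

end

theory Submission
  imports Defs "HOL-Library.Function_Algebras"
begin

text \<open>
  Write \<open>k\<close> for the residue field. Modulo \<open>ESp(R[X], m[X])\<close> the generators only depend on their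
  parameter in \<open>k[X]\<close>, so the claim is that the relations of \<open>Sp(k[X])\<close> hold in the quotient
  \<open>ESp(R[X]) / ESp(R[X], m[X])\<close>. By induction on the rank this follows once the stabilizer of a basis
  vector \<open>e\<close> in that quotient is generated by the obvious root subgroups. In rank one, Nagao's
  reduced words show this: a degree count separates them from the stabilizer. In rank \<open>r + 2\<close>, the cosets
  of the obvious subgroup form a graph lying over the graph of primitive vectors of \<open>k[X]\<^sup>2\<^sup>r\<^sup>+\<^sup>4\<close>
  with orthogonality as adjacency, and the induction hypothesis makes it a covering. It remains to lift
  cycles. Every cycle decomposes into triangles and quadrangles; these are filled by coning off a vector
  whose pairings with the given vertices have smaller degree, down to the case of frames,
  which is an explicit computation.
\<close>

text \<open>No presentation of \<open>Sp(k[X])\<close> is written down. The relations are encoded as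
  a kernel statement: an elementary element over \<open>R[X]\<close> that acts trivially on vectors
  over \<open>k[X]\<close> lies in the relative group \<open>E\<close>. Knowing the stabilizer of
  one basis vector turns this into a descent, because a trivial action puts the Heisenberg
  parameters into the kernel of \<open>\<pi>\<close> and leaves an element of lower rank. The
  stabilizer is a question about fibres: exactly one coset must lie over each primitive vector. For
  this it is enough to reach every coset by a path of length two and to close short cycles. Since
  \<open>k[X]\<close> is not local, unit entries cannot be assumed; division with remainder supplies
  the descents instead, until the entries are units. Locality of \<open>R\<close> enters when such
  units, which are nonzero constants, are lifted to units of \<open>R[X]\<close>: every unit met
  after reduction is then removed by a genuine diagonal element.\<close>

text \<open>The bijections of a type, written additively because the library has no class of
  multiplicative groups.\<close>

typedef 'v aut = "{f :: 'v \<Rightarrow> 'v. bij f}"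
  morphisms ap Aut
  by blast

instantiation aut :: (type) group_add
begin

definition "0 = Aut id"
definition "a + b = Aut (ap a \<circ> ap b)"
definition "- a = Aut (inv_into UNIV (ap a))" for a :: "'a aut"
definition "a - b = a + - b" for a b :: "'a aut"

lemma bij_ap: "bij (ap a)"
  using ap[of a] by simp

instance
proof
  fix a b c :: "'a aut"
  show "a + b + c = a + (b + c)"
    by (simp add: plus_aut_def Aut_inverse bij_ap bij_comp o_assoc)
  show "0 + a = a"
    by (simp add: zero_aut_def plus_aut_def Aut_inverse ap_inverse)
  show "a + 0 = a"
    by (simp add: zero_aut_def plus_aut_def Aut_inverse ap_inverse)
  show "- a + a = 0"
    by (simp add: zero_aut_def plus_aut_def uminus_aut_def Aut_inverse bij_ap bij_imp_bij_inv
        inv_o_cancel bij_is_inj)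
  show "a + - b = a - b"
    by (simp add: minus_aut_def)
qed

end

lemma ap_zero [simp]: "ap 0 v = v"
  by (simp add: zero_aut_def Aut_inverse)

lemma ap_add [simp]: "ap (a + b) v = ap a (ap b v)"
  by (simp add: plus_aut_def Aut_inverse bij_ap bij_comp)

lemma ap_diff [simp]: "ap (a - b) v = ap a (ap (- b) v)"
  by (subst minus_aut_def) (rule ap_add)

lemma ap_ap_minus [simp]: "ap a (ap (- a) v) = v"
  by (metis ap_add ap_zero right_minus)

lemma ap_minus_ap [simp]: "ap (- a) (ap a v) = v"
  by (metis ap_add ap_zero left_minus)

lemma aut_eqI: "(\<And>v. ap a v = ap b v) \<Longrightarrow> a = b"
  by (simp add: ap_inject[symmetric] fun_eq_iff)

section \<open>Vectors over a commutative ring and the standard symplectic form\<close>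

definition scale :: "'b \<Rightarrow> (nat \<Rightarrow> 'b) \<Rightarrow> nat \<Rightarrow> 'b::comm_ring_1" (infixr \<open>*s\<close> 75) where
  "x *s v = (\<lambda>i. x * v i)"

definition bv :: "nat \<Rightarrow> nat \<Rightarrow> 'b::comm_ring_1" where
  "bv j = (\<lambda>i. if i = j then 1 else 0)"

definition supp_below :: "nat \<Rightarrow> (nat \<Rightarrow> 'b::zero) \<Rightarrow> bool" where
  "supp_below k v \<longleftrightarrow> (\<forall>i\<ge>2 * k. v i = 0)"

definition om :: "nat \<Rightarrow> (nat \<Rightarrow> 'b) \<Rightarrow> (nat \<Rightarrow> 'b) \<Rightarrow> 'b::comm_ring_1" where
  "om k v w = (\<Sum>i<k. v (2 * i) * w (2 * i + 1) - v (2 * i + 1) * w (2 * i))"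

lemma scale_apply: "(x *s v) i = x * v i"
  by (simp add: scale_def)

lemma bv_apply: "bv j i = (if i = j then 1 else 0)"
  by (simp add: bv_def)

lemma scale_1 [simp]: "1 *s v = v" and scale_m1 [simp]: "(- 1) *s v = - v" and scale_0 [simp]: "0 *s v = 0"
  and scale_zero [simp]: "x *s (0 :: nat \<Rightarrow> 'b::comm_ring_1) = 0"
  by (auto simp: scale_def fun_eq_iff)

lemma scale_scale: "x *s y *s v = (x * y) *s v"
  by (auto simp: scale_def fun_eq_iff mult.assoc)

lemma minus_scale: "(- x) *s v = - (x *s v)"
  by (auto simp: scale_def fun_eq_iff)

declare plus_fun_apply [simp del] zero_fun_apply [simp del] minus_apply [simp del] uminus_apply [simp del]

lemmas vec_simps = scale_apply bv_apply plus_fun_apply zero_fun_apply minus_apply uminus_apply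

lemma om_add_left [simp]: "om k (u + v) w = om k u w + om k v w"
  by (simp add: om_def vec_simps sum.distrib[symmetric] algebra_simps)

lemma om_add_right [simp]: "om k w (u + v) = om k w u + om k w v"
  by (simp add: om_def vec_simps sum.distrib[symmetric] algebra_simps)

lemma om_scale_left [simp]: "om k (x *s v) w = x * om k v w"
  by (simp add: om_def vec_simps sum_distrib_left algebra_simps)

lemma om_scale_right [simp]: "om k w (x *s v) = x * om k w v"
  by (simp add: om_def vec_simps sum_distrib_left algebra_simps)

lemma om_diff_left [simp]: "om k (u - v) w = om k u w - om k v w"
  by (simp add: om_def vec_simps sum_subtractf[symmetric] algebra_simps)

lemma om_diff_right [simp]: "om k w (u - v) = om k w u - om k w v"
  by (simp add: om_def vec_simps sum_subtractf[symmetric] algebra_simps)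

lemma om_self [simp]: "om k v v = 0"
  by (simp add: om_def vec_simps mult.commute)

lemma om_zero [simp]: "om k 0 v = 0" "om k v 0 = 0"
  by (simp_all add: om_def vec_simps)

lemma om_swap: "om k v w = - om k w v"
  by (simp add: om_def vec_simps sum_negf[symmetric] algebra_simps)

lemma om_swap_eq_0: "om k v w = 0 \<longleftrightarrow> om k w v = 0"
  by (metis om_swap neg_equal_0_iff_equal)

lemma om_Suc: "om (Suc k) v w = om k v w + (v (2 * k) * w (2 * k + 1) - v (2 * k + 1) * w (2 * k))"
  by (simp add: om_def)

lemma om_bv_right: "i < 2 * k \<Longrightarrow> om k v (bv i) = (if even i then - v (i + 1) else v (i - 1))"
proof (induction k)
  case (Suc k)
  consider "i < 2 * k" | "i = 2 * k" | "i = 2 * k + 1" using Suc.prems by fastforce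
  then show ?case
  proof cases
    case 1
    then show ?thesis using Suc.IH by (simp add: om_Suc vec_simps)
  next
    case 2
    then have "om k v (bv i) = 0" by (auto simp: om_def vec_simps intro!: sum.neutral)
    with 2 show ?thesis by (simp add: om_Suc) (simp add: vec_simps)
  next
    case 3
    then have "om k v (bv i) = 0" by (auto simp: om_def vec_simps intro!: sum.neutral)
    with 3 show ?thesis by (simp add: om_Suc) (simp add: vec_simps)
  qed
qed simp

lemma om_bv_left: "i < 2 * k \<Longrightarrow> om k (bv i) v = (if even i then v (i + 1) else - v (i - 1))"
  by (subst om_swap) (simp add: om_bv_right)

lemma om_cong: "(\<And>i. i < 2 * k \<Longrightarrow> v i = v' i) \<Longrightarrow> (\<And>i. i < 2 * k \<Longrightarrow> w i = w' i) \<Longrightarrow> om k v w = om k v' w'"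
  by (auto simp: om_def vec_simps intro!: sum.cong)

lemma sigma_sigma [simp]: "sigma (sigma i) = i"
  by (auto simp: sigma_def elim!: oddE)

lemma sigma_neq [simp]: "sigma i \<noteq> i" "i \<noteq> sigma i"
  by (auto simp: sigma_def elim!: oddE)

lemma sigma_eq_iff [simp]: "sigma i = sigma j \<longleftrightarrow> i = j"
  by (metis sigma_sigma)

lemma sigma_less [simp]: "sigma i < 2 * k \<longleftrightarrow> i < 2 * k"
  by (auto simp: sigma_def elim!: oddE evenE)

lemma sigma_eq_swap: "sigma i = j \<longleftrightarrow> i = sigma j"
  by auto

lemma om_bv_sigma: "i < 2 * k \<Longrightarrow> om k v (bv i) = - ((- 1) ^ i * v (sigma i))"
  by (simp add: om_bv_right sigma_def)

text \<open>The elementary symplectic matrices act on infinite sequences, so that the groups of all ranks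
  live in one type and lower rank groups are subsets.\<close>

definition elf :: "nat \<Rightarrow> nat \<Rightarrow> 'b \<Rightarrow> (nat \<Rightarrow> 'b) \<Rightarrow> nat \<Rightarrow> 'b::comm_ring_1" where
  "elf i j x v = (if i = sigma j then v + (x * v j) *s bv i
     else v + (x * v j) *s bv i - ((- 1) ^ (i + j) * x * v (sigma i)) *s bv (sigma j))"

lemma elf_elf: "i \<noteq> j \<Longrightarrow> elf i j x (elf i j y v) = elf i j (x + y) v"
  by (rule ext) (auto simp: vec_simps elf_def algebra_simps)

lemma elf_zero [simp]: "elf i j 0 v = v"
  by (rule ext) (auto simp: vec_simps elf_def)

lemma bij_elf: "i \<noteq> j \<Longrightarrow> bij (elf i j x)"
  by (rule o_bij[of "elf i j (- x)"]) (auto simp: elf_elf fun_eq_iff)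

text \<open>The value \<open>0\<close> on the diagonal keeps \<open>el_add\<close> and
  \<open>el_minus\<close> free of side conditions.\<close>

definition el :: "nat \<Rightarrow> nat \<Rightarrow> 'b \<Rightarrow> (nat \<Rightarrow> 'b::comm_ring_1) aut" where
  "el i j x = (if i = j then 0 else Aut (elf i j x))"

lemma el_same [simp]: "el i i x = 0"
  by (simp add: el_def)

lemma ap_el [simp]: "i \<noteq> j \<Longrightarrow> ap (el i j x) v = elf i j x v"
  by (simp add: el_def Aut_inverse bij_elf)

lemma el_add: "el i j (x + y) = el i j x + el i j y"
  by (cases "i = j") (auto intro!: aut_eqI simp: elf_elf)

lemma el_0 [simp]: "el i j 0 = 0"
  by (cases "i = j") (auto intro!: aut_eqI)

lemma el_minus: "el i j (- x) = - el i j x"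
  using el_add[of i j x "- x"] by (simp add: minus_unique)

lemma elf_linear: "elf i j x (v + y *s w) = elf i j x v + y *s elf i j x w"
  by (rule ext) (auto simp: vec_simps elf_def algebra_simps)

lemma om_elf:
  fixes x :: "'a::comm_ring_1"
  assumes "i < 2 * k" "j < 2 * k" "i \<noteq> j"
  shows "om k (elf i j x v) (elf i j x w) = om k v w"
proof -
  have l: "om k (bv a) u = (- 1) ^ a * u (sigma a)" if "a < 2 * k" for a and u :: "nat \<Rightarrow> 'a"
    using that by (subst om_swap) (simp add: om_bv_sigma)
  have e: "(- 1) ^ sigma j = - ((- 1) ^ j :: 'a)"
    by (cases "even j") (auto simp: sigma_def)
  have s: "(- 1) ^ j * ((- 1) ^ j * y) = y" for y :: 'a
    by (simp add: mult.assoc[symmetric] power_add[symmetric])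
  have r: "om k u (bv i) = - ((- 1) ^ i * u (sigma i))" "om k u (bv (sigma j)) = (- 1) ^ j * u j"
      "om k (bv i) u = (- 1) ^ i * u (sigma i)" "om k (bv (sigma j)) u = - ((- 1) ^ j * u j)" for u :: "nat \<Rightarrow> 'a"
    using assms by (simp_all add: om_bv_sigma l e)
  show ?thesis
    using assms
    by (cases "i = sigma j") (auto simp: elf_def r s bv_apply power_add sigma_eq_swap algebra_simps)
qed

text \<open>Inverses of generators are generators with negated parameter, so left multiplication by
  generators already produces a group, and inductions have a single step.\<close>

inductive_set G :: "nat \<Rightarrow> (nat \<Rightarrow> 'b::comm_ring_1) aut set" for k where
  G_0: "0 \<in> G k"
| G_step: "i < 2 * k \<Longrightarrow> j < 2 * k \<Longrightarrow> i \<noteq> j \<Longrightarrow> g \<in> G k \<Longrightarrow> el i j x + g \<in> G k"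

lemma G_el: "i < 2 * k \<Longrightarrow> j < 2 * k \<Longrightarrow> i \<noteq> j \<Longrightarrow> el i j x \<in> G k"
  using G_step[OF _ _ _ G_0] by fastforce

lemma G_add: "g \<in> G k \<Longrightarrow> h \<in> G k \<Longrightarrow> g + h \<in> G k"
  by (induction rule: G.induct) (auto simp: add.assoc intro: G_step)

lemma G_minus: "g \<in> G k \<Longrightarrow> - g \<in> G k"
proof (induction rule: G.induct)
  case (G_step i j g x)
  have "- (el i j x + g) = - g + el i j (- x)" by (simp add: el_minus minus_add)
  then show ?case using G_step by (auto intro: G_add G_el)
qed (auto intro: G_0)

lemma G_diff: "g \<in> G k \<Longrightarrow> h \<in> G k \<Longrightarrow> g - h \<in> G k"
  unfolding diff_conv_add_uminus by (rule G_add[OF _ G_minus])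

lemma G_mono: "g \<in> G k \<Longrightarrow> k \<le> l \<Longrightarrow> g \<in> G l"
  by (induction rule: G.induct) (auto intro!: G_step G_0)

lemma G_linear: "g \<in> G k \<Longrightarrow> ap g (v + y *s w) = ap g v + y *s ap g w"
proof (induction rule: G.induct)
  case (G_step i j g x)
  then show ?case by (simp add: elf_linear)
qed simp

lemma G_zero_vec: "g \<in> G k \<Longrightarrow> ap g 0 = 0"
proof (induction rule: G.induct)
  case (G_step i j g x)
  then show ?case by (simp add: fun_eq_iff elf_def vec_simps)
qed simp

lemma G_scale: "g \<in> G k \<Longrightarrow> ap g (y *s w) = y *s ap g w"
  using G_linear[of g k 0 y w] by (simp add: G_zero_vec)

lemma G_vec_add: "g \<in> G k \<Longrightarrow> ap g (v + w) = ap g v + ap g w"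
  using G_linear[of g k v 1 w] by simp

lemma G_fix: "g \<in> G k \<Longrightarrow> (\<And>i. i < 2 * k \<Longrightarrow> v i = 0) \<Longrightarrow> ap g v = v"
proof (induction rule: G.induct)
  case (G_step i j g x)
  then show ?case by (auto simp: elf_def fun_eq_iff vec_simps)
qed simp

lemma G_high: "g \<in> G k \<Longrightarrow> 2 * k \<le> i \<Longrightarrow> ap g v i = v i"
proof (induction rule: G.induct)
  case (G_step a b g x)
  then have "i \<noteq> a" "i \<noteq> sigma b" using sigma_less[of b k] by (auto simp del: sigma_less)
  then show ?case using G_step by (simp add: elf_def vec_simps)
qed simp

lemma om_G: "g \<in> G k \<Longrightarrow> om k (ap g v) (ap g w) = om k v w"
  by (induction rule: G.induct) (auto simp: om_elf)

lemma supp_G: "g \<in> G k \<Longrightarrow> k \<le> l \<Longrightarrow> supp_below l v \<Longrightarrow> supp_below l (ap g v)"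
  by (auto simp: supp_below_def G_high)

text \<open>The elements of the Heisenberg group, the unipotent radical of the stabilizer of
  \<^term>\<open>bv (2 * r)\<close> in rank \<open>r + 1\<close>.\<close>

definition hsf :: "nat \<Rightarrow> (nat \<Rightarrow> 'b) \<Rightarrow> 'b \<Rightarrow> (nat \<Rightarrow> 'b) \<Rightarrow> nat \<Rightarrow> 'b::comm_ring_1" where
  "hsf r w c v = v + v (2 * r + 1) *s w + (om r w v + c * v (2 * r + 1)) *s bv (2 * r)"

lemma om_bv_high: "2 * r \<le> i \<Longrightarrow> om r w (bv i) = 0" "2 * r \<le> i \<Longrightarrow> om r (bv i) w = 0"
  by (auto simp: om_def vec_simps intro!: sum.neutral)

text \<open>\<open>om r w\<close> ignores the coordinates from \<open>2 * r\<close> on and sees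
  \<open>hsf r w' c' v\<close> only as \<open>v + v (2 * r + 1) *s w'\<close>. The term this adds is
  the Heisenberg cocycle \<open>om r w w'\<close>.\<close>

lemma hsf_hsf:
  assumes "supp_below r w" "supp_below r w'"
  shows "hsf r w c (hsf r w' c' v) = hsf r (w + w') (c + c' + om r w w') v"
proof -
  have "hsf r w' c' v (2 * r + 1) = v (2 * r + 1)"
    using assms by (simp add: hsf_def supp_below_def vec_simps)
  moreover have "om r w (hsf r w' c' v) = om r w v + v (2 * r + 1) * om r w w'"
    by (simp add: hsf_def om_bv_high)
  ultimately show ?thesis
    unfolding hsf_def[of r w c "hsf r w' c' v"]
    by (intro ext) (simp add: hsf_def vec_simps algebra_simps)
qed

lemma hsf_0 [simp]: "hsf r 0 0 v = v"
  by (intro ext) (simp add: hsf_def vec_simps)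

lemma supp_below_minus [simp]: "supp_below r (- w) = supp_below r (w :: nat \<Rightarrow> 'b::comm_ring_1)"
  by (simp add: supp_below_def vec_simps)

lemma supp_below_add: "supp_below r v \<Longrightarrow> supp_below r w \<Longrightarrow> supp_below r (v + w)" for v :: "nat \<Rightarrow> 'b::comm_ring_1"
  by (simp add: supp_below_def vec_simps)

lemma supp_below_diff: "supp_below r v \<Longrightarrow> supp_below r w \<Longrightarrow> supp_below r (v - w)" for v :: "nat \<Rightarrow> 'b::comm_ring_1"
  by (simp add: supp_below_def vec_simps)

lemma supp_below_scale: "supp_below r v \<Longrightarrow> supp_below r (c *s v)"
  by (simp add: supp_below_def vec_simps)

lemma supp_below_bv: "i < 2 * r \<Longrightarrow> supp_below r (bv i)"
  by (simp add: supp_below_def vec_simps)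

lemma supp_below_0 [simp]: "supp_below r 0"
  by (simp add: supp_below_def vec_simps)

lemma supp_below_mono: "supp_below r v \<Longrightarrow> r \<le> s \<Longrightarrow> supp_below s v"
  by (simp add: supp_below_def vec_simps)

lemma om_minus_right [simp]: "om k v (- w) = - om k v w"
  by (simp add: om_def vec_simps sum_negf[symmetric] algebra_simps)

lemma om_minus_left [simp]: "om k (- v) w = - om k v w"
  by (simp add: om_def vec_simps sum_negf[symmetric] algebra_simps)

lemma bij_hsf: "supp_below r w \<Longrightarrow> bij (hsf r w c)"
  by (rule o_bij[of "hsf r (- w) (- c)"]) (auto simp: hsf_hsf fun_eq_iff)

definition hs :: "nat \<Rightarrow> (nat \<Rightarrow> 'b) \<Rightarrow> 'b \<Rightarrow> (nat \<Rightarrow> 'b::comm_ring_1) aut" where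
  "hs r w c = (if supp_below r w then Aut (hsf r w c) else 0)"

lemma ap_hs [simp]: "supp_below r w \<Longrightarrow> ap (hs r w c) v = hsf r w c v"
  by (simp add: hs_def Aut_inverse bij_hsf)

lemma hs_add:
  "supp_below r w \<Longrightarrow> supp_below r w' \<Longrightarrow> hs r w c + hs r w' c' = hs r (w + w') (c + c' + om r w w')"
  by (rule aut_eqI) (simp add: hsf_hsf supp_below_add)

lemma hs_0 [simp]: "hs r 0 0 = 0"
  by (rule aut_eqI) simp

lemma hs_minus: "supp_below r w \<Longrightarrow> - hs r w c = hs r (- w) (- c)"
  by (rule minus_unique) (simp add: hs_add)

lemma hs_conj:
  assumes g: "g \<in> G r" and w: "supp_below r w"
  shows "g + hs r w c - g = hs r (ap g w) c"
proof (rule aut_eqI)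
  fix v
  define u where "u = ap (- g) v"
  have v: "v = ap g u" by (simp add: u_def)
  have gw: "supp_below r (ap g w)" using supp_G[OF g order_refl w] .
  have "ap (g + hs r w c - g) v = ap g (hsf r w c u)"
    using w by (simp add: u_def)
  also have "\<dots> = v + u (2 * r + 1) *s ap g w + (om r w u + c * u (2 * r + 1)) *s ap g (bv (2 * r))"
    unfolding hsf_def v G_vec_add[OF g] G_scale[OF g] ..
  also have "ap g (bv (2 * r)) = bv (2 * r)"
    by (rule G_fix[OF g]) (simp add: vec_simps)
  also have "u (2 * r + 1) = v (2 * r + 1)"
    using G_high[OF g, of "2 * r + 1" u] by (simp add: v)
  also have "om r w u = om r (ap g w) v"
    using om_G[OF g] by (simp add: v)
  finally show "ap (g + hs r w c - g) v = ap (hs r (ap g w) c) v"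
    using gw by (simp add: hsf_def)
qed

lemma hs_single:
  fixes x :: "'a::comm_ring_1"
  assumes j: "j < 2 * r"
  shows "hs r (x *s bv j) 0 = el (2 * r) (sigma j) ((- 1) ^ j * x)"
proof (rule aut_eqI)
  fix v :: "nat \<Rightarrow> 'a"
  have "supp_below r (x *s bv j)" using j by (auto intro: supp_below_scale supp_below_bv)
  moreover have "2 * r \<noteq> j" "2 * r \<noteq> sigma j" using j sigma_less[of j r] by (auto simp del: sigma_less)
  moreover have "(- 1) ^ j * ((- 1) ^ j * x) = x"
    by (simp add: mult.assoc[symmetric] power_add[symmetric])
  moreover have "(- 1) ^ sigma j = - ((- 1) ^ j :: 'a)"
    by (cases "even j") (auto simp: sigma_def)
  moreover have "om r (bv j) v = (- 1) ^ j * v (sigma j)"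
    using j by (subst om_swap) (simp add: om_bv_sigma)
  moreover have "sigma (2 * r) = 2 * r + 1" by (simp add: sigma_def)
  ultimately show "ap (hs r (x *s bv j) 0) v = ap (el (2 * r) (sigma j) ((- 1) ^ j * x)) v"
    by (intro ext) (simp add: hsf_def elf_def vec_simps algebra_simps power_add)
qed

lemma hs_centre: "hs r 0 c = el (2 * r) (2 * r + 1) c"
  by (rule aut_eqI) (auto simp: hsf_def elf_def sigma_def vec_simps intro!: ext)

text \<open>Coordinates of \<open>w\<close> are split off from the top, each a short root element by
  \<open>hs_single\<close>, until the centre, a long root element, is left. \<open>J\<close> is the
  ideal of admissible parameters: \<open>UNIV\<close> gives membership in \<open>G\<close>, the
  kernel of \<open>\<pi>\<close> membership in \<open>E\<close>.\<close>

lemma hs_induct: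
  assumes w: "supp_below r w" and S: "\<And>g h. g \<in> S \<Longrightarrow> h \<in> S \<Longrightarrow> g + h \<in> S"
    and el: "\<And>j x. j < 2 * r + 2 \<Longrightarrow> j \<noteq> 2 * r \<Longrightarrow> x \<in> J \<Longrightarrow> el (2 * r) j x \<in> S"
    and J: "0 \<in> J" "\<And>x y. x \<in> J \<Longrightarrow> y \<in> J \<Longrightarrow> x - y \<in> J" "\<And>x y. x \<in> J \<Longrightarrow> y * x \<in> J"
    and wc: "\<And>i. w i \<in> J" "c \<in> J"
  shows "hs r w c \<in> S"
proof -
  have "hs r w c \<in> S" if "n \<le> 2 * r" "\<forall>i\<ge>n. w i = 0" "\<forall>i. w i \<in> J" "c \<in> J" for n w c
    using that
  proof (induction n arbitrary: w c)
    case 0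
    then have w: "w = 0" by (intro ext) (simp add: vec_simps)
    show ?case unfolding w using el[of "2 * r + 1" c] 0 by (simp add: hs_centre)
  next
    case (Suc n)
    define w' where "w' = w(n := 0)"
    define z where "z = w n *s bv n"
    \<comment> \<open>Compensates the cocycle created by writing \<open>w\<close> as
      \<open>w' + z\<close>.\<close>
    define c' where "c' = c - om r w' z"
    have w: "w = w' + z" by (auto simp: w'_def z_def fun_eq_iff vec_simps)
    have sup: "supp_below r w'" "supp_below r z"
      using Suc.prems by (auto simp: w'_def z_def supp_below_def vec_simps)
    have "om r w' z = w n * om r w' (bv n)" by (simp add: z_def)
    also have "\<dots> \<in> J" using J(3)[of "w n" "om r w' (bv n)"] Suc.prems by (simp add: mult.commute)
    finally have c': "c' \<in> J" using J(2) Suc.prems by (simp add: c'_def)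
    have "hs r w' c' \<in> S"
      using Suc.prems c' J by (intro Suc.IH) (auto simp: w'_def Suc_le_eq)
    moreover have "hs r z 0 \<in> S"
    proof -
      have n: "n < 2 * r" using Suc.prems by simp
      then have "sigma n < 2 * r" by simp
      then have s: "sigma n < 2 * r + 2" "sigma n \<noteq> 2 * r" by linarith+
      show ?thesis
        unfolding z_def hs_single[OF n] using Suc.prems by (intro el[OF s] J) auto
    qed
    moreover have "hs r w' c' + hs r z 0 = hs r w c"
      using sup by (subst hs_add) (simp_all add: w c'_def)
    ultimately show ?case using S by metis
  qed
  from this[of "2 * r" w c] show ?thesis using w wc by (auto simp: supp_below_def)
qed

lemma hs_G: "supp_below r w \<Longrightarrow> hs r w c \<in> G (Suc r)"
  by (rule hs_induct[where J = UNIV]) (auto intro: G_add G_el)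

section \<open>Rank one subgroups\<close>

definition pr2 :: "'b \<Rightarrow> 'b \<Rightarrow> nat \<Rightarrow> 'b::comm_ring_1" where
  "pr2 x y = (\<lambda>i. if i = 0 then x else if i = 1 then y else 0)"

lemma pr2_simps [simp]: "pr2 x y 0 = x" "pr2 x y (Suc 0) = y" "pr2 x y 1 = y"
  by (simp_all add: pr2_def)

text \<open>\<^term>\<open>G (Suc 0)\<close> is the group of rank one; \<open>kap r\<close> embeds it along the long root of the plane
  of index \<open>r\<close>, and \<open>rho r\<close> along the short root mixing the planes of index \<open>r + 1\<close> and \<open>r\<close>.\<close>

definition kapf :: "nat \<Rightarrow> ((nat \<Rightarrow> 'b) \<Rightarrow> nat \<Rightarrow> 'b) \<Rightarrow> (nat \<Rightarrow> 'b) \<Rightarrow> nat \<Rightarrow> 'b::comm_ring_1" where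
  "kapf r \<phi> v = (\<lambda>i. if i = 2 * r then \<phi> (pr2 (v (2 * r)) (v (2 * r + 1))) 0
     else if i = 2 * r + 1 then \<phi> (pr2 (v (2 * r)) (v (2 * r + 1))) 1 else v i)"

text \<open>On the dual coordinates the rank one group has to act by the contragredient. In the
  reordered pair \<open>(v (2 * r + 1), - v (2 * r + 3))\<close> the inverse transpose of a matrix
  of determinant 1 becomes that matrix again, so the same \<open>\<phi>\<close> serves on both
  halves.\<close>

definition rhof :: "nat \<Rightarrow> ((nat \<Rightarrow> 'b) \<Rightarrow> nat \<Rightarrow> 'b) \<Rightarrow> (nat \<Rightarrow> 'b) \<Rightarrow> nat \<Rightarrow> 'b::comm_ring_1" where
  "rhof r \<phi> v = (\<lambda>i. if i = 2 * r + 2 then \<phi> (pr2 (v (2 * r + 2)) (v (2 * r))) 0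
     else if i = 2 * r then \<phi> (pr2 (v (2 * r + 2)) (v (2 * r))) 1
     else if i = 2 * r + 1 then \<phi> (pr2 (v (2 * r + 1)) (- v (2 * r + 3))) 0
     else if i = 2 * r + 3 then - \<phi> (pr2 (v (2 * r + 1)) (- v (2 * r + 3))) 1
     else v i)"

lemma pr2_G1: "g \<in> G 1 \<Longrightarrow> pr2 (ap g (pr2 x y) 0) (ap g (pr2 x y) (Suc 0)) = ap g (pr2 x y)"
  using G_high[of g 1] by (auto simp: fun_eq_iff pr2_def)

lemma kapf_add: "h \<in> G 1 \<Longrightarrow> kapf r (ap g) (kapf r (ap h) v) = kapf r (ap (g + h)) v"
  by (rule ext) (simp add: kapf_def pr2_G1)

lemma rhof_add: "h \<in> G 1 \<Longrightarrow> rhof r (ap g) (rhof r (ap h) v) = rhof r (ap (g + h)) v"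
  by (rule ext) (simp add: rhof_def pr2_G1 numeral_3_eq_3)

lemma kapf_0: "kapf r (ap 0) v = v"
  by (rule ext) (simp add: kapf_def)

lemma rhof_0: "rhof r (ap 0) v = v"
  by (rule ext) (simp add: rhof_def)

definition kap :: "nat \<Rightarrow> (nat \<Rightarrow> 'b) aut \<Rightarrow> (nat \<Rightarrow> 'b::comm_ring_1) aut" where
  "kap r g = (if g \<in> G 1 then Aut (kapf r (ap g)) else 0)"

definition rho :: "nat \<Rightarrow> (nat \<Rightarrow> 'b) aut \<Rightarrow> (nat \<Rightarrow> 'b::comm_ring_1) aut" where
  "rho r g = (if g \<in> G 1 then Aut (rhof r (ap g)) else 0)"

lemma ap_kap: "g \<in> G 1 \<Longrightarrow> ap (kap r g) v = kapf r (ap g) v"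
proof -
  assume g: "g \<in> G 1"
  have "bij (kapf r (ap g))"
    using g G_minus[OF g]
    by (intro o_bij[of "kapf r (ap (- g))"]) (auto simp: kapf_add fun_eq_iff kapf_0 del: ext)
  then show ?thesis using g by (simp add: kap_def Aut_inverse)
qed

lemma ap_rho: "g \<in> G 1 \<Longrightarrow> ap (rho r g) v = rhof r (ap g) v"
proof -
  assume g: "g \<in> G 1"
  have "bij (rhof r (ap g))"
    using g G_minus[OF g]
    by (intro o_bij[of "rhof r (ap (- g))"]) (auto simp: rhof_add fun_eq_iff rhof_0 del: ext)
  then show ?thesis using g by (simp add: rho_def Aut_inverse)
qed

lemma kap_add: "g \<in> G 1 \<Longrightarrow> h \<in> G 1 \<Longrightarrow> kap r (g + h) = kap r g + kap r h"
  by (rule aut_eqI) (simp add: ap_kap G_add kapf_add)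

lemma rho_add: "g \<in> G 1 \<Longrightarrow> h \<in> G 1 \<Longrightarrow> rho r (g + h) = rho r g + rho r h"
  by (rule aut_eqI) (simp add: ap_rho G_add rhof_add)

lemma kap_0 [simp]: "kap r 0 = 0"
  by (rule aut_eqI) (simp add: ap_kap G_0 kapf_0)

lemma rho_0 [simp]: "rho r 0 = 0"
  by (rule aut_eqI) (simp add: ap_rho G_0 rhof_0)

lemma kap_minus: "g \<in> G 1 \<Longrightarrow> kap r (- g) = - kap r g"
  by (rule minus_unique[symmetric]) (simp add: kap_add[symmetric] G_minus)

lemma rho_minus: "g \<in> G 1 \<Longrightarrow> rho r (- g) = - rho r g"
  by (rule minus_unique[symmetric]) (simp add: rho_add[symmetric] G_minus)

abbreviation X :: "'b \<Rightarrow> (nat \<Rightarrow> 'b::comm_ring_1) aut" where "X f \<equiv> el 0 (Suc 0) f"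
abbreviation Y :: "'b \<Rightarrow> (nat \<Rightarrow> 'b::comm_ring_1) aut" where "Y f \<equiv> el (Suc 0) 0 f"

lemma elf_X: "elf 0 (Suc 0) f v = v(0 := v 0 + f * v 1)"
  by (auto simp: elf_def sigma_def vec_simps fun_eq_iff)

lemma elf_Y: "elf (Suc 0) 0 f v = v(1 := v 1 + f * v 0)"
  by (auto simp: elf_def sigma_def vec_simps fun_eq_iff)

lemma X_G [simp]: "X f \<in> G (Suc 0)" and Y_G [simp]: "Y f \<in> G (Suc 0)"
  by (auto intro: G_el)

lemma kap_X: "kap r (X f) = el (2 * r) (2 * r + 1) f"
  by (rule aut_eqI) (auto simp: ap_kap kapf_def elf_X intro!: ext, auto simp: elf_def sigma_def vec_simps)

lemma kap_Y: "kap r (Y f) = el (2 * r + 1) (2 * r) f"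
  by (rule aut_eqI) (auto simp: ap_kap kapf_def elf_Y intro!: ext, auto simp: elf_def sigma_def vec_simps)

lemma rho_X: "rho r (X f) = el (2 * r + 2) (2 * r) f"
  by (rule aut_eqI) (auto simp: ap_rho rhof_def elf_X intro!: ext, auto simp: elf_def sigma_def vec_simps numeral_3_eq_3)

lemma rho_Y: "rho r (Y f) = el (2 * r) (2 * r + 2) f"
  by (rule aut_eqI) (auto simp: ap_rho rhof_def elf_Y intro!: ext, auto simp: elf_def sigma_def vec_simps numeral_3_eq_3)

lemma G1_induct [consumes 1, case_names zero X Y]:
  assumes "g \<in> G (Suc 0)" "P 0"
    "\<And>f g. g \<in> G (Suc 0) \<Longrightarrow> P g \<Longrightarrow> P (X f + g)" "\<And>f g. g \<in> G (Suc 0) \<Longrightarrow> P g \<Longrightarrow> P (Y f + g)"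
  shows "P g"
  using assms(1)
proof (induction rule: G.induct)
  case (G_step i j g x)
  then have "i = 0 \<and> j = Suc 0 \<or> i = Suc 0 \<and> j = 0" by auto
  then show ?case using assms G_step by auto
qed (use assms in auto)

lemma kap_G: "g \<in> G (Suc 0) \<Longrightarrow> r < k \<Longrightarrow> kap r g \<in> G k"
  by (induction rule: G1_induct) (auto simp: kap_add kap_X kap_Y intro!: G_0 G_add G_el)

lemma rho_G: "g \<in> G (Suc 0) \<Longrightarrow> r + 1 < k \<Longrightarrow> rho r g \<in> G k"
  by (induction rule: G1_induct) (auto simp: rho_add rho_X rho_Y intro!: G_0 G_add G_el)

section \<open>Weyl and diagonal elements in rank one\<close>

definition W :: "(nat \<Rightarrow> 'b::comm_ring_1) aut" where "W = X 1 + Y (- 1) + X 1"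

lemma W_G [simp]: "W \<in> G (Suc 0)"
  by (auto simp: W_def intro!: G_add)

lemma ap_W: "ap W v = v(0 := v 1, 1 := - v 0)"
  by (auto simp: W_def elf_X elf_Y fun_eq_iff)

lemma ap_minus_W: "ap (- W) v = v(0 := - v 1, 1 := v 0)"
proof -
  have "v = ap W (v(0 := - v 1, 1 := v 0))" by (auto simp: ap_W fun_eq_iff)
  then show ?thesis by (metis ap_minus_ap)
qed

lemma unit_cancel: "u * u' = 1 \<Longrightarrow> u * (u' * x) = x" "u * u' = 1 \<Longrightarrow> u' * (u * x) = x" for u :: "'b::comm_ring_1"
  by (metis mult.assoc mult.commute mult_1)+

text \<open>A word in root elements for the diagonal matrix with entries \<open>u\<close> and
  \<open>u'\<close>; it is elementary for any parameters and becomes diagonal once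
  \<open>u * u' = 1\<close>.\<close>

definition D :: "'b \<Rightarrow> 'b \<Rightarrow> (nat \<Rightarrow> 'b::comm_ring_1) aut" where "D u u' = X u + Y (- u') + X u - W"

lemma D_G [simp]: "D u u' \<in> G (Suc 0)"
  by (auto simp: D_def intro!: G_add G_diff)

lemma ap_D: "u * u' = 1 \<Longrightarrow> ap (D u u') v = v(0 := u * v 0, 1 := u' * v 1)"
  by (auto simp: D_def elf_X elf_Y ap_minus_W fun_eq_iff unit_cancel algebra_simps)

lemma Y_conv: "Y f = - W + X (- f) + W"
  by (rule aut_eqI) (auto simp: ap_W ap_minus_W elf_X elf_Y fun_eq_iff)

lemma minus_W_conv: "- W = D (- 1) (- 1) + W"
  by (rule aut_eqI) (auto simp: ap_W ap_minus_W ap_D fun_eq_iff)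

lemma D_W: "u * u' = 1 \<Longrightarrow> D u u' + W = W + D u' u"
  by (rule aut_eqI) (auto simp: ap_W ap_D fun_eq_iff mult.commute[of u'])

lemma D_X: "u * u' = 1 \<Longrightarrow> D u u' + X f = X (u * u * f) + D u u'"
  by (rule aut_eqI) (auto simp: elf_X ap_D fun_eq_iff unit_cancel algebra_simps)

lemma D_D: "u * u' = 1 \<Longrightarrow> v * v' = 1 \<Longrightarrow> D u u' + D v v' = D (u * v) (u' * v')"
proof (rule aut_eqI)
  fix w assume u: "u * u' = 1" and v: "v * v' = 1"
  then have "(u * v) * (u' * v') = 1" by (simp add: unit_cancel mult_ac)
  then show "ap (D u u' + D v v') w = ap (D (u * v) (u' * v')) w"
    using u v by (simp add: ap_D fun_eq_iff mult_ac)
qed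

text \<open>The rank one Bruhat relation for a unit parameter: of the two Weyl elements enclosing it
  only one survives.\<close>

lemma W_X_W: "u * u' = 1 \<Longrightarrow> W + X u + W = D (- 1) (- 1) + X (- u') + D u' u + W + X (- u')"
  by (rule aut_eqI) (auto simp: ap_W ap_D elf_X fun_eq_iff unit_cancel algebra_simps)

lemma W_W: "W + W = D (- 1) (- 1)"
  by (rule aut_eqI) (auto simp: ap_W ap_D fun_eq_iff)

lemma poly_unit: "p * q = 1 \<Longrightarrow> degree p = 0 \<and> p \<noteq> 0" for p q :: "'k::field poly"
  by (metis add_is_0 degree_1 degree_mult_eq mult_eq_0_iff zero_neq_one)

section \<open>Reduction to polynomials over a field\<close>

text \<open>\<open>unit_lift\<close> carries the locality of the base ring: the units of
  \<open>k[X]\<close> are the nonzero constants, and a representative outside the maximal ideal is a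
  unit.\<close>

locale reduction =
  fixes \<pi> :: "'a::comm_ring_1 \<Rightarrow> 'b::field poly"
  assumes pi_add [simp]: "\<pi> (x + y) = \<pi> x + \<pi> y"
    and pi_mult [simp]: "\<pi> (x * y) = \<pi> x * \<pi> y"
    and pi_1 [simp]: "\<pi> 1 = 1"
    and surj_pi: "surj \<pi>"
    and unit_lift: "c \<noteq> 0 \<Longrightarrow> \<exists>u u'. u * u' = 1 \<and> \<pi> u = [:c:]"
begin

lemma pi_0 [simp]: "\<pi> 0 = 0"
  by (metis add_cancel_right_right pi_add)

lemma pi_minus [simp]: "\<pi> (- x) = - \<pi> x"
  using pi_add[of x "- x"] by (simp add: add_eq_0_iff)

lemma pi_diff [simp]: "\<pi> (x - y) = \<pi> x - \<pi> y"
  using pi_add[of x "- y"] by simp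

lemma pi_power [simp]: "\<pi> (x ^ n) = \<pi> x ^ n"
  by (induction n) simp_all

lemma pi_sum: "\<pi> (sum f S) = (\<Sum>i\<in>S. \<pi> (f i))"
  by (induction S rule: infinite_finite_induct) simp_all

definition sec :: "'b poly \<Rightarrow> 'a" where "sec a = (SOME x. \<pi> x = a)"

lemma pi_sec [simp]: "\<pi> (sec a) = a"
  unfolding sec_def using surj_pi by (metis (mono_tags) surjD someI_ex)

definition red :: "(nat \<Rightarrow> 'a) \<Rightarrow> nat \<Rightarrow> 'b poly" where "red v = (\<lambda>i. \<pi> (v i))"

lemma red_apply: "red v i = \<pi> (v i)"
  by (simp add: red_def)

lemma red_bv [simp]: "red (bv i) = bv i"
  by (auto simp: red_def bv_apply)

lemma red_surj: "\<exists>v. red v = w"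
  by (rule exI[of _ "\<lambda>i. sec (w i)"]) (simp add: red_def)

lemma red_elf: "red (elf i j x v) = elf i j (\<pi> x) (red v)"
  by (rule ext) (auto simp: red_def elf_def vec_simps)

text \<open>The section \<open>sec\<close> is an arbitrary choice; \<open>red_ap\<close> shows that
  on elements of \<open>G k\<close> the choice is immaterial.\<close>

definition act :: "(nat \<Rightarrow> 'a) aut \<Rightarrow> (nat \<Rightarrow> 'b poly) \<Rightarrow> nat \<Rightarrow> 'b poly" where
  "act g w = red (ap g (\<lambda>i. sec (w i)))"

lemma red_sec [simp]: "red (\<lambda>i. sec (w i)) = w"
  by (simp add: red_def)

text \<open>Applying \<open>\<pi>\<close> to each parameter of a word for \<open>g\<close> gives an
  elementary element over \<open>k[X]\<close>. Linearity, invariance of the form and support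
  properties of \<open>act\<close> are inherited from it.\<close>

lemma act_lift:
  assumes "g \<in> G k"
  obtains g' where "g' \<in> G k" "act g = ap g'" "\<And>v. red (ap g v) = ap g' (red v)"
proof -
  have "\<exists>g'\<in>G k. \<forall>v. red (ap g v) = ap g' (red v)"
    using assms
  proof (induction rule: G.induct)
    case G_0
    show ?case by (rule bexI[of _ 0]) (auto intro: G.G_0)
  next
    case (G_step i j g x)
    then obtain g' where "g' \<in> G k" "\<forall>v. red (ap g v) = ap g' (red v)" by blast
    with G_step show ?case
      by (intro bexI[of _ "el i j (\<pi> x) + g'"]) (auto simp: red_elf intro: G.G_step)
  qed
  then obtain g' where g': "g' \<in> G k" "\<And>v. red (ap g v) = ap g' (red v)" by blast
  moreover have "act g = ap g'" by (rule ext) (simp add: act_def g')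
  ultimately show ?thesis using that by blast
qed

lemma red_ap: "g \<in> G k \<Longrightarrow> red (ap g v) = act g (red v)"
  by (rule act_lift) auto

lemma act_0 [simp]: "act 0 w = w"
  by (simp add: act_def)

lemma act_add: "g \<in> G k \<Longrightarrow> act (g + h) w = act g (act h w)"
  using red_ap[of g k "ap h (\<lambda>i. sec (w i))"] by (simp add: act_def)

lemma act_diff: "g \<in> G k \<Longrightarrow> act (g - h) w = act g (act (- h) w)"
  using act_add[of g k "- h" w] by simp

lemma act_minus_act [simp]: "g \<in> G k \<Longrightarrow> act (- g) (act g w) = w"
  using act_add[of "- g" k g w] by (simp add: G_minus)

lemma act_act_minus [simp]: "g \<in> G k \<Longrightarrow> act g (act (- g) w) = w"
  using act_add[of g k "- g" w] by simp

lemma act_el: "i \<noteq> j \<Longrightarrow> act (el i j x) w = elf i j (\<pi> x) w"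
  by (simp add: act_def red_elf)

lemma act_vec_add: "g \<in> G k \<Longrightarrow> act g (v + w) = act g v + act g w"
  by (rule act_lift) (auto simp: G_vec_add)

lemma act_scale: "g \<in> G k \<Longrightarrow> act g (c *s w) = c *s act g w"
  by (rule act_lift) (auto simp: G_scale)

lemma act_zero: "g \<in> G k \<Longrightarrow> act g 0 = 0"
  by (rule act_lift) (auto simp: G_zero_vec)

lemma act_fix: "g \<in> G k \<Longrightarrow> (\<And>i. i < 2 * k \<Longrightarrow> v i = 0) \<Longrightarrow> act g v = v"
  by (rule act_lift) (auto simp: G_fix)

lemma act_fix_bv: "g \<in> G k \<Longrightarrow> 2 * k \<le> i \<Longrightarrow> act g (bv i) = bv i"
  by (rule act_fix) (auto simp: bv_apply)

lemma act_high: "g \<in> G k \<Longrightarrow> 2 * k \<le> i \<Longrightarrow> act g v i = v i"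
  by (rule act_lift) (auto simp: G_high)

lemma om_act: "g \<in> G k \<Longrightarrow> om k (act g v) (act g w) = om k v w"
  by (rule act_lift) (auto simp: om_G)

lemma supp_act: "g \<in> G k \<Longrightarrow> k \<le> l \<Longrightarrow> supp_below l v \<Longrightarrow> supp_below l (act g v)"
  by (rule act_lift) (auto simp: supp_G)

lemma act_hs: "supp_below r w \<Longrightarrow> act (hs r w c) v = hsf r (red w) (\<pi> c) v"
  by (rule ext) (simp add: act_def red_def hsf_def vec_simps om_def pi_sum bv_apply)

lemma act_kap: "g \<in> G 1 \<Longrightarrow> act (kap r g) v = kapf r (act g) v"
proof -
  assume g: "g \<in> G 1"
  obtain u where u: "red u = v" using red_surj by blast
  have "red (pr2 (u (2 * r)) (u (2 * r + 1))) = pr2 (v (2 * r)) (v (2 * r + 1))"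
    by (auto simp: u[symmetric] red_def pr2_def)
  then have *: "\<pi> (ap g (pr2 (u (2 * r)) (u (2 * r + 1))) i) = act g (pr2 (v (2 * r)) (v (2 * r + 1))) i" for i
    using red_ap[OF g, of "pr2 (u (2 * r)) (u (2 * r + 1))"] by (metis red_apply)
  have "act (kap r g) v = red (ap (kap r g) u)"
    using red_ap[OF kap_G[of g r "Suc r"]] g by (simp add: u)
  also have "\<dots> = kapf r (act g) v"
    using g by (intro ext) (simp add: ap_kap red_apply kapf_def * del: One_nat_def, simp add: u[symmetric] red_apply)
  finally show ?thesis .
qed

lemma act_rho: "g \<in> G 1 \<Longrightarrow> act (rho r g) v = rhof r (act g) v"
proof -
  assume g: "g \<in> G 1"
  obtain u where u: "red u = v" using red_surj by blast
  have r: "red (pr2 a b) = pr2 (\<pi> a) (\<pi> b)" for a b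
    by (auto simp: red_def pr2_def)
  have *: "\<pi> (ap g (pr2 a b) i) = act g (pr2 (\<pi> a) (\<pi> b)) i" for i a b
    using red_ap[OF g, of "pr2 a b"] by (metis red_apply r)
  have "act (rho r g) v = red (ap (rho r g) u)"
    using red_ap[OF rho_G[of g r "Suc (Suc r)"]] g by (simp add: u)
  also have "\<dots> = rhof r (act g) v"
    using g by (intro ext) (simp add: ap_rho red_apply rhof_def * del: One_nat_def, simp add: u[symmetric] red_apply)
  finally show ?thesis .
qed

section \<open>The relative elementary subgroup\<close>

inductive_set E :: "nat \<Rightarrow> (nat \<Rightarrow> 'a) aut set" for k where
  E_0: "0 \<in> E k"
| E_step: "g \<in> G k \<Longrightarrow> i < 2 * k \<Longrightarrow> j < 2 * k \<Longrightarrow> i \<noteq> j \<Longrightarrow> \<pi> x = 0 \<Longrightarrow> h \<in> E k \<Longrightarrow> g + el i j x - g + h \<in> E k"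

lemma E_G: "\<epsilon> \<in> E k \<Longrightarrow> \<epsilon> \<in> G k"
  by (induction rule: E.induct) (auto intro!: G_0 G_add G_diff G_el)

lemma E_add: "g \<in> E k \<Longrightarrow> h \<in> E k \<Longrightarrow> g + h \<in> E k"
proof (induction rule: E.induct)
  case (E_step g i j x g')
  then have "g + el i j x - g + (g' + h) \<in> E k" by (intro E.E_step)
  then show ?case by (simp add: add.assoc)
qed simp

lemma E_conj_el: "g \<in> G k \<Longrightarrow> i < 2 * k \<Longrightarrow> j < 2 * k \<Longrightarrow> i \<noteq> j \<Longrightarrow> \<pi> x = 0 \<Longrightarrow> g + el i j x - g \<in> E k"
  using E_step[OF _ _ _ _ _ E_0] by fastforce

lemma E_el: "i < 2 * k \<Longrightarrow> j < 2 * k \<Longrightarrow> i \<noteq> j \<Longrightarrow> \<pi> x = 0 \<Longrightarrow> el i j x \<in> E k"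
  using E_conj_el[OF G_0] by fastforce

lemma E_minus: "g \<in> E k \<Longrightarrow> - g \<in> E k"
proof (induction rule: E.induct)
  case (E_step g i j x h)
  have "- (g + el i j x - g + h) = - h + (g + el i j (- x) - g)"
    by (simp add: el_minus minus_add minus_diff_eq diff_conv_add_uminus add.assoc del: add_uminus_conv_diff)
  then show ?case using E_step by (auto intro!: E_add E_conj_el)
qed (simp add: E_0)

lemma E_conj: "\<epsilon> \<in> E k \<Longrightarrow> a \<in> G k \<Longrightarrow> a + \<epsilon> - a \<in> E k"
proof (induction rule: E.induct)
  case (E_step g i j x h)
  have "a + (g + el i j x - g + h) - a = ((a + g) + el i j x - (a + g)) + (a + h - a)"
    by (simp add: minus_add diff_conv_add_uminus add.assoc del: add_uminus_conv_diff)
  then show ?case using E_step by (auto intro!: E_add E_conj_el G_add)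
qed (simp add: E_0)

lemma E_conj': "\<epsilon> \<in> E k \<Longrightarrow> a \<in> G k \<Longrightarrow> - a + \<epsilon> + a \<in> E k"
  using E_conj[of \<epsilon> k "- a"] by (simp add: G_minus)

text \<open>Normality in the shape used to sort products: factors from \<open>E\<close> are pushed
  to the right end.\<close>

lemma E_move: "\<epsilon> \<in> E k \<Longrightarrow> a \<in> G k \<Longrightarrow> \<exists>\<epsilon>'\<in>E k. \<epsilon> + a = a + \<epsilon>'"
  using E_conj'[of \<epsilon> k a] by (intro bexI[of _ "- a + \<epsilon> + a"]) (simp_all add: add.assoc[symmetric])

lemma E_mono: "\<epsilon> \<in> E k \<Longrightarrow> k \<le> l \<Longrightarrow> \<epsilon> \<in> E l"
proof (induction rule: E.induct)
  case (E_step g i j x h)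
  then have "g \<in> G l" using G_mono by blast
  with E_step show ?case by (intro E.E_step) simp_all
qed (simp add: E_0)

lemma act_E: "\<epsilon> \<in> E k \<Longrightarrow> act \<epsilon> w = w"
proof (induction rule: E.induct)
  case (E_step g i j x h)
  have "act (g + el i j x - g + h) w = act g (act (el i j x) (act (- g) (act h w)))"
    using E_step by (simp add: act_add[of _ k] act_diff[of _ k] G_add G_diff G_el)
  then show ?case using E_step by (simp add: act_el)
qed simp

lemma rho_E: "\<epsilon> \<in> E (Suc 0) \<Longrightarrow> r + 1 < k \<Longrightarrow> rho r \<epsilon> \<in> E k"
proof (induction rule: E.induct)
  case (E_step g i j x h)
  then have "i = 0 \<and> j = Suc 0 \<or> i = Suc 0 \<and> j = 0" by auto
  moreover have "rho r (g + el i j x - g + h) = rho r g + rho r (el i j x) - rho r g + rho r h"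
    using E_step by (simp add: rho_add rho_minus G_add G_diff G_el E_G G_minus diff_conv_add_uminus del: add_uminus_conv_diff)
  ultimately show ?case using E_step by (auto simp: rho_X rho_Y intro!: E.E_step rho_G)
qed (simp add: E_0)

lemma hs_E:
  assumes "supp_below r w" "\<And>i. \<pi> (w i) = 0" "\<pi> c = 0"
  shows "hs r w c \<in> E (Suc r)"
  by (rule hs_induct[where J = "{x. \<pi> x = 0}"]) (use assms in \<open>auto intro: E_add E_el\<close>)

section \<open>Reduced words in rank one\<close>

lemma act_X: "act (X f) v = v(0 := v 0 + \<pi> f * v 1)"
  by (simp add: act_el elf_X)

lemma act_W: "act W v = v(0 := v 1, 1 := - v 0)"
  by (rule ext) (simp add: act_def ap_W red_def)

lemma act_D: "u * u' = 1 \<Longrightarrow> act (D u u') v = v(0 := \<pi> u * v 0, 1 := \<pi> u' * v 1)"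
  by (rule ext) (simp add: act_def ap_D red_def)

lemmas act_add_G1 = act_add[of _ "Suc 0"]

text \<open>Words \<open>W X\<^sub>1 W X\<^sub>2 \<dots> W X\<^sub>n D\<close> whose inner parameters have positive degree; the first column then
  grows in degree with every letter.\<close>

inductive_set C where
  C_base: "u * u' = 1 \<Longrightarrow> \<epsilon> \<in> E (Suc 0) \<Longrightarrow> W + X f + D u u' + \<epsilon> \<in> C"
| C_step: "g \<in> C \<Longrightarrow> 0 < degree (\<pi> f) \<Longrightarrow> W + X f + g \<in> C"

lemma C_G: "g \<in> C \<Longrightarrow> g \<in> G (Suc 0)"
  by (induction rule: C.induct) (auto intro!: G_add intro: E_G)

text \<open>\<open>W + X f\<close> turns the first column \<open>(p, q)\<close> into
  \<open>(q, - p - \<pi> f * q)\<close>. The nonzero lower entry is what keeps such words out of the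
  stabilizer of \<open>bv 0\<close>; a zero upper entry is listed separately because
  \<open>degree 0 = 0\<close>.\<close>

lemma C_act:
  "g \<in> C \<Longrightarrow> act g (bv 0) 1 \<noteq> 0 \<and> (act g (bv 0) 0 = 0 \<or> degree (act g (bv 0) 0) < degree (act g (bv 0) 1))"
proof (induction rule: C.induct)
  case (C_base u u' \<epsilon> f)
  have "\<pi> u * \<pi> u' = 1" using C_base by (metis pi_mult pi_1)
  then have "\<pi> u \<noteq> 0" by auto
  with C_base show ?case
    by (simp add: add.assoc act_add_G1 act_E act_D act_X act_W bv_apply)
next
  case (C_step g f)
  define p q where "p = act g (bv 0) 0" and "q = act g (bv 0) 1"
  have pq: "q \<noteq> 0" "p = 0 \<or> degree p < degree q" using C_step by (simp_all add: p_def q_def)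
  have f: "\<pi> f \<noteq> 0" using C_step by auto
  have "degree q < degree (\<pi> f * q)" using f pq C_step by (simp add: degree_mult_eq)
  moreover have "degree (p + \<pi> f * q) = degree (\<pi> f * q)"
    using pq calculation by (auto intro: degree_add_eq_right)
  ultimately have "degree q < degree (- p - \<pi> f * q)" "- p - \<pi> f * q \<noteq> 0"
    using degree_minus[of "p + \<pi> f * q"] by (auto simp del: degree_minus)
  moreover have "act (W + X f + g) (bv 0) 0 = q" "act (W + X f + g) (bv 0) 1 = - p - \<pi> f * q"
    using C_G[OF \<open>g \<in> C\<close>]
    by (simp_all add: add.assoc act_add_G1 act_X act_W p_def q_def)
  ultimately show ?case by simp
qed

lemma C_E: "g \<in> C \<Longrightarrow> \<epsilon> \<in> E (Suc 0) \<Longrightarrow> g + \<epsilon> \<in> C"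
proof (induction rule: C.induct)
  case (C_base u u' \<epsilon>' f)
  then show ?case using C.C_base[of u u' "\<epsilon>' + \<epsilon>" f] by (simp add: add.assoc E_add)
next
  case (C_step g f)
  then show ?case using C.C_step[of "g + \<epsilon>" f] by (simp add: add.assoc)
qed

lemma E_C: "g \<in> C \<Longrightarrow> \<epsilon> \<in> E (Suc 0) \<Longrightarrow> \<epsilon> + g \<in> C"
  using E_move[of \<epsilon> "Suc 0" g] C_E C_G by auto

lemma D_C: "g \<in> C \<Longrightarrow> u * u' = 1 \<Longrightarrow> D u u' + g \<in> C"
proof (induction arbitrary: u u' rule: C.induct)
  case (C_base v v' \<epsilon> f)
  have u: "u' * u = 1" using C_base by (simp add: mult.commute)
  have "D u u' + (W + X f + D v v' + \<epsilon>) = (D u u' + W) + X f + D v v' + \<epsilon>"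
    by (simp only: add.assoc)
  also have "\<dots> = W + (D u' u + X f) + D v v' + \<epsilon>"
    using C_base by (simp only: D_W add.assoc)
  also have "\<dots> = W + X (u' * u' * f) + (D u' u + D v v') + \<epsilon>"
    by (simp only: D_X[OF u] add.assoc)
  also have "\<dots> = W + X (u' * u' * f) + D (u' * v) (u * v') + \<epsilon>"
    by (simp only: D_D[OF u C_base(1)])
  also have "\<dots> \<in> C"
    using C_base u by (intro C.C_base) (simp_all add: unit_cancel mult_ac)
  finally show ?case .
next
  case (C_step g f)
  have u: "u' * u = 1" using C_step by (simp add: mult.commute)
  have "D u u' + (W + X f + g) = (D u u' + W) + X f + g"
    by (simp only: add.assoc)
  also have "\<dots> = W + (D u' u + X f) + g"
    using C_step by (simp only: D_W add.assoc)
  also have "\<dots> = W + X (u' * u' * f) + (D u' u + g)"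
    by (simp only: D_X[OF u] add.assoc)
  also have "\<dots> \<in> C"
  proof (rule C.C_step)
    show "D u' u + g \<in> C" using C_step.IH[OF u] .
    have "\<pi> u' * \<pi> u = 1" using u by (metis pi_mult pi_1)
    then have "degree (\<pi> u') = 0" "\<pi> u' \<noteq> 0" using poly_unit by blast+
    then show "0 < degree (\<pi> (u' * u' * f))" using C_step by (cases "\<pi> f = 0") (auto simp: degree_mult_eq)
  qed
  finally show ?case .
qed

text \<open>The first set consists of the words without \<open>W\<close>, upper triangular modulo
  \<open>E\<close>. The leading parameter is unrestricted, since the degree condition concerns
  parameters between two \<open>W\<close>.\<close>

definition NF where
  "NF = {X f + D u u' + \<epsilon> | f u u' \<epsilon>. u * u' = 1 \<and> \<epsilon> \<in> E (Suc 0)} \<union> {X f + g | f g. g \<in> C}"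

lemma X_NF: "g \<in> NF \<Longrightarrow> X f + g \<in> NF"
proof -
  have *: "X f + (X f' + g) = X (f + f') + g" for f' g
    by (simp only: el_add add.assoc)
  assume "g \<in> NF"
  then show ?thesis
    unfolding NF_def by (auto simp: add.assoc *)
qed

lemma NF_D: "u * u' = 1 \<Longrightarrow> \<epsilon> \<in> E (Suc 0) \<Longrightarrow> X f + D u u' + \<epsilon> \<in> NF"
  unfolding NF_def by blast

lemma NF_C: "g \<in> C \<Longrightarrow> X f + g \<in> NF"
  unfolding NF_def by blast

lemma NF_E: "g \<in> NF \<Longrightarrow> \<epsilon> \<in> E (Suc 0) \<Longrightarrow> g + \<epsilon> \<in> NF"
proof -
  assume e: "\<epsilon> \<in> E (Suc 0)" and "g \<in> NF"
  then consider (1) f v v' \<epsilon>' where "v * v' = 1" "\<epsilon>' \<in> E (Suc 0)" "g = X f + D v v' + \<epsilon>'"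
    | (2) f h where "h \<in> C" "g = X f + h"
    unfolding NF_def by blast
  then show ?thesis
  proof cases
    case 1
    then show ?thesis using NF_D[of v v' "\<epsilon>' + \<epsilon>" f] e by (simp add: E_add add.assoc)
  next
    case 2
    then show ?thesis using NF_C[OF C_E[OF _ e], of h f] by (simp add: add.assoc)
  qed
qed

lemma C_NF: "g \<in> C \<Longrightarrow> g \<in> NF"
  using NF_C[of g 0] by simp

lemma D_NF: "g \<in> NF \<Longrightarrow> u * u' = 1 \<Longrightarrow> D u u' + g \<in> NF"
proof -
  assume u: "u * u' = 1" and "g \<in> NF"
  then consider (1) f v v' \<epsilon> where "v * v' = 1" "\<epsilon> \<in> E (Suc 0)" "g = X f + D v v' + \<epsilon>"
    | (2) f h where "h \<in> C" "g = X f + h"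
    unfolding NF_def by blast
  then show ?thesis
  proof cases
    case 1
    have "D u u' + g = (D u u' + X f) + D v v' + \<epsilon>" by (simp only: 1 add.assoc)
    also have "\<dots> = X (u * u * f) + (D u u' + D v v') + \<epsilon>" by (simp only: D_X[OF u] add.assoc)
    also have "\<dots> = X (u * u * f) + D (u * v) (u' * v') + \<epsilon>" by (simp only: D_D[OF u 1(1)])
    finally show ?thesis using u 1 NF_D[of "u * v" "u' * v'"] by (simp add: unit_cancel mult_ac)
  next
    case 2
    have "D u u' + g = (D u u' + X f) + h" by (simp only: 2 add.assoc)
    also have "\<dots> = X (u * u * f) + (D u u' + h)" by (simp only: D_X[OF u] add.assoc)
    finally show ?thesis using NF_C[OF D_C[OF 2(1) u]] by simp
  qed
qed

text \<open>A constant inner parameter shortens the word, by \<open>W_X_W\<close>.\<close>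

lemma W_X_C_NF:
  assumes "\<pi> f = [:c:]" "g \<in> C"
  shows "W + X f + g \<in> NF"
proof -
  show "W + X f + g \<in> NF"
  proof (cases "c = 0")
    \<comment> \<open>Here \<open>X f\<close> lies in \<open>E\<close> and moves away to the right;
      then \<open>W + W\<close> is diagonal, and two letters disappear at once.\<close>
    case True
    have g: "W + g \<in> NF"
      using assms(2)
    proof cases
      case (C_base u u' \<epsilon> f')
      have "W + g = D (- 1) (- 1) + (X f' + D u u' + \<epsilon>)" by (simp add: C_base(1) W_W[symmetric] add.assoc)
      moreover have "X f' + D u u' + \<epsilon> \<in> NF" using C_base unfolding NF_def by blast
      ultimately show ?thesis by (simp add: D_NF)
    next
      case (C_step g' f')
      have "W + g = D (- 1) (- 1) + (X f' + g')" by (simp add: C_step(1) W_W[symmetric] add.assoc)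
      moreover have "X f' + g' \<in> NF" using C_step unfolding NF_def by blast
      ultimately show ?thesis by (simp add: D_NF)
    qed
    have "X f \<in> E (Suc 0)" using True assms by (auto intro: E_el)
    then obtain \<epsilon> where e: "\<epsilon> \<in> E (Suc 0)" "X f + g = g + \<epsilon>" using E_move C_G[OF assms(2)] by blast
    have "W + X f + g = (W + g) + \<epsilon>" by (simp add: add.assoc e)
    with g e(1) show ?thesis by (simp add: NF_E)
  next
    case False
    then obtain u u' where u: "u * u' = 1" "\<pi> u = [:c:]" using unit_lift by blast
    have u': "u' * u = 1" using u by (simp add: mult.commute)
    have "\<pi> u' * \<pi> u = 1" using u' by (metis pi_mult pi_1)
    then have du: "degree (\<pi> u') = 0" using poly_unit by blast
    have fu: "X f = X u + X (f - u)" by (simp add: el_add[symmetric])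
    have "X (f - u) \<in> E (Suc 0)" using u assms by (auto intro: E_el)
    then have eg: "X (f - u) + g \<in> C" using E_C assms(2) by blast
    have key: "W + X u + h \<in> NF" if "h \<in> C" for h
      using that
    proof cases
      case (C_base v v' \<epsilon> f')
      have "W + X u + h = (W + X u + W) + X f' + D v v' + \<epsilon>" by (simp only: C_base(1) add.assoc)
      also have "\<dots> = D (- 1) (- 1) + (X (- u') + (D u' u + (W + (X (- u') + X f') + D v v' + \<epsilon>)))"
        by (simp only: W_X_W[OF u(1)]) (simp only: add.assoc)
      also have "X (- u') + X f' = X (- u' + f')" by (simp only: el_add)
      finally show ?thesis
        using C_base u' by (simp only:) (intro D_NF X_NF C_NF[OF D_C[OF C.C_base]]; simp)
    next
      case (C_step g' f')
      have "W + X u + h = (W + X u + W) + X f' + g'" by (simp only: C_step(1) add.assoc)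
      also have "\<dots> = D (- 1) (- 1) + (X (- u') + (D u' u + (W + (X (- u') + X f') + g')))"
        by (simp only: W_X_W[OF u(1)]) (simp only: add.assoc)
      also have "X (- u') + X f' = X (- u' + f')" by (simp only: el_add)
      finally have *: "W + X u + h = D (- 1) (- 1) + (X (- u') + (D u' u + (W + X (- u' + f') + g')))" .
      \<comment> \<open>Shortening shifts the next parameter by a constant, which cannot destroy its
        positive degree.\<close>
      have "degree (\<pi> (- u' + f')) = degree (\<pi> f')"
        unfolding pi_add pi_minus using du C_step by (intro degree_add_eq_right) simp
      then have "W + X (- u' + f') + g' \<in> C" using C_step by (intro C.C_step) auto
      then show ?thesis
        unfolding * using u' by (intro D_NF X_NF C_NF[OF D_C]) simp_all
    qed
    have "W + X f + g = W + X u + (X (f - u) + g)" by (simp only: fu add.assoc)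
    with key[OF eg] show ?thesis by simp
  qed
qed

lemma W_NF: "g \<in> NF \<Longrightarrow> W + g \<in> NF"
proof -
  assume "g \<in> NF"
  then consider (1) f v v' \<epsilon> where "v * v' = 1" "\<epsilon> \<in> E (Suc 0)" "g = X f + D v v' + \<epsilon>"
    | (2) f h where "h \<in> C" "g = X f + h"
    unfolding NF_def by blast
  then show ?thesis
  proof cases
    case 1
    then have "W + g \<in> C" using C_base[of v v' \<epsilon> f] by (simp add: add.assoc)
    then show ?thesis by (rule C_NF)
  next
    case 2
    show ?thesis
    proof (cases "degree (\<pi> f) = 0")
      case True
      then obtain c where "\<pi> f = [:c:]" by (meson degree_eq_zeroE)
      then show ?thesis using W_X_C_NF[of f c h] 2 by (simp add: add.assoc)
    next
      case False
      then show ?thesis using 2 C_step[of h f] by (auto simp: add.assoc intro: C_NF)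
    qed
  qed
qed

lemma G1_NF: "g \<in> G (Suc 0) \<Longrightarrow> g \<in> NF"
proof (induction rule: G1_induct)
  case zero
  have "D 1 1 = (0 :: (nat \<Rightarrow> 'a) aut)" by (rule aut_eqI) (simp add: ap_D)
  then have "0 = X 0 + D 1 (1 :: 'a) + 0" by simp
  then show ?case using NF_D[of 1 1 0 0] by (simp add: E_0)
next
  case (X f g)
  then show ?case by (intro X_NF)
next
  case (Y f g)
  have "Y f + g = D (- 1) (- 1) + (W + (X (- f) + (W + g)))"
    by (subst Y_conv, subst minus_W_conv) (simp only: add.assoc)
  then show ?case using Y by (auto intro!: D_NF W_NF X_NF)
qed

definition cong :: "nat \<Rightarrow> (nat \<Rightarrow> 'a) aut \<Rightarrow> (nat \<Rightarrow> 'a) aut \<Rightarrow> bool" where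
  "cong k a b \<longleftrightarrow> - a + b \<in> E k"

lemma cong_refl [simp]: "cong k a a"
  by (simp add: cong_def E_0)

lemma cong_add: "cong k a a' \<Longrightarrow> cong k b b' \<Longrightarrow> b \<in> G k \<Longrightarrow> cong k (a + b) (a' + b')"
proof -
  assume *: "cong k a a'" "cong k b b'" "b \<in> G k"
  have "- (a + b) + (a' + b') = (- b + (- a + a') + b) + (- b + b')"
    by (simp only: minus_add add.assoc add_minus_cancel)
  then show ?thesis using * by (simp add: cong_def E_add E_conj')
qed

lemma cong_el: "i < 2 * k \<Longrightarrow> j < 2 * k \<Longrightarrow> i \<noteq> j \<Longrightarrow> \<pi> x = \<pi> y \<Longrightarrow> cong k (el i j x) (el i j y)"
  by (auto simp: cong_def el_minus[symmetric] el_add[symmetric] intro!: E_el)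

text \<open>Words involving \<open>C\<close> have a nonzero lower entry in the first column. In the
  remaining normal form the diagonal entry \<open>u\<close> reduces to 1, and the diagonal factor
  falls into \<open>E\<close>.\<close>

lemma stab_G1:
  assumes g: "g \<in> G (Suc 0)" and fx: "act g (bv 0) = bv 0"
  shows "\<exists>f. \<exists>\<epsilon>\<in>E (Suc 0). g = X f + \<epsilon>"
proof -
  consider (1) f u u' \<epsilon> where "u * u' = 1" "\<epsilon> \<in> E (Suc 0)" "g = X f + D u u' + \<epsilon>"
    | (2) f h where "h \<in> C" "g = X f + h"
    using G1_NF[OF g] unfolding NF_def by blast
  then show ?thesis
  proof cases
    case 1
    have "act g (bv 0) 0 = \<pi> u"
      using 1 by (simp add: add.assoc act_add_G1 act_E act_D act_X bv_apply)
    then have u: "\<pi> u = 1" by (simp add: fx bv_apply)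
    moreover have "\<pi> u * \<pi> u' = 1" using 1 by (metis pi_mult pi_1)
    ultimately have u': "\<pi> u' = 1" by simp
    \<comment> \<open>\<open>W - W\<close> is the word for \<open>D 1 1\<close>. As \<open>u\<close>
      and \<open>u'\<close> reduce to 1, the two words differ by parameters in the kernel.\<close>
    have "cong (Suc 0) (W - W) (D u u')"
    proof -
      have "cong (Suc 0) (X 1 + Y (- 1) + X 1 + - W) (X u + Y (- u') + X u + - W)"
        using u u' by (intro cong_add cong_el cong_refl G_minus W_G X_G Y_G) simp_all
      then show ?thesis by (simp add: D_def W_def)
    qed
    then have "D u u' \<in> E (Suc 0)" by (simp add: cong_def)
    then show ?thesis using 1 E_add by (metis add.assoc)
  next
    case 2
    have "act g (bv 0) 1 = act h (bv 0) 1"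
      using 2 by (simp add: act_add_G1 act_X)
    then show ?thesis using C_act[OF 2(1)] by (simp add: fx bv_apply)
  qed
qed

end

section \<open>Primitive vectors and transitivity\<close>

text \<open>Shifting the degree by one leaves the value \<open>0\<close> to the zero polynomial, so
  every remainder is strictly smaller than the divisor, and the units are exactly the polynomials of
  size 1.\<close>

definition dg :: "'k::field poly \<Rightarrow> nat" where "dg p = (if p = 0 then 0 else Suc (degree p))"

lemma dg_0 [simp]: "dg 0 = 0"
  by (simp add: dg_def)

lemma dg_eq_0 [simp]: "dg p = 0 \<longleftrightarrow> p = 0"
  by (simp add: dg_def)

lemma dg_minus [simp]: "dg (- p) = dg p"
  by (simp add: dg_def)

lemma dg_mod: "q \<noteq> 0 \<Longrightarrow> dg (p mod q) < dg q"
  using degree_mod_less[of q p] by (auto simp: dg_def)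

lemma dg_mult: "p \<noteq> 0 \<Longrightarrow> q \<noteq> 0 \<Longrightarrow> Suc (dg (p * q)) = dg p + dg q"
  by (simp add: dg_def degree_mult_eq)

lemma dg_mult_le: "p \<noteq> 0 \<Longrightarrow> dg q \<le> dg (p * q)"
  by (cases "q = 0") (auto simp: dg_def degree_mult_eq)

lemma dg_unit: "dg p \<le> 1 \<Longrightarrow> p \<noteq> 0 \<Longrightarrow> \<exists>c. c \<noteq> 0 \<and> p = [:c:]"
  by (auto simp: dg_def split: if_splits elim: degree_eq_zeroE)

lemma dvd_1_dg: "p dvd (1 :: 'k::field poly) \<Longrightarrow> dg p = 1"
  using poly_unit[of p] by (auto simp: dg_def elim!: dvdE)

lemma dg_1_dvd: "dg p = 1 \<Longrightarrow> p dvd 1"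
proof -
  assume "dg p = 1"
  then obtain c where "c \<noteq> 0" "p = [:c:]" using dg_unit[of p] by fastforce
  then have "p * [:inverse c:] = 1" by (simp add: one_pCons)
  then show ?thesis by (metis dvdI)
qed

lemma dvd_dg_le: "p dvd q \<Longrightarrow> q \<noteq> 0 \<Longrightarrow> dg p \<le> dg q" for p q :: "'k::field poly"
  using dg_mult_le by (metis dvdE mult.commute mult_eq_0_iff)

text \<open>Over the principal ideal domain \<open>k[X]\<close> this is unimodularity; the divisor
  form is the one that linear bijections visibly preserve.\<close>

definition prim :: "(nat \<Rightarrow> 'k::field poly) \<Rightarrow> bool" where
  "prim v \<longleftrightarrow> (\<forall>d. (\<forall>i. d dvd v i) \<longrightarrow> d dvd 1)"

lemma prim_nonzero: "prim v \<Longrightarrow> v \<noteq> 0"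
  unfolding prim_def by (metis dvd_0_right zero_fun_apply not_one_le_zero dvd_0_left_iff zero_neq_one)

lemma prim_bv [simp]: "prim (bv i)"
  by (metis prim_def bv_apply)

lemma prim_scale: "prim (c *s v) \<Longrightarrow> c dvd 1"
  by (auto simp: prim_def vec_simps)

lemma prim_factor: "v \<noteq> 0 \<Longrightarrow> \<exists>c w. c \<noteq> 0 \<and> v = c *s w \<and> prim w" for v :: "nat \<Rightarrow> 'k::field poly"
proof -
  assume "v \<noteq> 0"
  then obtain i where "v i \<noteq> 0" by (auto simp: fun_eq_iff vec_simps)
  then show ?thesis
  proof (induction "dg (v i)" arbitrary: v rule: less_induct)
    case less
    show ?case
    proof (cases "prim v")
      case True
      then show ?thesis by (intro exI[of _ 1] exI[of _ v]) simp
    next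
      case False
      then obtain d where d: "\<forall>i. d dvd v i" "\<not> d dvd 1" by (auto simp: prim_def)
      define w where "w = (\<lambda>i. v i div d)"
      have w: "v i = d * w i" for i using d by (simp add: w_def)
      have "d \<noteq> 0" "w i \<noteq> 0" using w[of i] less by auto
      moreover have "dg d \<noteq> 1" using d dg_1_dvd by blast
      moreover have "Suc (dg (v i)) = dg d + dg (w i)" using calculation w dg_mult by metis
      ultimately have "dg (w i) < dg (v i)"
        by (simp flip: dg_eq_0)
      with less.hyps \<open>w i \<noteq> 0\<close> obtain c u where c: "c \<noteq> 0" "w = c *s u" "prim u" by blast
      have "v = d *s w" using w by (auto simp: fun_eq_iff vec_simps)
      then show ?thesis using c \<open>d \<noteq> 0\<close> by (intro exI[of _ "d * c"] exI[of _ u]) (auto simp: scale_scale)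
    qed
  qed
qed

lemma scale_cancel: "c \<noteq> 0 \<Longrightarrow> c *s v = c *s w \<Longrightarrow> v = w" for c :: "'k::field poly"
  by (auto simp: fun_eq_iff vec_simps)

context reduction begin

lemma act_pr2_pr2: "g \<in> G (Suc 0) \<Longrightarrow> pr2 (act g (pr2 x y) 0) (act g (pr2 x y) (Suc 0)) = act g (pr2 x y)"
  by (rule act_lift[of g 1]) (use pr2_G1 in auto)

lemma pr2_bv: "pr2 1 0 = bv 0" "pr2 c 0 = c *s bv 0" "pr2 0 0 = 0"
  by (auto simp: pr2_def bv_apply fun_eq_iff vec_simps)

lemma prim_act: "g \<in> G k \<Longrightarrow> prim v \<Longrightarrow> prim (act g v)"
  unfolding prim_def
proof (intro allI impI)
  fix d assume g: "g \<in> G k" and v: "\<forall>d. (\<forall>i. d dvd v i) \<longrightarrow> d dvd 1" and d: "\<forall>i. d dvd act g v i"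
  define w where "w = (\<lambda>i. act g v i div d)"
  have "act g v = d *s w" using d by (intro ext) (simp add: w_def vec_simps)
  then have "v = d *s act (- g) w" using act_minus_act[OF g, of v] act_scale[OF G_minus[OF g]] by metis
  then have "\<forall>i. d dvd v i" by (simp add: vec_simps)
  then show "d dvd 1" using v by blast
qed

lemma unit_lift_dvd: "p dvd 1 \<Longrightarrow> \<exists>u u'. u * u' = 1 \<and> \<pi> u = p"
proof -
  assume "p dvd 1"
  then obtain c where "c \<noteq> 0" "p = [:c:]" using dvd_1_dg[of p] dg_unit[of p] by fastforce
  then show ?thesis using unit_lift by blast
qed

lemma G1_gcd: "\<exists>g\<in>G (Suc 0). \<exists>d. act g (pr2 p q) = pr2 d 0"
proof (induction "dg q" arbitrary: p q rule: less_induct)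
  case less
  show ?case
  proof (cases "q = 0")
    case True
    then show ?thesis by (intro bexI[of _ 0]) (auto intro: G_0)
  next
    case False
    have "act (W + X (- sec (p div q))) (pr2 p q) = pr2 q (- (p mod q))"
      by (rule ext) (simp add: act_add_G1 act_W act_X pr2_def minus_div_mult_eq_mod[symmetric])
    moreover obtain g d where "g \<in> G (Suc 0)" "act g (pr2 q (- (p mod q))) = pr2 d 0"
      using less[of "- (p mod q)" q] dg_mod[OF False] by auto
    ultimately have "act (g + (W + X (- sec (p div q)))) (pr2 p q) = pr2 d 0"
      by (simp add: act_add_G1)
    then show ?thesis using \<open>g \<in> G (Suc 0)\<close> by (metis G_add W_G X_G)
  qed
qed

lemma G1_trans:
  assumes "prim (pr2 p q)"
  shows "\<exists>g\<in>G (Suc 0). act g (bv 0) = pr2 p q"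
proof -
  obtain g d where g: "g \<in> G (Suc 0)" "act g (pr2 p q) = pr2 d 0" using G1_gcd by blast
  then have "prim (d *s bv 0)" using prim_act assms pr2_bv by metis
  then have "d dvd 1" by (rule prim_scale)
  then obtain u u' where u: "u * u' = 1" "\<pi> u = d" using unit_lift_dvd by blast
  have "act (D u u') (bv 0) = pr2 d 0"
    using u by (auto simp: act_D bv_apply pr2_def)
  then have "act (- g + D u u') (bv 0) = pr2 p q"
    using g act_minus_act[OF g(1), of "pr2 p q"] by (simp add: act_add_G1 G_minus)
  moreover have "- g + D u u' \<in> G (Suc 0)" using g by (intro G_add G_minus) auto
  ultimately show ?thesis by blast
qed

text \<open>The Euclidean algorithm leaves one coordinate in each plane, and \<open>rho\<close>
  merges the surviving coordinates of neighbouring planes.\<close>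

lemma G_gcd: "supp_below (Suc k) v \<Longrightarrow> \<exists>g\<in>G (Suc k). \<exists>c. act g v = c *s bv (2 * k)"
proof (induction k arbitrary: v)
  case 0
  then have "v = pr2 (v 0) (v 1)" by (auto simp: fun_eq_iff pr2_def supp_below_def)
  with G1_gcd[of "v 0" "v 1"] pr2_bv(2) show ?case by (metis mult_0_right)
next
  case (Suc k)
  define lo where "lo = (\<lambda>i. if i < 2 * Suc k then v i else 0)"
  have v: "v = lo + (v (2 * k + 2) *s bv (2 * k + 2) + v (2 * k + 3) *s bv (2 * k + 3))"
    using Suc.prems by (auto simp: fun_eq_iff lo_def vec_simps supp_below_def)
  have "supp_below (Suc k) lo" by (simp add: lo_def supp_below_def)
  then obtain g c where g: "g \<in> G (Suc k)" "act g lo = c *s bv (2 * k)" using Suc.IH by blast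
  obtain h d where h: "h \<in> G (Suc 0)" "act h (pr2 (v (2 * k + 2)) (v (2 * k + 3))) = pr2 d 0" using G1_gcd by blast
  obtain l d' where l: "l \<in> G (Suc 0)" "act l (pr2 d c) = pr2 d' 0" using G1_gcd by blast
  have "act g v = c *s bv (2 * k) + (v (2 * k + 2) *s bv (2 * k + 2) + v (2 * k + 3) *s bv (2 * k + 3))"
    by (subst v) (simp add: act_vec_add[OF g(1)] act_scale[OF g(1)] g(2) act_fix_bv[OF g(1)])
  moreover have "act (kap (Suc k) h) \<dots> = c *s bv (2 * k) + d *s bv (2 * k + 2)"
    using h by (intro ext) (simp add: act_kap kapf_def vec_simps numeral_3_eq_3)
  moreover have "act (rho k l) \<dots> = d' *s bv (2 * k + 2)"
    using l by (intro ext) (simp add: act_rho rhof_def vec_simps numeral_3_eq_3 pr2_bv act_zero[of l "Suc 0"])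
  ultimately have "act (rho k l + kap (Suc k) h + g) v = d' *s bv (2 * k + 2)"
    using g h l by (simp add: add.assoc act_add[of _ "Suc (Suc k)"] rho_G kap_G)
  moreover have "rho k l + kap (Suc k) h + g \<in> G (Suc (Suc k))"
    using h l G_mono[OF g(1), of "Suc (Suc k)"] by (intro G_add rho_G kap_G) auto
  ultimately show ?case by auto
qed

lemma G_trans:
  assumes "supp_below (Suc k) v" "prim v"
  shows "\<exists>g\<in>G (Suc k). act g (bv (2 * k)) = v"
proof -
  obtain g c where g: "g \<in> G (Suc k)" "act g v = c *s bv (2 * k)" using G_gcd[OF assms(1)] by blast
  then have "prim (c *s bv (2 * k))" using prim_act assms(2) by metis
  then have "c dvd 1" by (rule prim_scale)
  then obtain u u' where u: "u * u' = 1" "\<pi> u = c" using unit_lift_dvd by blast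
  have "act (kap k (D u u')) (bv (2 * k)) = c *s bv (2 * k)"
    using u by (intro ext) (simp add: act_kap kapf_def vec_simps act_D)
  then have "act (- g + kap k (D u u')) (bv (2 * k)) = v"
    using g act_minus_act[OF g(1), of v] by (simp add: act_add[of _ "Suc k"] G_minus)
  moreover have "- g + kap k (D u u') \<in> G (Suc k)" using g by (intro G_add G_minus kap_G) auto
  ultimately show ?thesis by blast
qed

section \<open>The stabilizer of a basis vector\<close>

text \<open>Unipotent radical times Levi factor, enlarged by the normal subgroup
  \<open>E (Suc r)\<close>. It fixes \<open>bv (2 * r)\<close> by \<open>Q_fix\<close>; that it is
  the whole stabilizer is the goal \<open>stabilizer\<close>.\<close>

definition Q :: "nat \<Rightarrow> (nat \<Rightarrow> 'a) aut set" where
  "Q r = {hs r w c + g + \<epsilon> | w c g \<epsilon>. supp_below r w \<and> g \<in> G r \<and> \<epsilon> \<in> E (Suc r)}"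

lemma Q_I: "supp_below r w \<Longrightarrow> g \<in> G r \<Longrightarrow> \<epsilon> \<in> E (Suc r) \<Longrightarrow> hs r w c + g + \<epsilon> \<in> Q r"
  unfolding Q_def by blast

lemma Q_E:
  assumes "q \<in> Q r"
  obtains w c g \<epsilon> where "supp_below r w" "g \<in> G r" "\<epsilon> \<in> E (Suc r)" "q = hs r w c + g + \<epsilon>"
  using assms unfolding Q_def by blast

lemma Q_hs: "supp_below r w \<Longrightarrow> hs r w c \<in> Q r"
  using Q_I[of r w 0 0 c] by (simp add: G_0 E_0)

lemma Q_lower: "g \<in> G r \<Longrightarrow> g \<in> Q r"
  using Q_I[of r 0 g 0 0] by (simp add: E_0)

lemma Q_of_E: "\<epsilon> \<in> E (Suc r) \<Longrightarrow> \<epsilon> \<in> Q r"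
  using Q_I[of r 0 0 \<epsilon> 0] by (simp add: G_0)

lemma Q_G: "q \<in> Q r \<Longrightarrow> q \<in> G (Suc r)"
  by (elim Q_E) (simp add: G_add hs_G E_G G_mono[of _ r])

text \<open>The Levi factor normalizes the Heisenberg group by \<open>hs_conj\<close>, and
  \<open>E\<close> is normal, so the factors of a product can be sorted again.\<close>

lemma Q_add: "q \<in> Q r \<Longrightarrow> q' \<in> Q r \<Longrightarrow> q + q' \<in> Q r"
proof (elim Q_E)
  fix w c g \<epsilon> w' c' g' \<epsilon>'
  assume *: "supp_below r w" "g \<in> G r" "\<epsilon> \<in> E (Suc r)" "q = hs r w c + g + \<epsilon>"
    "supp_below r w'" "g' \<in> G r" "\<epsilon>' \<in> E (Suc r)" "q' = hs r w' c' + g' + \<epsilon>'"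
  have "hs r w' c' + g' \<in> G (Suc r)" using * by (simp add: G_add hs_G G_mono[of _ r])
  then obtain \<delta> where \<delta>: "\<delta> \<in> E (Suc r)" "\<epsilon> + (hs r w' c' + g') = (hs r w' c' + g') + \<delta>"
    using E_move * by blast
  have "q + q' = hs r w c + g + (\<epsilon> + (hs r w' c' + g')) + \<epsilon>'" by (simp add: * add.assoc)
  also have "\<dots> = hs r w c + (g + hs r w' c' - g) + (g + g') + (\<delta> + \<epsilon>')"
    unfolding \<delta> by (simp add: add.assoc diff_conv_add_uminus del: add_uminus_conv_diff)
  also have "\<dots> \<in> Q r"
    unfolding hs_conj[OF *(2,5)] using * \<delta> supp_G[OF *(2) order_refl *(5)]
    by (subst hs_add) (auto intro!: Q_I G_add E_add supp_below_add)
  finally show ?thesis .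
qed

lemma Q_minus: "q \<in> Q r \<Longrightarrow> - q \<in> Q r"
  by (elim Q_E) (simp add: minus_add Q_add Q_hs Q_lower Q_of_E G_minus E_minus hs_minus
      diff_conv_add_uminus del: add_uminus_conv_diff)

lemma Q_0 [simp]: "0 \<in> Q r"
  by (rule Q_lower[OF G_0])

lemma hsf_base: "hsf r w c (bv (2 * r)) = bv (2 * r)"
  by (rule ext) (simp add: hsf_def om_bv_high vec_simps)

lemma Q_fix: "q \<in> Q r \<Longrightarrow> act q (bv (2 * r)) = bv (2 * r)"
  by (elim Q_E) (simp add: add.assoc act_add[of _ "Suc r"] hs_G G_mono[of _ r] act_E act_fix_bv act_hs hsf_base)

lemma Q_E_conj: "\<epsilon> \<in> E (Suc r) \<Longrightarrow> a \<in> G (Suc r) \<Longrightarrow> - a + \<epsilon> + a \<in> Q r"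
  by (simp add: Q_of_E E_conj')

lemma kap_comm: "g \<in> G k \<Longrightarrow> h \<in> G (Suc 0) \<Longrightarrow> kap k h + g = g + kap k h"
proof (induction rule: G.induct)
  case (G_step i j g x)
  have "kap k h + el i j x = el i j x + kap k h"
  proof (rule aut_eqI)
    fix v
    have n: "i < 2 * k" "sigma i < 2 * k" "j < 2 * k" "sigma j < 2 * k" using G_step by auto
    then have n: "2 * k \<noteq> i" "2 * k + 1 \<noteq> i" "2 * k \<noteq> sigma i" "2 * k + 1 \<noteq> sigma i"
      "2 * k \<noteq> j" "2 * k + 1 \<noteq> j" "2 * k \<noteq> sigma j" "2 * k + 1 \<noteq> sigma j" by linarith+
    have "elf i j x v (2 * k) = v (2 * k)" "elf i j x v (2 * k + 1) = v (2 * k + 1)"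
      using n by (auto simp: elf_def vec_simps)
    then show "ap (kap k h + el i j x) v = ap (el i j x + kap k h) v"
      using n n[symmetric] G_step by (intro ext) (auto simp: ap_kap kapf_def elf_def vec_simps)
  qed
  then show ?case using G_step by (metis add.assoc)
qed simp

lemma kap_D_hs: "u * u' = 1 \<Longrightarrow> supp_below r w \<Longrightarrow> hs r w c + kap r (D u u') = kap r (D u u') + hs r (u' *s w) (u' * u' * c)"
proof (rule aut_eqI)
  fix v assume u: "u * u' = 1" and w: "supp_below r w"
  have "om r w (kapf r (ap (D u u')) v) = om r w v"
    by (rule om_cong) (auto simp: kapf_def)
  moreover have "w (2 * r) = 0" "w (Suc (2 * r)) = 0" using w by (auto simp: supp_below_def)
  ultimately show "ap (hs r w c + kap r (D u u')) v = ap (kap r (D u u') + hs r (u' *s w) (u' * u' * c)) v"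
    using u w by (intro ext) (auto simp: ap_kap supp_below_scale hsf_def kapf_def vec_simps ap_D unit_cancel algebra_simps)
qed

lemma rho_D: "u * u' = 1 \<Longrightarrow> rho r (D u u') = kap (Suc r) (D u u') + kap r (D u' u)"
  by (rule aut_eqI, rule ext) (auto simp: ap_rho ap_kap rhof_def kapf_def ap_D mult.commute[of u'] numeral_3_eq_3)

lemma Q_kap_D: 
  assumes u: "u * u' = 1" and q: "q \<in> Q r"
  shows "- kap r (D u u') + q + kap r (D u u') \<in> Q r"
proof -
  let ?K = "kap r (D u u')"
  obtain w c g \<epsilon> where *: "supp_below r w" "g \<in> G r" "\<epsilon> \<in> E (Suc r)" "q = hs r w c + g + \<epsilon>"
    using q by (rule Q_E)
  have K: "?K \<in> G (Suc r)" by (rule kap_G) auto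
  have "- ?K + q + ?K = - ?K + hs r w c + ?K + (- ?K + g + ?K) + (- ?K + \<epsilon> + ?K)"
    by (simp add: * add.assoc)
  also have "- ?K + hs r w c + ?K = hs r (u' *s w) (u' * u' * c)"
    using kap_D_hs[OF u *(1), of c] by (simp add: add.assoc)
  also have "- ?K + g + ?K = g"
    using kap_comm[OF *(2), of "D u u'"] by (simp add: add.assoc) (metis minus_add_cancel)
  also have "hs r (u' *s w) (u' * u' * c) + g + (- ?K + \<epsilon> + ?K) \<in> Q r"
    using * K by (intro Q_I supp_below_scale E_conj')
  finally show ?thesis .
qed

lemma rho_X_hs: "rho r (X f) = hs (Suc r) ((- f) *s bv (2 * r + 1)) 0"
  by (subst hs_single) (auto simp: rho_X sigma_def)

lemma rho_fix_Q:
  assumes "l \<in> G (Suc 0)" "act l (bv 0) = bv 0"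
  shows "rho r l \<in> Q (Suc r)"
proof -
  obtain f \<epsilon> where "\<epsilon> \<in> E (Suc 0)" "l = X f + \<epsilon>" using stab_G1[OF assms] by blast
  then have "rho r l = hs (Suc r) ((- f) *s bv (2 * r + 1)) 0 + rho r \<epsilon>"
    by (simp add: rho_add E_G rho_X_hs)
  also have "\<dots> \<in> Q (Suc r)"
    using \<open>\<epsilon> \<in> E (Suc 0)\<close> by (intro Q_add Q_hs Q_of_E rho_E supp_below_scale supp_below_bv) auto
  finally show ?thesis .
qed

text \<open>A group normalized by \<open>rho r\<close> that contains the part of \<open>Q (Suc r)\<close> acting trivially on the
  plane of \<^term>\<open>bv (2 * r + 2)\<close> and \<^term>\<open>bv (2 * r)\<close>.\<close>

inductive_set R for r where
  R_0: "0 \<in> R r"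
| R_hs: "supp_below (Suc r) w \<Longrightarrow> w (2 * r + 1) = 0 \<Longrightarrow> x \<in> R r \<Longrightarrow> hs (Suc r) w c + x \<in> R r"
| R_hs': "supp_below r w \<Longrightarrow> x \<in> R r \<Longrightarrow> hs r w c + x \<in> R r"
| R_G: "g \<in> G r \<Longrightarrow> x \<in> R r \<Longrightarrow> g + x \<in> R r"

lemma R_add: "x \<in> R r \<Longrightarrow> y \<in> R r \<Longrightarrow> x + y \<in> R r"
  by (induction rule: R.induct) (auto simp: add.assoc intro: R.intros)

lemma R_Q: "x \<in> R r \<Longrightarrow> x \<in> Q (Suc r)"
  by (induction rule: R.induct) (auto intro!: Q_add Q_hs intro: Q_lower[OF G_mono[of _ r]] Q_lower[OF hs_G])

lemma R_conjI:
  assumes a: "a \<in> G (Suc (Suc r))"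
    and 1: "\<And>w c. supp_below (Suc r) w \<Longrightarrow> w (2 * r + 1) = 0 \<Longrightarrow> - a + hs (Suc r) w c + a \<in> R r"
    and 2: "\<And>w c. supp_below r w \<Longrightarrow> - a + hs r w c + a \<in> R r"
    and 3: "\<And>g. g \<in> G r \<Longrightarrow> - a + g + a \<in> R r"
  shows "x \<in> R r \<Longrightarrow> - a + x + a \<in> R r"
proof (induction rule: R.induct)
  case R_0
  show ?case by (simp add: R.R_0)
next
  case (R_hs w x c)
  have "- a + (hs (Suc r) w c + x) + a = (- a + hs (Suc r) w c + a) + (- a + x + a)" by (simp add: add.assoc)
  then show ?case using R_hs 1 by (simp add: R_add)
next
  case (R_hs' w x c)
  have "- a + (hs r w c + x) + a = (- a + hs r w c + a) + (- a + x + a)" by (simp add: add.assoc)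
  then show ?case using R_hs' 2 by (simp add: R_add)
next
  case (R_G g x)
  have "- a + (g + x) + a = (- a + g + a) + (- a + x + a)" by (simp add: add.assoc)
  then show ?case using R_G 3 by (simp add: R_add)
qed

lemma R_hs1: "supp_below (Suc r) w \<Longrightarrow> w (2 * r + 1) = 0 \<Longrightarrow> hs (Suc r) w c \<in> R r"
  using R_hs[OF _ _ R_0] by fastforce

lemma R_hs2: "supp_below r w \<Longrightarrow> hs r w c \<in> R r"
  using R_hs'[OF _ R_0] by fastforce

text \<open>The conjugate is \<open>a\<close> times a Heisenberg element with vector
  \<open>z - ap (- a) z\<close>. The hypothesis makes coordinate \<open>2 * r + 1\<close> of this
  vector vanish, as \<open>R_hs1\<close> demands.\<close>

lemma R_conj_hs:
  assumes z: "supp_below (Suc r) z" and a: "a \<in> G (Suc r)" "ap (- a) z (2 * r + 1) = z (2 * r + 1)" "a \<in> R r"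
  shows "- hs (Suc r) z 0 + a + hs (Suc r) z 0 \<in> R r"
proof -
  have az: "supp_below (Suc r) (ap (- a) (- z))" using z a by (intro supp_G[of "- a" "Suc r"]) (auto intro: G_minus)
  have m: "ap (- a) (- z) = - ap (- a) z" using G_scale[OF G_minus[OF a(1)], of "- 1" z] by simp
  have "- hs (Suc r) z 0 + a + hs (Suc r) z 0 = a + ((- a) + hs (Suc r) (- z) 0 - (- a)) + hs (Suc r) z 0"
    using z by (simp add: hs_minus add.assoc)
  also have "\<dots> = a + (hs (Suc r) (ap (- a) (- z)) 0 + hs (Suc r) z 0)"
    using z a by (subst hs_conj) (auto intro: G_minus simp: add.assoc)
  also have "\<dots> \<in> R r"
    using z az a by (subst hs_add) (auto intro!: R_add R_hs1 supp_below_diff simp: vec_simps m)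
  finally show ?thesis .
qed

lemma R_conj_X:
  fixes x :: "(nat \<Rightarrow> 'a) aut"
  assumes "x \<in> R r"
  shows "- rho r (X f) + x + rho r (X f) \<in> R r"
proof (rule R_conjI[OF _ _ _ _ assms])
  define z where "z = (- f) *s bv (2 * r + 1)"
  have z: "supp_below (Suc r) z" unfolding z_def by (intro supp_below_scale supp_below_bv) auto
  have e: "rho r (X f) = hs (Suc r) z 0" by (simp add: rho_X_hs z_def)
  show "rho r (X f) \<in> G (Suc (Suc r))" by (rule rho_G) auto
  fix w :: "nat \<Rightarrow> 'a" and c
  show "- rho r (X f) + hs (Suc r) w c + rho r (X f) \<in> R r" if w: "supp_below (Suc r) w" "w (2 * r + 1) = 0"
    unfolding e using z w by (simp add: hs_minus hs_add supp_below_add supp_below_diff R_hs1)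
  show "- rho r (X f) + hs r w c + rho r (X f) \<in> R r" if w: "supp_below r w"
    unfolding e
  proof (rule R_conj_hs[OF z])
    show "hs r w c \<in> G (Suc r)" "hs r w c \<in> R r" using w by (auto intro: hs_G R_hs2)
    show "ap (- hs r w c) z (2 * r + 1) = z (2 * r + 1)"
      using w by (simp add: hs_minus hsf_def vec_simps) (simp add: supp_below_def)
  qed
next
  fix g :: "(nat \<Rightarrow> 'a) aut" assume g: "g \<in> G r"
  define z where "z = (- f) *s bv (2 * r + 1)"
  have z: "supp_below (Suc r) z" unfolding z_def by (intro supp_below_scale supp_below_bv) auto
  have e: "rho r (X f) = hs (Suc r) z 0" by (simp add: rho_X_hs z_def)
  show "- rho r (X f) + g + rho r (X f) \<in> R r"
    unfolding e
  proof (rule R_conj_hs[OF z])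
    show "g \<in> G (Suc r)" using g by (rule G_mono) simp
    show "g \<in> R r" using R_G[OF g R_0] by simp
    show "ap (- g) z (2 * r + 1) = z (2 * r + 1)"
      using G_high[OF G_minus[OF g]] by simp
  qed
qed

lemma rho_comm: "g \<in> G r \<Longrightarrow> h \<in> G (Suc 0) \<Longrightarrow> rho r h + g = g + rho r h"
proof (induction rule: G.induct)
  case (G_step i j g x)
  have "rho r h + el i j x = el i j x + rho r h"
  proof (rule aut_eqI)
    fix v
    have n: "i < 2 * r" "sigma i < 2 * r" "j < 2 * r" "sigma j < 2 * r" using G_step by auto
    then have n: "k \<noteq> i" "k \<noteq> sigma i" "k \<noteq> j" "k \<noteq> sigma j" if "2 * r \<le> k" for k using that by linarith+
    have "elf i j x v k = v k" if "2 * r \<le> k" for k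
      using n[OF that] by (auto simp: elf_def vec_simps)
    then show "ap (rho r h + el i j x) v = ap (el i j x + rho r h) v"
      using n n[symmetric] G_step by (intro ext) (auto simp: ap_rho rhof_def elf_def vec_simps)
  qed
  then show ?case using G_step by (metis add.assoc)
qed simp

lemma rho_W_hs: "supp_below r w \<Longrightarrow> hs (Suc r) w c + rho r W = rho r W + hs r w c"
proof (rule aut_eqI)
  fix v assume w: "supp_below r w"
  then have "supp_below (Suc r) w" by (rule supp_below_mono) simp
  moreover have "om (Suc r) w (rhof r (ap W) v) = om r w v"
    using w unfolding om_Suc by (simp add: supp_below_def) (rule om_cong, auto simp: rhof_def)
  moreover have "w k = 0" if "2 * r \<le> k" for k using w that by (simp add: supp_below_def)
  ultimately show "ap (hs (Suc r) w c + rho r W) v = ap (rho r W + hs r w c) v"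
    using w by (intro ext) (auto simp: ap_rho hsf_def rhof_def vec_simps ap_W numeral_3_eq_3 algebra_simps)
qed

lemma rho_W_hs': "supp_below r w \<Longrightarrow> hs r w c + rho r W = rho r W + hs (Suc r) (- w) c"
proof (rule aut_eqI)
  fix v assume w: "supp_below r w"
  then have "supp_below (Suc r) w" by (rule supp_below_mono) simp
  moreover have "om r w (rhof r (ap W) v) = om r w v" "om (Suc r) w v = om r w v"
    using w unfolding om_Suc by (auto simp: supp_below_def rhof_def intro!: om_cong)
  moreover have "w k = 0" if "2 * r \<le> k" for k using w that by (simp add: supp_below_def)
  ultimately show "ap (hs r w c + rho r W) v = ap (rho r W + hs (Suc r) (- w) c) v"
    using w by (intro ext) (auto simp: ap_rho hsf_def rhof_def vec_simps ap_W numeral_3_eq_3 algebra_simps)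
qed

lemma rho_W_hs'':
  fixes x :: 'a
  shows "hs (Suc r) (x *s bv (2 * r)) 0 + rho r W = rho r W + hs (Suc r) ((- x) *s bv (2 * r)) 0"
proof (rule aut_eqI)
  fix v
  have "supp_below (Suc r) (y *s bv (2 * r))" for y :: 'a by (intro supp_below_scale supp_below_bv) auto
  then show "ap (hs (Suc r) (x *s bv (2 * r)) 0 + rho r W) v = ap (rho r W + hs (Suc r) ((- x) *s bv (2 * r)) 0) v"
    by (intro ext) (simp add: ap_rho hsf_def rhof_def vec_simps ap_W numeral_3_eq_3 om_bv_left)
qed

text \<open>The Weyl element exchanges the two planes, hence the Heisenberg parts of ranks
  \<open>r\<close> and \<open>r + 1\<close>. The component of \<open>w\<close> along
  \<open>bv (2 * r)\<close> stays in rank \<open>r + 1\<close> up to sign, which is why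
  \<open>w\<close> is split there.\<close>

lemma R_conj_W:
  fixes x :: "(nat \<Rightarrow> 'a) aut"
  assumes "x \<in> R r"
  shows "- rho r W + x + rho r W \<in> R r"
proof (rule R_conjI[OF _ _ _ _ assms])
  show "rho r W \<in> G (Suc (Suc r))" by (rule rho_G) auto
  fix w :: "nat \<Rightarrow> 'a" and c
  show "- rho r W + hs (Suc r) w c + rho r W \<in> R r" if w: "supp_below (Suc r) w" "w (2 * r + 1) = 0"
  proof -
    define w0 where "w0 = w(2 * r := 0)"
    define z where "z = w (2 * r) *s bv (2 * r)"
    have ww: "w = w0 + z" by (auto simp: w0_def z_def fun_eq_iff vec_simps)
    have w0: "supp_below r w0"
      unfolding supp_below_def
    proof (intro allI impI)
      fix i assume "2 * r \<le> i"
      then consider "i = 2 * r" | "i = 2 * r + 1" | "2 * Suc r \<le> i" by fastforce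
      then show "w0 i = 0" using w by cases (auto simp: w0_def supp_below_def)
    qed
    then have w0': "supp_below (Suc r) w0" by (rule supp_below_mono) simp
    have z: "supp_below (Suc r) z" unfolding z_def by (intro supp_below_scale supp_below_bv) auto
    define c' where "c' = c - om (Suc r) w0 z"
    have "hs (Suc r) w c = hs (Suc r) w0 c' + hs (Suc r) z 0"
      by (subst hs_add[OF w0' z]) (simp add: ww c'_def)
    then have "- rho r W + hs (Suc r) w c + rho r W = hs r w0 c' + hs (Suc r) ((- w (2 * r)) *s bv (2 * r)) 0"
      using rho_W_hs[OF w0, of c'] rho_W_hs''[of r "w (2 * r)"]
      by (simp add: add.assoc z_def) (simp add: add.assoc[symmetric])
    then show ?thesis
      using w0 by (auto intro!: R_add R_hs1 R_hs2 supp_below_scale supp_below_bv simp: vec_simps)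
  qed
  show "- rho r W + hs r w c + rho r W \<in> R r" if w: "supp_below r w"
    using rho_W_hs'[OF w, of c] w
    by (simp add: add.assoc) (auto intro!: R_hs1 elim: supp_below_mono simp: supp_below_def vec_simps)
next
  fix g :: "(nat \<Rightarrow> 'a) aut" assume g: "g \<in> G r"
  have "- rho r W + g + rho r W = g" using rho_comm[OF g W_G] by (simp add: add.assoc) (metis minus_add_cancel)
  then show "- rho r W + g + rho r W \<in> R r" using R_G[OF g R_0] by simp
qed

lemma R_conj:
  fixes x :: "(nat \<Rightarrow> 'a) aut"
  assumes "l \<in> G (Suc 0)" "x \<in> R r"
  shows "- rho r l + x + rho r l \<in> R r"
  using assms
proof (induction arbitrary: x rule: G1_induct)
  case (X f g)
  have "- rho r (X f + g) + x + rho r (X f + g) = - rho r g + (- rho r (X f) + x + rho r (X f)) + rho r g"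
    using X by (simp add: rho_add minus_add add.assoc diff_conv_add_uminus del: add_uminus_conv_diff)
  then show ?case using X R_conj_X by simp
next
  case (Y f g)
  \<comment> \<open>This is \<open>Y_conv\<close> with \<open>- W\<close> spelled as
    \<open>W + W + W\<close>, so that conjugation by \<open>W\<close> itself suffices.\<close>
  have Y: "Y f = W + (W + (W + (X (- f) + W)))"
    by (rule aut_eqI) (auto simp: ap_W elf_X elf_Y fun_eq_iff)
  have *: "- rho r (Y f + g) + x + rho r (Y f + g)
    = - rho r g + (- rho r W + (- rho r (X (- f)) + (- rho r W + (- rho r W + (- rho r W + x + rho r W) + rho r W) + rho r W) + rho r (X (- f))) + rho r W) + rho r g"
    using Y.hyps unfolding Y by (simp add: rho_add G_add minus_add add.assoc diff_conv_add_uminus del: add_uminus_conv_diff)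
  show ?case unfolding * by (intro Y.IH R_conj_X R_conj_W Y.prems)
qed simp

text \<open>On the plane of \<open>bv (2 * r + 2)\<close> and \<open>bv (2 * r)\<close> the diagonal
  element has determinant \<open>u\<close>, so in general it does not come from
  \<open>rho r\<close>; it still normalizes \<open>rho r\<close>, rescaling the parameters of
  \<open>X\<close> and \<open>Y\<close> by \<open>u'\<close> and \<open>u\<close>.\<close>

lemma kap_rho_conj:
  assumes u: "u * u' = 1" and l: "l \<in> G (Suc 0)"
  shows "\<exists>l'\<in>G (Suc 0). kap r (D u u') + rho r l = rho r l' + kap r (D u u')"
  using l
proof (induction rule: G1_induct)
  case zero
  show ?case by (rule bexI[of _ 0]) (auto intro: G_0)
next
  case (X f g)
  then obtain l' where l': "l' \<in> G (Suc 0)" "kap r (D u u') + rho r g = rho r l' + kap r (D u u')" by blast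
  have "kap r (D u u') + rho r (X f) = rho r (X (u' * f)) + kap r (D u u')"
    using u by (intro aut_eqI ext) (auto simp: ap_rho rhof_def ap_kap kapf_def elf_X ap_D unit_cancel numeral_3_eq_3 algebra_simps)
  then have "kap r (D u u') + rho r (X f + g) = rho r (X (u' * f) + l') + kap r (D u u')"
    using l' X by (simp add: rho_add add.assoc[symmetric]) (simp add: add.assoc)
  then show ?case using l' by (meson G_add X_G)
next
  case (Y f g)
  then obtain l' where l': "l' \<in> G (Suc 0)" "kap r (D u u') + rho r g = rho r l' + kap r (D u u')" by blast
  have "kap r (D u u') + rho r (Y f) = rho r (Y (u * f)) + kap r (D u u')"
    using u by (intro aut_eqI ext) (auto simp: ap_rho rhof_def ap_kap kapf_def elf_Y ap_D unit_cancel numeral_3_eq_3 algebra_simps)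
  then have "kap r (D u u') + rho r (Y f + g) = rho r (Y (u * f) + l') + kap r (D u u')"
    using l' Y by (simp add: rho_add add.assoc[symmetric]) (simp add: add.assoc)
  then show ?case using l' by (meson G_add Y_G)
qed

end

section \<open>The graph of cosets\<close>

text \<open>\<open>stab\<close> is the induction hypothesis in rank \<open>r + 1\<close>; the graph
  lives one rank higher, over vectors with \<open>r + 2\<close> planes.\<close>

locale rank_step = reduction \<pi> for \<pi> :: "'a::comm_ring_1 \<Rightarrow> 'b::field poly" +
  fixes r :: nat
  assumes stab: "g \<in> G (Suc r) \<Longrightarrow> act g (bv (2 * r)) = bv (2 * r) \<Longrightarrow> g \<in> Q r"
begin

abbreviation "GG \<equiv> G (Suc (Suc r))"
abbreviation "QQ \<equiv> Q (Suc r)"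
abbreviation "bb \<equiv> (bv (Suc (Suc (2 * r))) :: nat \<Rightarrow> 'b poly)"

lemma act_rho_base: "l \<in> G (Suc 0) \<Longrightarrow>
  act (rho r l) bb = act l (bv 0) 0 *s bb + act l (bv 0) 1 *s bv (2 * r)"
  by (intro ext) (simp add: act_rho rhof_def vec_simps pr2_bv act_zero[of l "Suc 0"] bv_apply)

lemma QQ_fix: "q \<in> QQ \<Longrightarrow> act q bb = bb"
  using Q_fix[of q "Suc r"] by simp

lemma rho_QQ: "l \<in> G (Suc 0) \<Longrightarrow> act l (bv 0) = bv 0 \<Longrightarrow> rho r l \<in> QQ"
  by (rule rho_fix_Q)

lemma QQ_rho_D:
  assumes u: "u * u' = 1" and q: "q \<in> QQ"
  shows "- rho r (D u u') + q + rho r (D u u') \<in> QQ"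
proof -
  let ?K = "kap (Suc r) (D u u')" and ?k = "kap r (D u' u)"
  have k: "?k \<in> QQ" by (intro Q_lower kap_G) auto
  have "- rho r (D u u') + q + rho r (D u u') = - ?k + (- ?K + q + ?K) + ?k"
    by (simp add: rho_D[OF u] minus_add add.assoc diff_conv_add_uminus del: add_uminus_conv_diff)
  also have "\<dots> \<in> QQ" by (intro Q_add Q_minus k Q_kap_D u q)
  finally show ?thesis .
qed

text \<open>Up to a diagonal element, which normalizes \<open>QQ\<close>, such an \<open>l\<close>
  fixes \<open>bv 0\<close>, and then its image under \<open>rho r\<close> lies in \<open>QQ\<close>
  itself.\<close>

lemma QQ_rho_line:
  assumes l: "l \<in> G (Suc 0)" "act l (bv 0) 1 = 0" and q: "q \<in> QQ"
  shows "- rho r l + q + rho r l \<in> QQ"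
proof -
  define x where "x = act l (bv 0) 0"
  have lx: "act l (bv 0) = x *s bv 0"
    using act_pr2_pr2[OF l(1), of 1 0] l(2) by (simp add: pr2_bv x_def)
  then have "prim (x *s bv 0)" using prim_act[OF l(1)] by (metis prim_bv)
  then have "x dvd 1" by (rule prim_scale)
  then obtain u u' where u: "u * u' = 1" "\<pi> u = x" using unit_lift_dvd by blast
  define l' where "l' = - D u u' + l"
  have "act (D u u') (bv 0) = x *s bv 0"
    using u by (intro ext) (simp add: act_D bv_apply vec_simps)
  then have "act l' (bv 0) = bv 0"
    using act_minus_act[of "D u u'" 1 "bv 0"] by (simp add: l'_def act_add_G1 G_minus lx)
  moreover have l': "l' \<in> G (Suc 0)" using l by (simp add: l'_def G_add G_minus)
  ultimately have Q: "rho r l' \<in> QQ" by (intro rho_QQ)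
  have "l = D u u' + l'" by (simp add: l'_def add.assoc[symmetric])
  then have "rho r l = rho r (D u u') + rho r l'" using l' by (simp add: rho_add)
  then have "- rho r l + q + rho r l = - rho r l' + (- rho r (D u u') + q + rho r (D u u')) + rho r l'"
    by (simp add: minus_add add.assoc diff_conv_add_uminus del: add_uminus_conv_diff)
  also have "\<dots> \<in> QQ" by (intro Q_add Q_minus Q QQ_rho_D u q)
  finally show ?thesis .
qed

text \<open>This is the uniqueness of lifted edges. Comparing coordinates, either both vectors lie
  on the line of \<open>bb\<close>, or the Levi factor of \<open>q\<close> preserves the line of
  \<open>bv (2 * r)\<close>. In the second case \<open>stab\<close> splits that factor further,
  \<open>R_conj\<close> carries the pieces past \<open>rho r l'\<close>, and the product becomes one
  element of \<open>rho r\<close> times an element of \<open>QQ\<close>.\<close>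

lemma QQ_core:
  assumes l: "l \<in> G (Suc 0)" and l': "l' \<in> G (Suc 0)" and q: "q \<in> QQ"
    and eq: "act (rho r l) bb = act q (act (rho r l') bb)"
  shows "- rho r l + q + rho r l' \<in> QQ"
proof -
  define x d where "x = act l (bv 0) 0" and "d = act l (bv 0) 1"
  define x' d' where "x' = act l' (bv 0) 0" and "d' = act l' (bv 0) 1"
  obtain w c g \<epsilon> where w: "supp_below (Suc r) w" and g: "g \<in> G (Suc r)" and \<epsilon>: "\<epsilon> \<in> E (Suc (Suc r))"
    and q_eq: "q = hs (Suc r) w c + g + \<epsilon>"
    using q by (rule Q_E)
  define y where "y = act g (bv (2 * r))"
  have y_high: "y i = 0" if "2 * r + 2 \<le> i" for i
    using act_high[OF g, of i "bv (2 * r)"] that by (simp add: y_def bv_apply)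
  have gG: "g \<in> GG" using g by (rule G_mono) simp
  have rhoG: "rho r h \<in> GG" if "h \<in> G (Suc 0)" for h using that by (simp add: rho_G)
  have "act q (x' *s bb + d' *s bv (2 * r)) = hsf (Suc r) (red w) (\<pi> c) (x' *s bb + d' *s y)"
    using hs_G[OF w] gG act_E[OF \<epsilon>] w
    by (simp add: q_eq add.assoc act_add[of _ "Suc (Suc r)"] act_hs act_vec_add[OF gG] act_scale[OF gG]
        act_fix_bv[OF g] y_def)
  then have e: "x *s bb + d *s bv (2 * r) = hsf (Suc r) (red w) (\<pi> c) (x' *s bb + d' *s y)"
    using eq l l' by (simp add: act_rho_base x_def d_def x'_def d'_def)
  have e_low: "d * bv (2 * r) i = d' * y i" if "i < 2 * r + 2" for i
    using fun_cong[OF e, of i] that y_high[of "2 * r + 3"]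
    by (simp add: hsf_def vec_simps numeral_3_eq_3)
  show ?thesis
  proof (cases "d' = 0")
    case True
    have "d = 0" using e_low[of "2 * r"] True by (simp add: bv_apply)
    have "x = x'" using fun_cong[OF e, of "2 * r + 2"] True \<open>d = 0\<close>
      by (simp add: hsf_def vec_simps om_bv_high)
    have lv: "act l (bv 0) = act l' (bv 0)"
      using act_pr2_pr2[OF l, of 1 0] act_pr2_pr2[OF l', of 1 0] \<open>x = x'\<close> \<open>d = 0\<close> True
      by (simp add: pr2_bv x_def x'_def d_def d'_def)
    define l0 where "l0 = - l + l'"
    have l0: "l0 \<in> G (Suc 0)" using l l' by (simp add: l0_def G_add G_minus)
    have "act l0 (bv 0) = bv 0"
      using l by (simp add: l0_def act_add_G1 G_minus lv[symmetric])
    with l0 have "rho r l0 \<in> QQ" by (rule rho_QQ)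
    moreover have "- rho r l + q + rho r l \<in> QQ"
      using QQ_rho_line[OF l _ q] \<open>d = 0\<close> by (simp add: d_def)
    moreover have "- rho r l + q + rho r l' = (- rho r l + q + rho r l) + rho r l0"
      using l l' by (simp add: l0_def rho_add rho_minus G_minus add.assoc)
    ultimately show ?thesis using Q_add by simp
  next
    case False
    \<comment> \<open>With \<open>d' \<noteq> 0\<close> the lower coordinates force \<open>y\<close>
      onto the line of \<open>bv (2 * r)\<close>; primitivity makes the factor \<open>z\<close> a
      unit, which lifts to a diagonal element.\<close>
    have y0: "y i = 0" if "i \<noteq> 2 * r" for i
      using e_low[of i] y_high[of i] that False by (cases "i < 2 * r + 2") (auto simp: bv_apply)
    define z where "z = y (2 * r)"
    have yz: "y = z *s bv (2 * r)" using y0 by (intro ext) (simp add: z_def vec_simps)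
    have "prim y" unfolding y_def using prim_act[OF g] by simp
    then have "z dvd 1" unfolding yz by (rule prim_scale)
    then obtain u u' where u: "u * u' = 1" "\<pi> u = z" using unit_lift_dvd by blast
    let ?\<eta> = "kap r (D u u')"
    have eta: "?\<eta> \<in> G (Suc r)" by (rule kap_G) auto
    have "act ?\<eta> (bv (2 * r)) = y"
      unfolding yz using u by (intro ext) (simp add: act_kap kapf_def vec_simps act_D)
    then have "act (- ?\<eta> + g) (bv (2 * r)) = bv (2 * r)"
      using act_minus_act[OF eta, of "bv (2 * r)"] by (simp add: act_add[of _ "Suc r"] G_minus eta y_def[symmetric])
    then have "- ?\<eta> + g \<in> Q r" using stab eta g by (simp add: G_add G_minus)
    then obtain w2 c2 g2 \<epsilon>2 where w2: "supp_below r w2" and g2: "g2 \<in> G r" and \<epsilon>2: "\<epsilon>2 \<in> E (Suc r)"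
      and "- ?\<eta> + g = hs r w2 c2 + g2 + \<epsilon>2" by (rule Q_E)
    then have g_eq: "g = ?\<eta> + (hs r w2 c2 + g2 + \<epsilon>2)" by (metis add_minus_cancel)
    \<comment> \<open>Coordinate \<open>2 * r + 1\<close> is the part of the Heisenberg element that
      \<open>R\<close> excludes. It is itself \<open>rho r (X (- f))\<close> and is merged with the
      rank one factors.\<close>
    define f where "f = w (2 * r + 1)"
    define w1 where "w1 = w(2 * r + 1 := 0)"
    have w1: "supp_below (Suc r) w1" using w by (simp add: w1_def supp_below_def)
    have wz: "supp_below (Suc r) (f *s bv (2 * r + 1))" by (intro supp_below_scale supp_below_bv) simp
    have ww: "w = f *s bv (2 * r + 1) + w1" by (auto simp: f_def w1_def fun_eq_iff vec_simps)
    define c1 where "c1 = c - om (Suc r) (f *s bv (2 * r + 1)) w1"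
    have hs_eq: "hs (Suc r) w c = rho r (X (- f)) + hs (Suc r) w1 c1"
      unfolding rho_X_hs using wz w1 by (subst hs_add) (simp_all add: ww c1_def)
    define w3 where "w3 = ap (- ?\<eta>) w1"
    have w3: "supp_below (Suc r) w3" unfolding w3_def using supp_G[OF G_minus[OF eta] _ w1] by simp
    have w3': "w3 (2 * r + 1) = 0"
    proof -
      have uu: "u' * u = 1" using u by (simp add: mult.commute)
      have "- ?\<eta> = kap r (- D u u')" by (simp add: kap_minus)
      also have "- D u u' = D u' u"
        using u uu by (intro minus_unique aut_eqI) (simp add: ap_D fun_eq_iff unit_cancel)
      finally have "- ?\<eta> = kap r (D u' u)" .
      then show ?thesis
        using uu by (simp add: w3_def ap_kap kapf_def ap_D w1_def)
    qed
    have eta_hs: "hs (Suc r) w1 c1 + ?\<eta> = ?\<eta> + hs (Suc r) w3 c1"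
      using hs_conj[OF G_minus[OF eta] w1, of c1] unfolding w3_def[symmetric]
      by (metis add_minus_cancel add.assoc diff_minus_eq_add)
    define \<rho> where "\<rho> = hs (Suc r) w3 c1 + (hs r w2 c2 + g2)"
    have \<rho>: "\<rho> \<in> R r"
      unfolding \<rho>_def using R_hs[OF w3 w3' R_hs'[OF w2 R_G[OF g2 R_0]]] by simp
    have q_eq2: "q = rho r (X (- f)) + ?\<eta> + \<rho> + (\<epsilon>2 + \<epsilon>)"
    proof -
      have "q = rho r (X (- f)) + (hs (Suc r) w1 c1 + ?\<eta>) + (hs r w2 c2 + g2) + (\<epsilon>2 + \<epsilon>)"
        by (simp only: q_eq hs_eq g_eq add.assoc)
      then show ?thesis unfolding eta_hs \<rho>_def by (simp only: add.assoc)
    qed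
    obtain l'' where l'': "l'' \<in> G (Suc 0)" "?\<eta> + rho r l' = rho r l'' + ?\<eta>"
      using kap_rho_conj[OF u(1) l'] by blast
    define ll where "ll = - l + X (- f) + l''"
    have lam: "ll \<in> G (Suc 0)" using l l'' by (simp add: ll_def G_add G_diff G_minus)
    define \<rho>' where "\<rho>' = - rho r l' + \<rho> + rho r l'"
    have \<rho>': "\<rho>' \<in> QQ" unfolding \<rho>'_def by (intro R_Q R_conj l' \<rho>)
    define \<delta> where "\<delta> = - rho r l' + (\<epsilon>2 + \<epsilon>) + rho r l'"
    have \<delta>: "\<delta> \<in> QQ"
      unfolding \<delta>_def using E_mono[OF \<epsilon>2, of "Suc (Suc r)"] \<epsilon> rhoG[OF l'] by (intro Q_E_conj E_add) auto
    have tot: "- rho r l + q + rho r l' = rho r ll + (?\<eta> + \<rho>' + \<delta>)"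
    proof -
      have "- rho r l + q + rho r l' = - rho r l + rho r (X (- f)) + (?\<eta> + rho r l') + \<rho>' + \<delta>"
        unfolding q_eq2 \<rho>'_def \<delta>_def by (simp add: add.assoc diff_conv_add_uminus del: add_uminus_conv_diff)
      also have "\<dots> = - rho r l + rho r (X (- f)) + rho r l'' + (?\<eta> + \<rho>' + \<delta>)"
        unfolding l''(2) by (simp only: add.assoc)
      also have "- rho r l + rho r (X (- f)) + rho r l'' = rho r ll"
        using l l'' by (simp add: ll_def rho_add rho_minus G_add G_diff G_minus add.assoc)
      finally show ?thesis .
    qed
    have fixQ: "?\<eta> + \<rho>' + \<delta> \<in> QQ" by (intro Q_add Q_lower eta \<rho>' \<delta>)
    \<comment> \<open>The factor after \<open>rho r ll\<close> fixes \<open>bb\<close>, and so does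
      the whole product; hence \<open>rho r ll\<close> fixes \<open>bb\<close> and the rank one
      stabilizer applies.\<close>
    have "act (- rho r l + q + rho r l') bb = bb"
      using rhoG[OF l] Q_G[OF q] eq[symmetric]
      by (simp add: add.assoc act_add[of _ "Suc (Suc r)"] G_minus)
    then have "act (rho r ll) bb = bb"
      using QQ_fix[OF fixQ] rhoG[OF lam] unfolding tot by (simp add: act_add[of _ "Suc (Suc r)"])
    then have "act ll (bv 0) 0 *s bb + act ll (bv 0) 1 *s bv (2 * r) = bb"
      using act_rho_base[OF lam] by simp
    note * = fun_cong[OF this]
    have "act ll (bv 0) 0 = 1" using *[of "2 * r + 2"] by (simp add: vec_simps)
    moreover have "act ll (bv 0) (Suc 0) = 0" using *[of "2 * r"] by (simp add: vec_simps)
    ultimately have "act ll (bv 0) = bv 0"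
      using act_pr2_pr2[OF lam, of 1 0] by (simp add: pr2_bv)
    then have "rho r ll \<in> QQ" by (rule rho_QQ[OF lam])
    then show ?thesis unfolding tot by (intro Q_add fixQ)
  qed
qed

text \<open>The elements represent cosets modulo \<open>QQ\<close>; \<open>adj\<close> is the lift of orthogonality of the vectors
  \<open>pos g\<close>. That it is a covering is the content of \<open>edge_lift\<close> and \<open>edge_unique\<close>.\<close>

definition adj :: "(nat \<Rightarrow> 'a) aut \<Rightarrow> (nat \<Rightarrow> 'a) aut \<Rightarrow> bool" where
  "adj g h \<longleftrightarrow> g \<in> GG \<and> h \<in> GG \<and> (\<exists>q\<in>QQ. \<exists>l\<in>G (Suc 0). \<exists>q'\<in>QQ. - g + h = q + rho r l + q')"

abbreviation pos :: "(nat \<Rightarrow> 'a) aut \<Rightarrow> nat \<Rightarrow> 'b poly" where "pos g \<equiv> act g bb"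

abbreviation form :: "(nat \<Rightarrow> 'b poly) \<Rightarrow> (nat \<Rightarrow> 'b poly) \<Rightarrow> 'b poly" where
  "form \<equiv> om (Suc (Suc r))"

definition pt :: "(nat \<Rightarrow> 'b poly) \<Rightarrow> bool" where
  "pt v \<longleftrightarrow> prim v \<and> supp_below (Suc (Suc r)) v"

lemma act_addG: "g \<in> GG \<Longrightarrow> act (g + h) w = act g (act h w)"
  by (rule act_add)

lemma pt_act: "g \<in> GG \<Longrightarrow> pt v \<Longrightarrow> pt (act g v)"
  by (simp add: pt_def prim_act supp_act)

lemma pt_bb: "pt bb"
  by (simp add: pt_def supp_below_bv)

lemma pt_at: "g \<in> GG \<Longrightarrow> pt (pos g)"
  by (rule pt_act[OF _ pt_bb])

lemma adj_G: "adj g h \<Longrightarrow> g \<in> GG" "adj g h \<Longrightarrow> h \<in> GG"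
  by (auto simp: adj_def)

lemma adjI: "g \<in> GG \<Longrightarrow> q \<in> QQ \<Longrightarrow> l \<in> G (Suc 0) \<Longrightarrow> q' \<in> QQ \<Longrightarrow> - g + h = q + rho r l + q' \<Longrightarrow> adj g h"
proof -
  assume *: "g \<in> GG" "q \<in> QQ" "l \<in> G (Suc 0)" "q' \<in> QQ" "- g + h = q + rho r l + q'"
  then have "h = g + (q + rho r l + q')" by (metis add_minus_cancel)
  then have "h \<in> GG" using * by (simp add: G_add Q_G rho_G)
  then show ?thesis using * unfolding adj_def by blast
qed

lemma adj_sym: "adj g h \<Longrightarrow> adj h g"
proof -
  assume "adj g h"
  then obtain q l q' where *: "g \<in> GG" "h \<in> GG" "q \<in> QQ" "l \<in> G (Suc 0)" "q' \<in> QQ" "- g + h = q + rho r l + q'"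
    unfolding adj_def by blast
  have "- h + g = - (- g + h)" by (simp add: minus_add)
  also have "\<dots> = - q' + rho r (- l) + - q"
    unfolding *(6) using * by (simp add: minus_add rho_minus add.assoc diff_conv_add_uminus del: add_uminus_conv_diff)
  finally show ?thesis using * by (intro adjI[of h "- q'" "- l" "- q"]) (auto intro: Q_minus G_minus)
qed

lemma adj_trans_left: "k \<in> GG \<Longrightarrow> adj g h \<Longrightarrow> adj (k + g) (k + h)"
  by (auto simp: adj_def G_add minus_add add.assoc diff_conv_add_uminus simp del: add_uminus_conv_diff)

lemma adj_Q: "adj g h \<Longrightarrow> q \<in> QQ \<Longrightarrow> adj g (h + q)"
proof -
  assume "adj g h" and q: "q \<in> QQ"
  then obtain q1 l q' where *: "g \<in> GG" "h \<in> GG" "q1 \<in> QQ" "l \<in> G (Suc 0)" "q' \<in> QQ" "- g + h = q1 + rho r l + q'"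
    unfolding adj_def by blast
  have "- g + (h + q) = q1 + rho r l + (q' + q)" by (simp only: *(6) add.assoc[symmetric])
  then show ?thesis using * q by (intro adjI[of g q1 l "q' + q"]) (auto intro: Q_add)
qed

lemma adj_Q_left: "adj g h \<Longrightarrow> q \<in> QQ \<Longrightarrow> adj (g + q) h"
  by (meson adj_Q adj_sym)

lemma adj_rho: "l \<in> G (Suc 0) \<Longrightarrow> g \<in> GG \<Longrightarrow> adj g (g + rho r l)"
  by (rule adjI[of g 0 l 0]) auto

lemma adj_QQ: "q \<in> QQ \<Longrightarrow> g \<in> GG \<Longrightarrow> adj g (g + q)"
  by (rule adjI[of g q 0 0]) (auto intro: G_0)

lemma adj_refl: "g \<in> GG \<Longrightarrow> adj g g"
  using adj_QQ[of 0 g] by simp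

lemma form_base: "form bb v = v (2 * r + 3)"
  by (simp add: om_bv_left numeral_3_eq_3)

lemma form_act: "g \<in> GG \<Longrightarrow> form (act g v) (act g w) = form v w"
  by (rule om_act)

lemma adj_perp: "adj g h \<Longrightarrow> form (pos g) (pos h) = 0"
proof -
  assume "adj g h"
  then obtain q l q' where *: "g \<in> GG" "h \<in> GG" "q \<in> QQ" "l \<in> G (Suc 0)" "q' \<in> QQ" "- g + h = q + rho r l + q'"
    unfolding adj_def by blast
  then have h: "h = g + (q + (rho r l + q'))" by (metis add_minus_cancel add.assoc)
  have "form (pos g) (pos h) = form bb (act q (act (rho r l) bb))"
    unfolding h using *(1-5) by (simp add: form_act act_addG Q_G rho_G QQ_fix)
  also have "\<dots> = form (act q bb) (act q (act (rho r l) bb))" using * by (simp add: QQ_fix)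
  also have "\<dots> = form bb (act (rho r l) bb)" using * by (simp add: form_act Q_G)
  also have "\<dots> = 0" using * by (simp add: form_base act_rho_base vec_simps)
  finally show ?thesis .
qed

text \<open>After \<open>pos g\<close> is moved to \<open>bb\<close>, the lower rank group gathers
  \<open>w\<close> in the span of \<open>bb\<close> and \<open>bv (2 * r)\<close>, where primitivity
  of the coordinate pair lets \<open>G1_trans\<close> reach it.\<close>

lemma edge_lift:
  assumes g: "g \<in> GG" and w: "pt w" "form (pos g) w = 0"
  shows "\<exists>h. adj g h \<and> pos h = w"
proof -
  define w' where "w' = act (- g) w"
  have w': "pt w'" "act g w' = w" using w g by (auto simp: w'_def pt_act G_minus)
  have "form bb w' = 0" using w(2) form_act[OF g, of bb w'] w' by simp
  then have wf: "w' (2 * r + 3) = 0" by (simp add: form_base)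
  define lo where "lo = (\<lambda>i. if i < 2 * Suc r then w' i else 0)"
  have lo: "supp_below (Suc r) lo" by (simp add: lo_def supp_below_def)
  have w_eq: "w' = w' (2 * r + 2) *s bb + lo"
  proof
    fix i
    consider "i < 2 * r + 2" | "i = 2 * r + 2" | "i = 2 * r + 3" | "2 * r + 4 \<le> i" by linarith
    then show "w' i = (w' (2 * r + 2) *s bb + lo) i"
      using wf w'(1) by cases (auto simp: lo_def vec_simps pt_def supp_below_def)
  qed
  obtain k c where k: "k \<in> G (Suc r)" "act k lo = c *s bv (2 * r)" using G_gcd[OF lo] by blast
  have kG: "k \<in> GG" using k(1) by (rule G_mono) simp
  define x where "x = w' (2 * r + 2)"
  have kw: "act k w' = x *s bb + c *s bv (2 * r)"
    by (subst w_eq) (simp add: act_vec_add[OF k(1)] act_scale[OF k(1)] act_fix_bv[OF k(1)] k(2) x_def)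
  have "prim (act k w')" using w' by (simp add: pt_def prim_act[OF k(1)])
  then have "prim (pr2 x c)"
    unfolding prim_def kw
  proof (intro allI impI)
    fix d assume *: "\<forall>d. (\<forall>i. d dvd (x *s bb + c *s bv (2 * r)) i) \<longrightarrow> d dvd 1" "\<forall>i. d dvd pr2 x c i"
    then have "d dvd x" "d dvd c" by (metis pr2_simps)+
    then show "d dvd 1" using * by (auto simp: vec_simps)
  qed
  then obtain l where l: "l \<in> G (Suc 0)" "act l (bv 0) = pr2 x c" using G1_trans by blast
  have lb: "act (rho r l) bb = act k w'" using l by (simp add: act_rho_base kw)
  have "adj g (g + (- k + rho r l))"
    using g l Q_lower[OF G_minus[OF k(1)]]
    by (intro adjI[of g "- k" l 0]) (simp_all only: minus_add_cancel add_0_right Q_0)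
  moreover have "pos (g + (- k + rho r l)) = w"
    using g kG l w'(2) by (simp add: act_addG G_minus rho_G lb)
  ultimately show ?thesis by blast
qed

lemma edge_unique:
  assumes "adj g h" "adj g h'" "pos h = pos h'"
  shows "- h + h' \<in> QQ"
proof -
  obtain q l p where A: "g \<in> GG" "h \<in> GG" "q \<in> QQ" "l \<in> G (Suc 0)" "p \<in> QQ" "- g + h = q + rho r l + p"
    using assms(1) unfolding adj_def by blast
  obtain q' l' p' where B: "h' \<in> GG" "q' \<in> QQ" "l' \<in> G (Suc 0)" "p' \<in> QQ" "- g + h' = q' + rho r l' + p'"
    using assms(2) unfolding adj_def by blast
  have h: "h = g + (q + (rho r l + p))" using A by (metis add_minus_cancel add.assoc)
  have h': "h' = g + (q' + (rho r l' + p'))" using B by (metis add_minus_cancel add.assoc)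
  have "act g (act q (act (rho r l) bb)) = act g (act q' (act (rho r l') bb))"
    using assms(3) A B by (simp add: h h' act_addG Q_G rho_G QQ_fix)
  then have "act q (act (rho r l) bb) = act q' (act (rho r l') bb)"
    using A(1) act_minus_act by metis
  then have "act (rho r l) bb = act (- q) (act q' (act (rho r l') bb))"
    using Q_G[OF A(3)] act_minus_act by metis
  then have "act (rho r l) bb = act (- q + q') (act (rho r l') bb)"
    using Q_G[OF A(3)] by (simp add: act_addG G_minus)
  then have mid: "- rho r l + (- q + q') + rho r l' \<in> QQ"
    using A B by (intro QQ_core Q_add Q_minus) auto
  have "- p + (- rho r l + (- q + q') + rho r l') + p' \<in> QQ"
    by (rule Q_add[OF Q_add[OF Q_minus[OF A(5)] mid] B(4)])
  moreover have "- h + h' = - p + (- rho r l + (- q + q') + rho r l') + p'"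
    by (simp add: h h' minus_add add.assoc diff_conv_add_uminus del: add_uminus_conv_diff)
  ultimately show ?thesis by simp
qed

text \<open>The neighbours of \<open>g\<close> over one vector form a single coset, and adjacency
  depends on cosets. Later arguments use this to exchange given lifts for explicit ones.\<close>

lemma adj_replace: "adj g h \<Longrightarrow> adj g h' \<Longrightarrow> pos h = pos h' \<Longrightarrow> adj k h \<Longrightarrow> adj k h'"
proof -
  assume "adj g h" "adj g h'" "pos h = pos h'" and k: "adj k h"
  then have "- h + h' \<in> QQ" by (intro edge_unique)
  from adj_Q[OF k this] show ?thesis by simp
qed

section \<open>Triangles\<close>

text \<open>\<open>tri\<close> quantifies over all lifts, hence is invariant under the group; \<open>closes\<close> fixes the first
  lift to be \<open>0\<close>, and may only be normalized by elements of \<open>QQ\<close>.\<close>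

definition closes :: "(nat \<Rightarrow> 'b poly) \<Rightarrow> (nat \<Rightarrow> 'b poly) \<Rightarrow> bool" where
  "closes v w \<longleftrightarrow> (\<forall>g h. adj 0 g \<longrightarrow> adj g h \<longrightarrow> pos g = v \<longrightarrow> pos h = w \<longrightarrow> adj 0 h)"

definition tri :: "(nat \<Rightarrow> 'b poly) \<Rightarrow> (nat \<Rightarrow> 'b poly) \<Rightarrow> (nat \<Rightarrow> 'b poly) \<Rightarrow> bool" where
  "tri u v w \<longleftrightarrow> (\<forall>g1 g2 g3. adj g1 g2 \<longrightarrow> adj g2 g3 \<longrightarrow> pos g1 = u \<longrightarrow> pos g2 = v \<longrightarrow> pos g3 = w \<longrightarrow> adj g1 g3)"

lemma adj_0_Q: "t \<in> QQ \<Longrightarrow> adj 0 h \<Longrightarrow> adj 0 (t + h)"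
  using adj_Q_left[OF adj_trans_left[OF Q_G, of t 0 h], of "- t"] by (simp add: Q_minus)

lemma adj_0_Q_iff: "t \<in> QQ \<Longrightarrow> adj 0 (t + h) \<longleftrightarrow> adj 0 h"
  using adj_0_Q[of t h] adj_0_Q[of "- t" "t + h"] by (auto simp: Q_minus)

lemma adj_shift_iff: "k \<in> GG \<Longrightarrow> adj (k + g) (k + h) \<longleftrightarrow> adj g h"
  using adj_trans_left[of k g h] adj_trans_left[of "- k" "k + g" "k + h"] by (auto simp: G_minus)

lemma closes_Q: "t \<in> QQ \<Longrightarrow> closes (act t v) (act t w) \<Longrightarrow> closes v w"
  unfolding closes_def
proof (intro allI impI)
  fix g h assume t: "t \<in> QQ" and *: "adj 0 g" "adj g h" "pos g = v" "pos h = w"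
    and cl: "\<forall>g h. adj 0 g \<longrightarrow> adj g h \<longrightarrow> pos g = act t v \<longrightarrow> pos h = act t w \<longrightarrow> adj 0 h"
  have "adj 0 (t + h)"
    using cl[rule_format, of "t + g" "t + h"] * t
    by (simp add: adj_0_Q adj_trans_left Q_G act_addG)
  then show "adj 0 h" using t by (simp add: adj_0_Q_iff)
qed

lemma triI:
  assumes "\<And>k. k \<in> GG \<Longrightarrow> act k u = bb \<Longrightarrow> closes (act k v) (act k w)"
  shows "tri u v w"
  unfolding tri_def
proof (intro allI impI)
  fix g1 g2 g3 assume *: "adj g1 g2" "adj g2 g3" "pos g1 = u" "pos g2 = v" "pos g3 = w"
  have g: "g1 \<in> GG" "- g1 \<in> GG" using * by (auto simp: adj_def G_minus)
  have "act (- g1) u = bb" using * g by auto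
  from assms[OF g(2) this] have "closes (act (- g1) v) (act (- g1) w)" .
  moreover have "adj 0 (- g1 + g2)" "adj (- g1 + g2) (- g1 + g3)"
    using * adj_trans_left[OF g(2), of g1 g2] adj_trans_left[OF g(2), of g2 g3] by auto
  ultimately have "adj 0 (- g1 + g3)"
    unfolding closes_def using * g by (auto simp: act_addG)
  then show "adj g1 g3" using adj_trans_left[OF g(1), of 0 "- g1 + g3"] by simp
qed

lemma tri_act: "k \<in> GG \<Longrightarrow> tri (act k u) (act k v) (act k w) \<Longrightarrow> tri u v w"
  unfolding tri_def
proof (intro allI impI)
  fix g1 g2 g3 assume k: "k \<in> GG" and *: "adj g1 g2" "adj g2 g3" "pos g1 = u" "pos g2 = v" "pos g3 = w"
    and t: "\<forall>g1 g2 g3. adj g1 g2 \<longrightarrow> adj g2 g3 \<longrightarrow> pos g1 = act k u \<longrightarrow> pos g2 = act k v \<longrightarrow> pos g3 = act k w \<longrightarrow> adj g1 g3"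
  from k * t[rule_format, of "k + g1" "k + g2" "k + g3"] show "adj g1 g3"
    by (simp add: adj_shift_iff act_addG)
qed

text \<open>The edge from \<open>u\<close> to \<open>p\<close> is lifted; two triangles carry
  adjacency with that lift along to \<open>v\<close> and \<open>w\<close>, and the third closes
  up.\<close>

lemma tri_cone:
  assumes "pt p" "form u p = 0" "tri p u v" "tri p v w" "tri u p w"
  shows "tri u v w"
  unfolding tri_def
proof (intro allI impI)
  fix g1 g2 g3 assume *: "adj g1 g2" "adj g2 g3" "pos g1 = u" "pos g2 = v" "pos g3 = w"
  obtain h where h: "adj g1 h" "pos h = p"
    using edge_lift[of g1 p] assms * by (auto simp: adj_def)
  have "adj h g2" using assms(3) * h adj_sym unfolding tri_def by blast
  then have "adj h g3" using assms(4) * h unfolding tri_def by blast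
  then show "adj g1 g3" using assms(5) * h unfolding tri_def by blast
qed

lemma lower_part:
  assumes "pt v" "form bb v = 0"
  obtains lo where "supp_below (Suc r) lo" "v = v (2 * r + 2) *s bb + lo"
proof
  have vf: "v (2 * r + 3) = 0" using assms(2) by (simp add: form_base)
  show "supp_below (Suc r) (\<lambda>i. if i < 2 * Suc r then v i else 0)" by (simp add: supp_below_def)
  show "v = v (2 * r + 2) *s bb + (\<lambda>i. if i < 2 * Suc r then v i else 0)"
  proof
    fix i
    consider "i < 2 * r + 2" | "i = 2 * r + 2" | "i = 2 * r + 3" | "2 * r + 4 \<le> i" by linarith
    then show "v i = (v (2 * r + 2) *s bb + (\<lambda>i. if i < 2 * Suc r then v i else 0)) i"
      using vf assms by cases (auto simp: vec_simps pt_def supp_below_def)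
  qed
qed

lemma lower_G: "t \<in> G (Suc r) \<Longrightarrow> t \<in> GG" "t \<in> G (Suc r) \<Longrightarrow> t \<in> QQ" "t \<in> G (Suc r) \<Longrightarrow> act t bb = bb"
proof -
  assume t: "t \<in> G (Suc r)"
  then show "t \<in> GG" by (rule G_mono) simp
  show "t \<in> QQ" using t by (rule Q_lower)
  show "act t bb = bb" by (rule act_fix_bv[OF t]) simp
qed

lemma plane_lift:
  assumes "pt v" "v = x *s bb + d *s bv (2 * r)"
  shows "\<exists>l\<in>G (Suc 0). pos (rho r l) = v"
proof -
  have "prim (pr2 x d)"
    unfolding prim_def
  proof (intro allI impI)
    fix e assume *: "\<forall>i. e dvd pr2 x d i"
    then have "e dvd x" "e dvd d" by (metis pr2_simps)+
    then have "\<forall>i. e dvd v i" by (simp add: assms(2) vec_simps)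
    then show "e dvd 1" using assms(1) by (auto simp: pt_def prim_def)
  qed
  then obtain l where "l \<in> G (Suc 0)" "act l (bv 0) = pr2 x d" using G1_trans by blast
  then show ?thesis using assms(2) by (intro bexI[of _ l]) (simp_all add: act_rho_base)
qed

text \<open>In this plane all vertices lift into the group \<open>rho r\<close>. Quotients of such
  lifts are again in \<open>rho r\<close>, so any two of them are adjacent.\<close>

lemma closes_plane:
  assumes "pt v" "v = x *s bb + d *s bv (2 * r)" "pt w" "w = x' *s bb + d' *s bv (2 * r)"
  shows "closes v w"
  unfolding closes_def
proof (intro allI impI)
  fix g h assume *: "adj 0 g" "adj g h" "pos g = v" "pos h = w"
  obtain l where l: "l \<in> G (Suc 0)" "pos (rho r l) = v" using plane_lift assms by blast
  obtain l' where l': "l' \<in> G (Suc 0)" "pos (rho r l') = w" using plane_lift assms by blast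
  have a: "adj 0 (rho r l)" "adj 0 (rho r l')"
    using adj_rho[OF l(1), of 0] adj_rho[OF l'(1), of 0] by (simp_all add: G_0)
  have "adj (rho r l) (rho r l + rho r (- l + l'))"
    using l l' by (intro adj_rho) (auto intro: G_add G_minus rho_G)
  then have "adj (rho r l) (rho r l')"
    using l l' by (simp add: rho_add rho_minus G_minus)
  moreover have "adj (rho r l) h"
    using adj_replace[of 0 g "rho r l" h] * a l adj_sym by auto
  ultimately show "adj 0 h"
    using adj_replace[of "rho r l" "rho r l'" h 0] * a l' by auto
qed

definition dep :: "(nat \<Rightarrow> 'b poly) \<Rightarrow> (nat \<Rightarrow> 'b poly) \<Rightarrow> (nat \<Rightarrow> 'b poly) \<Rightarrow> bool" where
  "dep u v w \<longleftrightarrow> (\<exists>\<alpha> \<beta> \<gamma>. \<alpha> *s u + \<beta> *s v + \<gamma> *s w = 0 \<and> (\<alpha>, \<beta>, \<gamma>) \<noteq> (0, 0, 0))"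

lemma dep_act: "k \<in> GG \<Longrightarrow> dep u v w \<Longrightarrow> dep (act k u) (act k v) (act k w)"
  unfolding dep_def
proof (elim exE conjE, intro exI conjI)
  fix \<alpha> \<beta> \<gamma> assume k: "k \<in> GG" and *: "\<alpha> *s u + \<beta> *s v + \<gamma> *s w = 0" "(\<alpha>, \<beta>, \<gamma>) \<noteq> (0, 0, 0)"
  show "\<alpha> *s act k u + \<beta> *s act k v + \<gamma> *s act k w = 0"
    using arg_cong[OF *(1), of "act k"] k
    by (simp add: act_vec_add[OF k] act_scale[OF k] act_zero[OF k])
qed

text \<open>Modulo \<open>bb\<close> the other two vectors are dependent, so one element of the
  lower rank group carries both into the plane of \<open>bb\<close> and
  \<open>bv (2 * r)\<close>.\<close>

lemma tri_dep:
  assumes pts: "pt u" "pt v" "pt w" and perp: "form u v = 0" "form u w = 0" and d: "dep u v w"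
  shows "tri u v w"
proof (rule triI)
  fix k assume k: "k \<in> GG" "act k u = bb"
  define v' w' where "v' = act k v" and "w' = act k w"
  have p: "pt v'" "pt w'" "form bb v' = 0" "form bb w' = 0"
    using pts perp k form_act[OF k(1)] unfolding v'_def w'_def k(2)[symmetric] by (auto simp: pt_act)
  obtain lv where lv: "supp_below (Suc r) lv" "v' = v' (2 * r + 2) *s bb + lv" using lower_part p by blast
  obtain lw where lw: "supp_below (Suc r) lw" "w' = w' (2 * r + 2) *s bb + lw" using lower_part p by blast
  define x y where "x = v' (2 * r + 2)" and "y = w' (2 * r + 2)"
  have "dep bb v' w'" using dep_act[OF k(1) d] k by (simp add: v'_def w'_def)
  then obtain \<alpha> \<beta> \<gamma> where dp: "\<alpha> *s bb + \<beta> *s v' + \<gamma> *s w' = 0" "(\<alpha>, \<beta>, \<gamma>) \<noteq> (0, 0, 0)"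
    unfolding dep_def by blast
  have "\<exists>t\<in>G (Suc r). \<exists>c c'. act t lv = c *s bv (2 * r) \<and> act t lw = c' *s bv (2 * r)"
  proof (cases "lv = 0")
    case True
    obtain t c where t: "t \<in> G (Suc r)" "act t lw = c *s bv (2 * r)" using G_gcd[OF lw(1)] by blast
    then show ?thesis using act_zero[OF t(1)] by (intro bexI[of _ t] exI[of _ 0] exI[of _ c]) (auto simp: True)
  next
    case False
    obtain t c where t: "t \<in> G (Suc r)" "act t lv = c *s bv (2 * r)" using G_gcd[OF lv(1)] by blast
    have bl: "\<beta> *s lv + \<gamma> *s lw = 0"
    proof
      fix i
      show "(\<beta> *s lv + \<gamma> *s lw) i = 0 i"
      proof (cases "i < 2 * r + 2")
        case True
        then have "v' i = lv i" "w' i = lw i" using fun_cong[OF lv(2), of i] fun_cong[OF lw(2), of i] by (simp_all add: vec_simps)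
        then show ?thesis using fun_cong[OF dp(1), of i] True by (simp add: vec_simps)
      next
        case False
        then show ?thesis using lv(1) lw(1) by (simp add: supp_below_def vec_simps)
      qed
    qed
    have "\<gamma> \<noteq> 0"
    proof
      assume "\<gamma> = 0"
      then have "\<beta> = 0" using bl False scale_cancel[of \<beta> lv 0] by auto
      then have "\<alpha> = 0" using fun_cong[OF dp(1), of "2 * r + 2"] \<open>\<gamma> = 0\<close> by (simp add: vec_simps)
      then show False using dp(2) \<open>\<gamma> = 0\<close> \<open>\<beta> = 0\<close> by simp
    qed
    have "\<beta> *s c *s bv (2 * r) + \<gamma> *s act t lw = 0"
      using arg_cong[OF bl, of "act t"] by (simp add: act_vec_add[OF t(1)] act_scale[OF t(1)] t(2) act_zero[OF t(1)])
    note lwz = fun_cong[OF this]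
    have "act t lw i = 0" if "i \<noteq> 2 * r" for i
      using lwz[of i] that \<open>\<gamma> \<noteq> 0\<close> by (simp add: vec_simps)
    then have "act t lw = act t lw (2 * r) *s bv (2 * r)" by (intro ext) (simp add: vec_simps)
    then show ?thesis using t by blast
  qed
  then obtain t c c' where t: "t \<in> G (Suc r)" "act t lv = c *s bv (2 * r)" "act t lw = c' *s bv (2 * r)" by blast
  note tG = lower_G[OF t(1)]
  have tv: "act t v' = x *s bb + c *s bv (2 * r)"
    by (subst lv(2)) (simp add: act_vec_add[OF tG(1)] act_scale[OF tG(1)] tG(3) t(2) x_def)
  have tw: "act t w' = y *s bb + c' *s bv (2 * r)"
    by (subst lw(2)) (simp add: act_vec_add[OF tG(1)] act_scale[OF tG(1)] tG(3) t(3) y_def)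
  have "closes (act t v') (act t w')"
    by (rule closes_plane[OF _ tv _ tw]) (use p tG in \<open>auto intro: pt_act\<close>)
  then show "closes v' w'" by (rule closes_Q[OF tG(2)])
qed

text \<open>\<open>G_gcd\<close> is used twice: in rank \<open>r + 1\<close> for \<open>v\<close>,
  then in rank \<open>r\<close> for what is left of \<open>w\<close>, whose coordinate
  \<open>2 * r + 1\<close> orthogonality has removed. Independence makes that remainder nonzero,
  which forces \<open>r\<close> to be a successor.\<close>

lemma perp_normal_form:
  assumes p: "pt v" "pt w" "form bb v = 0" "form bb w = 0" "form v w = 0" and nd: "\<not> dep bb v w"
  obtains s t x d x' y z where "r = Suc s" "t \<in> QQ" "act t bb = bb" "d \<noteq> 0"
    "act t v = x *s bb + d *s bv (2 * r)"
    "act t w = x' *s bb + y *s bv (2 * r) + z *s bv (2 * s)"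
proof -
  obtain lv where lv: "supp_below (Suc r) lv" "v = v (2 * r + 2) *s bb + lv" using lower_part p by blast
  obtain lw where lw: "supp_below (Suc r) lw" "w = w (2 * r + 2) *s bb + lw" using lower_part p by blast
  define x x' where "x = v (2 * r + 2)" and "x' = w (2 * r + 2)"
  have vx: "v = x *s bb + lv" and wx: "w = x' *s bb + lw" using lv lw by (simp_all add: x_def x'_def)
  obtain t d where t: "t \<in> G (Suc r)" "act t lv = d *s bv (2 * r)" using G_gcd[OF lv(1)] by blast
  note tG = lower_G[OF t(1)]
  have d0: "d \<noteq> 0"
  proof
    assume "d = 0"
    then have "lv = 0" using t act_minus_act[OF t(1), of lv] act_zero[OF G_minus[OF t(1)]] by simp
    then have "(- x) *s bb + 1 *s v + 0 *s w = 0" using vx by (simp add: minus_scale)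
    moreover have "(- x, 1 :: 'b poly, 0 :: 'b poly) \<noteq> (0, 0, 0)" by simp
    ultimately show False using nd unfolding dep_def by blast
  qed
  define lo where "lo = act t lw"
  have lo: "supp_below (Suc r) lo" unfolding lo_def by (rule supp_act[OF t(1) _ lw(1)]) simp
  have tv: "act t v = x *s bb + d *s bv (2 * r)"
    unfolding vx by (simp add: act_vec_add[OF tG(1)] act_scale[OF tG(1)] tG(3) t(2))
  have tw: "act t w = x' *s bb + lo"
    unfolding wx by (simp add: act_vec_add[OF tG(1)] act_scale[OF tG(1)] tG(3) lo_def)
  have "form (act t v) (act t w) = 0" using p tG by (simp add: form_act)
  moreover have "lo (2 * r + 3) = 0" using lo by (simp add: supp_below_def)
  ultimately have "d * lo (2 * r + 1) = 0"
    unfolding tv tw by (simp add: om_bv_left vec_simps numeral_3_eq_3)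
  then have lo1: "lo (2 * r + 1) = 0" using d0 by simp
  define y where "y = lo (2 * r)"
  define l2 where "l2 = lo(2 * r := 0)"
  have l2: "supp_below r l2"
    unfolding supp_below_def
  proof (intro allI impI)
    fix i assume "2 * r \<le> i"
    then consider "i = 2 * r" | "i = 2 * r + 1" | "2 * Suc r \<le> i" by fastforce
    then show "l2 i = 0" using lo lo1 by cases (auto simp: l2_def supp_below_def)
  qed
  have loy: "lo = y *s bv (2 * r) + l2" by (auto simp: y_def l2_def fun_eq_iff vec_simps)
  have "l2 \<noteq> 0"
  proof
    assume "l2 = 0"
    then have tw': "act t w = x' *s bb + y *s bv (2 * r)" by (simp add: tw loy)
    have "act t (((y * x - d * x')) *s bb + (- y) *s v + d *s w) = 0"
      unfolding act_vec_add[OF tG(1)] act_scale[OF tG(1)] tG(3) tv tw'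
      by (intro ext) (simp add: vec_simps algebra_simps)
    then have "((y * x - d * x')) *s bb + (- y) *s v + d *s w = 0"
      using act_minus_act[OF tG(1)] act_zero[OF G_minus[OF tG(1)]] by metis
    moreover have "(y * x - d * x', - y, d) \<noteq> (0, 0, 0)" using d0 by simp
    ultimately show False using nd unfolding dep_def by blast
  qed
  then obtain s where s: "r = Suc s" using l2 by (cases r) (auto simp: supp_below_def fun_eq_iff vec_simps)
  obtain t' z where t': "t' \<in> G r" "act t' l2 = z *s bv (2 * s)" using G_gcd[of s l2] l2 s by auto
  have t'1: "t' \<in> G (Suc r)" using t'(1) by (rule G_mono) simp
  note tG' = lower_G[OF t'1]
  have e2: "act t' (bv (2 * r)) = bv (2 * r)" by (rule act_fix_bv[OF t'(1)]) simp
  show ?thesis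
  proof
    show "r = Suc s" by (rule s)
    show "t' + t \<in> QQ" by (intro Q_add tG tG')
    show "act (t' + t) bb = bb" by (simp add: act_addG[OF tG'(1)] tG tG')
    show "d \<noteq> 0" by (rule d0)
    show "act (t' + t) v = x *s bb + d *s bv (2 * r)"
      by (simp add: act_addG[OF tG'(1)] tv act_vec_add[OF tG'(1)] act_scale[OF tG'(1)] tG' e2)
    show "act (t' + t) w = x' *s bb + y *s bv (2 * r) + z *s bv (2 * s)"
      by (simp add: act_addG[OF tG'(1)] tw loy act_vec_add[OF tG'(1)] act_scale[OF tG'(1)] tG' e2 t' add.assoc)
  qed
qed

section \<open>Triangles in the isotropic space of \<open>bb\<close>, \<open>bv (2 * r)\<close> and
  \<open>bv (2 * s)\<close>\<close>

definition sp :: "nat \<Rightarrow> 'b poly \<Rightarrow> 'b poly \<Rightarrow> 'b poly \<Rightarrow> nat \<Rightarrow> 'b poly" where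
  "sp s a b c = a *s bb + b *s bv (2 * r) + c *s bv (2 * s)"

lemma act_X_pr2: "act (X f) (pr2 a b) = pr2 (a + \<pi> f * b) b"
  by (rule ext) (simp add: act_X pr2_def)

lemma sp_rho1: "r = Suc s \<Longrightarrow> l \<in> G (Suc 0) \<Longrightarrow>
    act (rho r l) (sp s a b c) = sp s (act l (pr2 a b) 0) (act l (pr2 a b) (Suc 0)) c"
  unfolding sp_def by (rule ext) (simp add: act_rho rhof_def vec_simps pr2_bv act_zero[of l "Suc 0"])

lemma sp_rho2: "r = Suc s \<Longrightarrow> l \<in> G (Suc 0) \<Longrightarrow>
    act (rho s l) (sp s a b c) = sp s a (act l (pr2 b c) 0) (act l (pr2 b c) (Suc 0))"
  unfolding sp_def by (rule ext) (simp add: act_rho rhof_def vec_simps pr2_bv act_zero[of l "Suc 0"])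

lemma sp_el: "r = Suc s \<Longrightarrow> act (el (Suc (Suc (2 * r))) (2 * s) f) (sp s a b c) = sp s (a + \<pi> f * c) b c"
  unfolding sp_def by (rule ext) (simp add: act_el elf_def sigma_def vec_simps)

lemma sp_kap1: "r = Suc s \<Longrightarrow> u * u' = 1 \<Longrightarrow> act (kap r (D u u')) (sp s a b c) = sp s a (\<pi> u * b) c"
  unfolding sp_def by (rule ext) (simp add: act_kap kapf_def vec_simps act_D)

lemma sp_kap2: "r = Suc s \<Longrightarrow> u * u' = 1 \<Longrightarrow> act (kap s (D u u')) (sp s a b c) = sp s a b (\<pi> u * c)"
  unfolding sp_def by (rule ext) (simp add: act_kap kapf_def vec_simps act_D)

lemma el_QQ: "j < 2 * r + 2 \<Longrightarrow> el (2 * r + 2) j x \<in> QQ"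
proof -
  assume j: "j < 2 * r + 2"
  then have j': "sigma j < 2 * Suc r" using sigma_less[of j "Suc r"] by (simp del: sigma_less)
  have "(- 1) ^ n * ((- 1) ^ n * x) = x" for n
    by (simp add: mult.assoc[symmetric] power_add[symmetric])
  then have "el (2 * r + 2) j x = hs (Suc r) (((- 1) ^ sigma j * x) *s bv (sigma j)) 0"
    using hs_single[OF j', of "(- 1) ^ sigma j * x"] by simp
  also have "\<dots> \<in> QQ" using j' by (intro Q_hs supp_below_scale supp_below_bv)
  finally show ?thesis .
qed

text \<open>The case \<open>p = 0\<close> is linear independence; the other values of
  \<open>p\<close> say that the span is saturated.\<close>

definition sat :: "(nat \<Rightarrow> 'b poly) \<Rightarrow> (nat \<Rightarrow> 'b poly) \<Rightarrow> (nat \<Rightarrow> 'b poly) \<Rightarrow> bool" where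
  "sat u v w \<longleftrightarrow> (\<forall>p \<alpha> \<beta> \<gamma> x. \<alpha> *s u + \<beta> *s v + \<gamma> *s w = p *s x \<longrightarrow> p dvd \<alpha> \<and> p dvd \<beta> \<and> p dvd \<gamma>)"

lemma sat_act: "k \<in> GG \<Longrightarrow> sat u v w \<Longrightarrow> sat (act k u) (act k v) (act k w)"
  unfolding sat_def
proof (intro allI impI)
  fix p \<alpha> \<beta> \<gamma> x assume k: "k \<in> GG"
    and s: "\<forall>p \<alpha> \<beta> \<gamma> x. \<alpha> *s u + \<beta> *s v + \<gamma> *s w = p *s x \<longrightarrow> p dvd \<alpha> \<and> p dvd \<beta> \<and> p dvd \<gamma>"
    and *: "\<alpha> *s act k u + \<beta> *s act k v + \<gamma> *s act k w = p *s x"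
  have mk: "- k \<in> GG" using k by (rule G_minus)
  have "\<alpha> *s u + \<beta> *s v + \<gamma> *s w = p *s act (- k) x"
    using arg_cong[OF *, of "act (- k)"] k
    by (simp add: act_vec_add[OF mk] act_scale[OF mk])
  then show "p dvd \<alpha> \<and> p dvd \<beta> \<and> p dvd \<gamma>" using s by blast
qed

text \<open>The lifts \<open>w1\<close> and \<open>w2 + w1\<close> are built from Weyl elements of
  neighbouring pairs of planes. Their braid relation rewrites \<open>- w1 + (w2 + w1)\<close> as
  \<open>w2 + w1 - w2\<close>, which displays the required edge; \<open>adj_replace\<close> passes
  to arbitrary lifts.\<close>

lemma closes_frame:
  assumes s: "r = Suc s"
  shows "closes (bv (2 * r)) (bv (2 * s))"
  unfolding closes_def
proof (intro allI impI)
  fix g h assume *: "adj 0 g" "adj g h" "pos g = bv (2 * r)" "pos h = bv (2 * s)"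
  define w1 where "w1 = rho r (- W :: (nat \<Rightarrow> 'a) aut)"
  define w2 where "w2 = rho s (- W :: (nat \<Rightarrow> 'a) aut)"
  have mW: "(- W :: (nat \<Rightarrow> 'a) aut) \<in> G (Suc 0)" by (simp add: G_minus)
  have aW: "act (- W) v = v(0 := - v 1, 1 := v 0)" for v
    by (rule ext) (simp add: act_def ap_minus_W red_def)
  have w2: "w2 \<in> G (Suc r)" unfolding w2_def using mW by (rule rho_G) (simp add: s)
  note w2G = lower_G[OF w2]
  have w1: "w1 \<in> GG" unfolding w1_def using mW by (rule rho_G) simp
  have p1: "pos w1 = bv (2 * r)"
    unfolding w1_def using mW by (subst act_rho_base) (simp_all add: aW bv_apply)
  have p2: "pos (w2 + w1) = bv (2 * s)"
  proof -
    have "pos (w2 + w1) = act w2 (bv (2 * r))" by (simp only: act_addG[OF w2G(1)] p1)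
    also have "\<dots> = bv (2 * s)"
      unfolding w2_def using mW by (intro ext) (simp add: act_rho rhof_def aW bv_apply s)
    finally show ?thesis .
  qed
  have a1: "adj 0 w1" using adj_rho[OF mW, of 0] by (simp add: w1_def G_0)
  have a2: "adj 0 (w2 + w1)" by (rule adj_0_Q[OF w2G(2) a1])
  have braid: "w2 + w1 + w2 = w1 + (w2 + w1)"
    unfolding w1_def w2_def
    by (intro aut_eqI ext) (simp add: ap_rho mW rhof_def ap_minus_W s numeral_3_eq_3)
  have "adj w1 (w2 + w1)"
  proof (rule adjI[of w1 w2 "- W" "- w2"])
    show "- w1 + (w2 + w1) = w2 + rho r (- W) + - w2"
    proof -
      have "w2 + w1 = w1 + (w2 + w1) + - w2" unfolding braid[symmetric] by simp
      then have "- w1 + (w2 + w1) = - w1 + (w1 + (w2 + w1) + - w2)" by simp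
      also have "\<dots> = w2 + w1 + - w2" by (simp only: add.assoc minus_add_cancel)
      finally show ?thesis by (simp add: w1_def)
    qed
  qed (use w1 w2G mW in \<open>auto intro: Q_minus\<close>)
  moreover have "adj w1 h"
    using adj_replace[of 0 g w1 h] * a1 p1 adj_sym by auto
  ultimately show "adj 0 h"
    using adj_replace[of w1 "w2 + w1" h 0] a2 p2 * by auto
qed

text \<open>Saturation turns the coefficients \<open>d\<close> and \<open>z\<close> of the normal
  form into units. Diagonal and unipotent elements of \<open>QQ\<close> then carry the triangle to
  the standard frame.\<close>

lemma tri_sat:
  assumes pts: "pt u" "pt v" "pt w" and perp: "form u v = 0" "form u w = 0" "form v w = 0" and st: "sat u v w"
  shows "tri u v w"
proof (rule triI)
  fix k assume k: "k \<in> GG" "act k u = bb"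
  define v' w' where "v' = act k v" and "w' = act k w"
  have p: "pt v'" "pt w'" "form bb v' = 0" "form bb w' = 0" "form v' w' = 0"
    using pts perp k form_act[OF k(1)] unfolding v'_def w'_def k(2)[symmetric] by (auto simp: pt_act)
  have st': "sat bb v' w'" using sat_act[OF k(1) st] k by (simp add: v'_def w'_def)
  have nd: "\<not> dep bb v' w'"
  proof
    assume "dep bb v' w'"
    then obtain \<alpha> \<beta> \<gamma> where "\<alpha> *s bb + \<beta> *s v' + \<gamma> *s w' = 0 *s 0" "(\<alpha>, \<beta>, \<gamma>) \<noteq> (0, 0, 0)"
      unfolding dep_def by (metis scale_0)
    then show False using st' unfolding sat_def by (metis dvd_0_left_iff)
  qed
  obtain s t x d x' y z where n: "r = Suc s" "t \<in> QQ" "act t bb = bb" "d \<noteq> 0"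
    "act t v' = x *s bb + d *s bv (2 * r)"
    "act t w' = x' *s bb + y *s bv (2 * r) + z *s bv (2 * s)"
    using perp_normal_form[OF p nd] by metis
  have st'': "sat bb (act t v') (act t w')" using sat_act[OF Q_G[OF n(2)] st'] n by simp
  \<comment> \<open>A multiple of \<open>d\<close> has coefficient 1 at the second vector, so
    saturation with \<open>p = d\<close> makes \<open>d\<close> a unit; \<open>z\<close> is treated
    in the same way below.\<close>
  have "(- x) *s bb + 1 *s act t v' + 0 *s act t w' = d *s bv (2 * r)"
    by (simp add: n(5) minus_scale)
  then have "d dvd 1" using st'' unfolding sat_def by blast
  then obtain d1 d2 where d: "d1 * d2 = 1" "\<pi> d1 = d" using unit_lift_dvd by blast
  define e where "e = \<pi> d2"
  have de: "d * e = 1" using d by (metis e_def pi_mult pi_1)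
  have "(y * e * x - x') *s bb + (- (y * e)) *s act t v' + 1 *s act t w' = z *s bv (2 * s)"
  proof
    fix i
    have yd: "y * e * d = y" using de by (simp add: mult.assoc mult.commute[of e])
    consider "i = 2 * r" | "i = 2 * r + 2" | "i \<noteq> 2 * r" "i \<noteq> 2 * r + 2" by blast
    then show "((y * e * x - x') *s bb + (- (y * e)) *s act t v' + 1 *s act t w') i = (z *s bv (2 * s)) i"
      unfolding n(5,6) using n(1) by cases (auto simp: vec_simps yd left_diff_distrib)
  qed
  then have "z dvd 1" using st'' unfolding sat_def by blast
  then obtain z1 z2 where z: "z1 * z2 = 1" "\<pi> z1 = z" using unit_lift_dvd by blast
  define u1 where "u1 = rho s (X (sec (- (e * y))))"
  define u2 where "u2 = rho r (X (sec (- x)))"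
  define u3 where "u3 = el (2 * r + 2) (2 * s) (sec (- x'))"
  define K1 where "K1 = kap r (D d2 d1)"
  define K2 where "K2 = kap s (D z2 z1)"
  have dd: "d2 * d1 = 1" and zz: "z2 * z1 = 1" using d z by (simp_all add: mult.commute)
  have pz: "\<pi> z2 * z = 1" using zz z by (metis pi_mult pi_1)
  have ed: "e * d = 1" using de by (simp add: mult.commute)
  have sr: "s + 1 < Suc r" "s < Suc r" "2 * s < 2 * r + 2" using n(1) by simp_all
  have Q: "u1 \<in> QQ" "u2 \<in> QQ" "u3 \<in> QQ" "K1 \<in> QQ" "K2 \<in> QQ"
    unfolding u1_def u2_def u3_def K1_def K2_def
    by (intro lower_G(2)[OF rho_G[OF X_G sr(1)]],
        intro rho_QQ X_G, simp add: act_X bv_apply fun_eq_iff,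
        intro el_QQ sr, intro lower_G(2) kap_G D_G lessI, intro lower_G(2) kap_G D_G sr)
  note QG = Q[THEN Q_G]
  note moves = sp_rho1[OF n(1) X_G] sp_rho2[OF n(1) X_G] sp_el[OF n(1)] sp_kap1[OF n(1) dd] sp_kap2[OF n(1) zz]
  define T where "T = u3 + (u2 + (u1 + (K2 + K1)))"
  have T: "T \<in> QQ" unfolding T_def using Q by (intro Q_add)
  have "act T (act t v') = bv (2 * r)"
  proof -
    have "act t v' = sp s x d 0" by (simp add: n(5) sp_def)
    then show ?thesis
      unfolding T_def using QG
      by (simp add: act_addG) (simp add: u1_def u2_def u3_def K1_def K2_def moves act_X_pr2 ed e_def[symmetric], simp add: sp_def)
  qed
  moreover have "act T (act t w') = bv (2 * s)"
  proof -
    have "act t w' = sp s x' y z" by (simp add: n(6) sp_def)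
    then show ?thesis
      unfolding T_def using QG
      by (simp add: act_addG) (simp add: u1_def u2_def u3_def K1_def K2_def moves act_X_pr2 pz e_def[symmetric], simp add: sp_def)
  qed
  ultimately have "closes (act T (act t v')) (act T (act t w'))"
    using closes_frame[OF n(1)] by simp
  then show "closes v' w'" using closes_Q n(2) T by blast
qed

text \<open>The descent parameter for triangles: in normal form it is \<open>d * z\<close>, which
  vanishes for dependent triples and is a unit for saturated ones.\<close>

definition det3 :: "nat \<Rightarrow> (nat \<Rightarrow> 'b poly) \<Rightarrow> (nat \<Rightarrow> 'b poly) \<Rightarrow> (nat \<Rightarrow> 'b poly) \<Rightarrow> 'b poly" where
  "det3 s u v w = u (2 * r + 2) * (v (2 * r) * w (2 * s) - v (2 * s) * w (2 * r))
     - u (2 * r) * (v (2 * r + 2) * w (2 * s) - v (2 * s) * w (2 * r + 2))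
     + u (2 * s) * (v (2 * r + 2) * w (2 * r) - v (2 * r) * w (2 * r + 2))"

lemma det3_sp: "r = Suc s \<Longrightarrow> det3 s (sp s a b c) (sp s a' b' c') (sp s a'' b'' c'')
   = a * (b' * c'' - c' * b'') - b * (a' * c'' - c' * a'') + c * (a' * b'' - b' * a'')"
  unfolding sp_def det3_def by (simp add: vec_simps)

lemma pt_sp: "r = Suc s \<Longrightarrow> prim (sp s a b c) \<Longrightarrow> pt (sp s a b c)"
  unfolding pt_def supp_below_def sp_def by (simp add: vec_simps)

lemma sp_form: "r = Suc s \<Longrightarrow> form (sp s a b c) (sp s a' b' c') = 0"
  unfolding sp_def by (simp add: om_bv_left vec_simps)

lemma sp_coord: "r = Suc s \<Longrightarrow> sp s a b c (2 * r) = b" "r = Suc s \<Longrightarrow> sp s a b c (2 * s) = c"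
  unfolding sp_def by (simp_all add: vec_simps)

lemma G1_matrix:
  assumes "l \<in> G (Suc 0)"
  obtains p q p' q' where "p * q' - q * p' = 1" "\<And>a b. act l (pr2 a b) 0 = p * a + q * b"
    "\<And>a b. act l (pr2 a b) (Suc 0) = p' * a + q' * b"
proof -
  have "\<exists>p q p' q'. p * q' - q * p' = 1 \<and> (\<forall>a b. act l (pr2 a b) = pr2 (p * a + q * b) (p' * a + q' * b))"
    using assms
  proof (induction rule: G1_induct)
    case zero
    show ?case by (intro exI[of _ 1] exI[of _ 0]) simp
  next
    case (X f g)
    then obtain p q p' q' where *: "p * q' - q * p' = 1"
      "\<And>a b. act g (pr2 a b) = pr2 (p * a + q * b) (p' * a + q' * b)" by blast
    then have "act (X f + g) (pr2 a b) = pr2 ((p + \<pi> f * p') * a + (q + \<pi> f * q') * b) (p' * a + q' * b)" for a b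
      by (simp add: act_add_G1 act_X_pr2 algebra_simps)
    moreover have "(p + \<pi> f * p') * q' - (q + \<pi> f * q') * p' = 1" using *(1) by (simp add: algebra_simps)
    ultimately show ?case by blast
  next
    case (Y f g)
    then obtain p q p' q' where *: "p * q' - q * p' = 1"
      "\<And>a b. act g (pr2 a b) = pr2 (p * a + q * b) (p' * a + q' * b)" by blast
    have "act (Y f) (pr2 a b) = pr2 a (b + \<pi> f * a)" for a b
      by (rule ext) (simp add: act_el elf_Y pr2_def)
    then have "act (Y f + g) (pr2 a b) = pr2 (p * a + q * b) ((p' + \<pi> f * p) * a + (q' + \<pi> f * q) * b)" for a b
      by (simp add: act_add_G1 * algebra_simps)
    moreover have "p * (q' + \<pi> f * q) - q * (p' + \<pi> f * p) = 1" using *(1) by (simp add: algebra_simps)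
    ultimately show ?case by blast
  qed
  then show ?thesis using that by (metis pr2_simps(1,2))
qed

definition sp_map :: "nat \<Rightarrow> (nat \<Rightarrow> 'a) aut \<Rightarrow> bool" where
  "sp_map s k \<longleftrightarrow> k \<in> GG \<and> (\<forall>a b c. \<exists>a' b' c'. act k (sp s a b c) = sp s a' b' c') \<and>
     (\<forall>a b c a' b' c' a'' b'' c''. det3 s (act k (sp s a b c)) (act k (sp s a' b' c')) (act k (sp s a'' b'' c''))
        = det3 s (sp s a b c) (sp s a' b' c') (sp s a'' b'' c''))"

lemma sp_map_add: "sp_map s k \<Longrightarrow> sp_map s k' \<Longrightarrow> sp_map s (k + k')"
  unfolding sp_map_def by (auto simp: G_add act_addG) metis+

lemma sp_map_rho1:
  assumes r: "r = Suc s" and l: "l \<in> G (Suc 0)"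
  shows "sp_map s (rho r l)"
proof -
  obtain p q p' q' where m: "p * q' - q * p' = 1" "\<And>a b. act l (pr2 a b) 0 = p * a + q * b"
    "\<And>a b. act l (pr2 a b) (Suc 0) = p' * a + q' * b" by (rule G1_matrix[OF l]) blast
  have "det3 s (act (rho r l) (sp s a b c)) (act (rho r l) (sp s a' b' c')) (act (rho r l) (sp s a'' b'' c''))
    = (p * q' - q * p') * det3 s (sp s a b c) (sp s a' b' c') (sp s a'' b'' c'')" for a b c a' b' c' a'' b'' c''
    unfolding sp_rho1[OF r l] m(2,3) det3_sp[OF r] by (simp add: algebra_simps)
  then show ?thesis
    using l unfolding sp_map_def m(1) by (auto simp: rho_G sp_rho1[OF r l])
qed

lemma sp_map_rho2:
  assumes r: "r = Suc s" and l: "l \<in> G (Suc 0)"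
  shows "sp_map s (rho s l)"
proof -
  obtain p q p' q' where m: "p * q' - q * p' = 1" "\<And>a b. act l (pr2 a b) 0 = p * a + q * b"
    "\<And>a b. act l (pr2 a b) (Suc 0) = p' * a + q' * b" by (rule G1_matrix[OF l]) blast
  have "det3 s (act (rho s l) (sp s a b c)) (act (rho s l) (sp s a' b' c')) (act (rho s l) (sp s a'' b'' c''))
    = (p * q' - q * p') * det3 s (sp s a b c) (sp s a' b' c') (sp s a'' b'' c'')" for a b c a' b' c' a'' b'' c''
    unfolding sp_rho2[OF r l] m(2,3) det3_sp[OF r] by (simp add: algebra_simps)
  moreover have "rho s l \<in> GG" using l by (rule rho_G) (simp add: r)
  ultimately show ?thesis
    unfolding sp_map_def m(1) by (auto simp: sp_rho2[OF r l])
qed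

text \<open>\<open>rho s\<close> and \<open>rho r\<close> gather the first vector in
  \<open>bb\<close>; a final \<open>rho s\<close>, which fixes \<open>bb\<close>, clears the last
  coordinate of the second vector.\<close>

lemma sp_normal_form:
  assumes r: "r = Suc s" and u: "prim (sp s a b c)"
  obtains k x d where "sp_map s k" "act k (sp s a b c) = bb" "act k (sp s a' b' c') = sp s x d 0"
proof -
  obtain l e where l: "l \<in> G (Suc 0)" "act l (pr2 b c) = pr2 e 0" using G1_gcd by blast
  note m1 = sp_map_rho2[OF r l(1)]
  have u1: "act (rho s l) (sp s a b c) = sp s a e 0" by (simp add: sp_rho2[OF r l(1)] l(2))
  then have "prim (sp s a e 0)" using u m1 prim_act unfolding sp_map_def by metis
  then have "prim (pr2 a e)"
    unfolding prim_def sp_def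
  proof (intro allI impI)
    fix h assume *: "\<forall>d. (\<forall>i. d dvd (a *s bb + e *s bv (2 * r) + 0 *s bv (2 * s)) i) \<longrightarrow> d dvd 1" "\<forall>i. h dvd pr2 a e i"
    then have "h dvd a" "h dvd e" by (metis pr2_simps)+
    then show "h dvd 1" using * by (auto simp: vec_simps)
  qed
  then obtain l2 where l2: "l2 \<in> G (Suc 0)" "act l2 (bv 0) = pr2 a e" using G1_trans by blast
  have ml2: "- l2 \<in> G (Suc 0)" using l2 by (simp add: G_minus)
  have "act (- l2) (pr2 a e) = pr2 1 0"
    using l2 act_minus_act[OF l2(1), of "bv 0"] by (simp add: pr2_bv)
  then have u2: "act (rho r (- l2)) (sp s a e 0) = sp s 1 0 0" by (simp add: sp_rho1[OF r ml2])
  note m2 = sp_map_rho1[OF r ml2]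
  obtain a1 b1 c1 where v1: "act (rho s l) (sp s a' b' c') = sp s a1 b1 c1" using m1 unfolding sp_map_def by blast
  obtain a2 b2 c2 where v2: "act (rho r (- l2)) (sp s a1 b1 c1) = sp s a2 b2 c2" using m2 unfolding sp_map_def by blast
  obtain l3 d where l3: "l3 \<in> G (Suc 0)" "act l3 (pr2 b2 c2) = pr2 d 0" using G1_gcd by blast
  note m3 = sp_map_rho2[OF r l3(1)]
  have G: "rho s l \<in> GG" "rho r (- l2) \<in> GG" "rho s l3 \<in> GG" using m1 m2 m3 by (auto simp: sp_map_def)
  show ?thesis
  proof
    show "sp_map s (rho s l3 + (rho r (- l2) + rho s l))" by (intro sp_map_add m1 m2 m3)
    show "act (rho s l3 + (rho r (- l2) + rho s l)) (sp s a b c) = bb"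
      using G by (simp add: act_addG u1 u2 sp_rho2[OF r l3(1)] pr2_bv act_zero[OF l3(1)] vec_simps) (simp add: sp_def)
    show "act (rho s l3 + (rho r (- l2) + rho s l)) (sp s a' b' c') = sp s a2 d 0"
      using G by (simp add: act_addG v1 v2 sp_rho2[OF r l3(1)] l3(2))
  qed
qed

lemma prim_one: "v i = 1 \<Longrightarrow> prim v"
  unfolding prim_def by metis

text \<open>Descent on the determinant \<open>d * z\<close> of the normalized triple. If
  \<open>d\<close>, or else \<open>z\<close>, is not a unit, there is an apex for which all three
  new determinants are smaller; if both are units, the triple is saturated.\<close>

lemma tri_sp:
  assumes r: "r = Suc s"
    and "prim (sp s a b c)" "prim (sp s a' b' c')" "prim (sp s a'' b'' c'')"
  shows "tri (sp s a b c) (sp s a' b' c') (sp s a'' b'' c'')"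
  using assms(2-)
proof (induction "dg (det3 s (sp s a b c) (sp s a' b' c') (sp s a'' b'' c''))"
    arbitrary: a b c a' b' c' a'' b'' c'' rule: less_induct)
  case less
  obtain k x d where k: "sp_map s k" "act k (sp s a b c) = bb" "act k (sp s a' b' c') = sp s x d 0"
    using sp_normal_form[OF r less.prems(1), of a' b' c'] by blast
  obtain x' y z where k3: "act k (sp s a'' b'' c'') = sp s x' y z" using k(1) unfolding sp_map_def by blast
  have kG: "k \<in> GG" using k(1) by (simp add: sp_map_def)
  have b1: "bb = sp s 1 0 0" by (simp add: sp_def)
  let ?u = "sp s 1 0 0" and ?v = "sp s x d 0" and ?w = "sp s x' y z"
  have det: "det3 s (sp s a b c) (sp s a' b' c') (sp s a'' b'' c'') = d * z"
  proof -
    have "det3 s (sp s a b c) (sp s a' b' c') (sp s a'' b'' c'') = det3 s ?u ?v ?w"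
      using k k3 b1 unfolding sp_map_def by metis
    then show ?thesis by (simp add: det3_sp[OF r])
  qed
  have pr: "prim ?u" "prim ?v" "prim ?w"
    using less.prems prim_act[OF kG] k k3 b1 by metis+
  note pts = pr[THEN pt_sp[OF r]]
  have fm: "form (sp s a b c) (sp s a' b' c') = 0" for a b c a' b' c' by (rule sp_form[OF r])
  have IH: "tri (sp s a1 b1 c1) (sp s a2 b2 c2) (sp s a3 b3 c3)"
    if "dg (det3 s (sp s a1 b1 c1) (sp s a2 b2 c2) (sp s a3 b3 c3)) < dg (d * z)"
      "prim (sp s a1 b1 c1)" "prim (sp s a2 b2 c2)" "prim (sp s a3 b3 c3)" for a1 b1 c1 a2 b2 c2 a3 b3 c3
    using less.hyps that det by simp
  have "tri ?u ?v ?w"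
  proof (cases "d * z = 0")
    case True
    have "dep ?u ?v ?w"
    proof (cases "d = 0")
      case True
      then have "(- x) *s ?u + 1 *s ?v + 0 *s ?w = 0"
        unfolding sp_def by (simp add: minus_scale)
      then show ?thesis unfolding dep_def by (metis prod.inject zero_neq_one)
    next
      case False
      then have "z = 0" using True by simp
      then have "(x * y - d * x') *s ?u + (- y) *s ?v + d *s ?w = 0"
        unfolding sp_def by (intro ext) (simp add: vec_simps algebra_simps)
      then show ?thesis unfolding dep_def using False by (metis prod.inject)
    qed
    then show ?thesis using pts fm by (intro tri_dep)
  next
    case False
    then have dz: "d \<noteq> 0" "z \<noteq> 0" by auto
    show ?thesis
    proof (cases "d dvd 1")
      case False
      then have "dg d \<noteq> 1" "dg d \<noteq> 0" using dg_1_dvd dz by auto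
      then have "1 < dg d" by linarith
      moreover have Sdz: "Suc (dg (d * z)) = dg d + dg z" using dg_mult dz by blast
      ultimately have small: "dg z < dg (d * z)" by linarith
      have small2: "dg ((x mod d) * z) < dg (d * z)"
      proof (cases "x mod d = 0")
        case True
        then show ?thesis using dz by (metis dg_eq_0 mult_eq_0_iff neq0_conv)
      next
        case False
        then have "Suc (dg ((x mod d) * z)) = dg (x mod d) + dg z" using dg_mult dz by blast
        then show ?thesis using dg_mod[OF dz(1), of x] Sdz by linarith
      qed
      \<comment> \<open>The three new determinants are \<open>0\<close>,
        \<open>- ((x mod d) * z)\<close> and \<open>z\<close>.\<close>
      let ?p = "sp s (x div d) 1 0"
      have pp: "prim ?p" by (rule prim_one) (rule sp_coord(1)[OF r])
      have e: "x div d * (d * z) - x * z = - ((x mod d) * z)"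
        by (simp add: minus_div_mult_eq_mod[symmetric] algebra_simps)
      show ?thesis
      proof (rule tri_cone[OF pt_sp[OF r pp] fm])
        show "tri ?p ?u ?v" by (rule IH[OF _ pp pr(1,2)]) (use small in \<open>simp add: det3_sp[OF r]\<close>)
        show "tri ?p ?v ?w" by (rule IH[OF _ pp pr(2,3)]) (use small2 e in \<open>simp add: det3_sp[OF r]\<close>)
        show "tri ?u ?p ?w" by (rule IH[OF _ pr(1) pp pr(3)]) (use small in \<open>simp add: det3_sp[OF r]\<close>)
      qed
    next
      case d1: True
      show ?thesis
      proof (cases "z dvd 1")
        case True
        have "sat ?u ?v ?w"
          unfolding sat_def
        proof (intro allI impI)
          fix p \<alpha> \<beta> \<gamma> q assume "\<alpha> *s ?u + \<beta> *s ?v + \<gamma> *s ?w = p *s q"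
          note * = fun_cong[OF this]
          have 1: "p dvd \<alpha> + \<beta> * x + \<gamma> * x'" using *[of "2 * r + 2"] unfolding sp_def by (simp add: vec_simps r)
          have 2: "p dvd \<beta> * d + \<gamma> * y" using *[of "2 * r"] unfolding sp_def by (simp add: vec_simps r)
          have 3: "p dvd \<gamma> * z" using *[of "2 * s"] unfolding sp_def by (simp add: vec_simps r)
          have g: "p dvd \<gamma>" using 3 True by (metis dvd_mult_unit_iff mult_unit_dvd_iff)
          have "p dvd \<beta> * d" using 2 g by (metis dvd_add_left_iff dvd_mult2)
          then have b: "p dvd \<beta>" using d1 by (metis dvd_mult_unit_iff mult_unit_dvd_iff)
          have "p dvd \<alpha>" using 1 g b by (metis dvd_add_left_iff dvd_mult2)
          then show "p dvd \<alpha> \<and> p dvd \<beta> \<and> p dvd \<gamma>" using g b by blast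
        qed
        then show ?thesis using pts fm by (intro tri_sat)
      next
        case False
        then have "dg z \<noteq> 1" "dg z \<noteq> 0" using dg_1_dvd dz by auto
        then have "1 < dg z" by linarith
        moreover have Sdz: "Suc (dg (d * z)) = dg d + dg z" using dg_mult dz by blast
        moreover have d1': "dg d = 1" using d1 by (rule dvd_1_dg)
        ultimately have small: "dg d < dg (d * z)" by linarith
        have small2: "dg (y mod z) < dg (d * z)" using dg_mod[OF dz(2), of y] Sdz d1' by simp
        \<comment> \<open>The determinant of the apex with \<open>?v\<close> and \<open>?w\<close>
          when the first coordinate of the apex is 0. That coordinate contributes multiples of
          \<open>d * z\<close> and is chosen to leave the remainder.\<close>
        define e where "e = x * y - d * x' - (y div z) * (x * z)"
        have small3: "dg (e mod (d * z)) < dg (d * z)" by (rule dg_mod) (use dz in simp)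
        let ?p = "sp s (- (e div (d * z))) (y div z) 1"
        have pp: "prim ?p" by (rule prim_one) (rule sp_coord(2)[OF r])
        have e1: "- (e div (d * z)) * (d * z) - (y div z) * (x * z) + (x * y - d * x') = e mod (d * z)"
          by (simp only: minus_div_mult_eq_mod[symmetric] e_def) (simp add: algebra_simps)
        have e2: "(y div z) * z - y = - (y mod z)"
          by (simp add: minus_div_mult_eq_mod[symmetric])
        show ?thesis
        proof (rule tri_cone[OF pt_sp[OF r pp] fm])
          show "tri ?p ?u ?v" by (rule IH[OF _ pp pr(1,2)]) (use small in \<open>simp add: det3_sp[OF r]\<close>)
          show "tri ?p ?v ?w"
          proof (rule IH[OF _ pp pr(2,3)])
            have "det3 s ?p ?v ?w = e mod (d * z)" unfolding det3_sp[OF r] e1[symmetric] by simp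
            then show "dg (det3 s ?p ?v ?w) < dg (d * z)" using small3 by simp
          qed
          show "tri ?u ?p ?w"
          proof (rule IH[OF _ pr(1) pp pr(3)])
            have "det3 s ?u ?p ?w = - (y mod z)" unfolding det3_sp[OF r] e2[symmetric] by simp
            then show "dg (det3 s ?u ?p ?w) < dg (d * z)" using small2 by simp
          qed
        qed
      qed
    qed
  qed
  then show ?case using tri_act[OF kG] k k3 b1 by metis
qed

theorem tri_all:
  assumes pts: "pt u" "pt v" "pt w" and perp: "form u v = 0" "form u w = 0" "form v w = 0"
  shows "tri u v w"
proof (cases "dep u v w")
  case True
  then show ?thesis using assms by (intro tri_dep)
next
  case False
  obtain k where "k \<in> GG" "act k bb = u" using G_trans[of "Suc r" u] pts by (auto simp: pt_def)
  then have k: "- k \<in> GG" "act (- k) u = bb" by (auto simp: G_minus)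
  define v' w' where "v' = act (- k) v" and "w' = act (- k) w"
  have p: "pt v'" "pt w'" "form bb v' = 0" "form bb w' = 0" "form v' w' = 0"
    using pts perp k(1) form_act[OF k(1)] unfolding v'_def w'_def k(2)[symmetric] by (auto simp: pt_act)
  have nd: "\<not> dep bb v' w'"
    using dep_act[of k bb v' w'] False \<open>k \<in> GG\<close> \<open>act k bb = u\<close> by (auto simp: v'_def w'_def)
  obtain s t x d x' y z where n: "r = Suc s" "t \<in> QQ" "act t bb = bb" "d \<noteq> 0"
    "act t v' = x *s bb + d *s bv (2 * r)"
    "act t w' = x' *s bb + y *s bv (2 * r) + z *s bv (2 * s)"
    using perp_normal_form[OF p nd] by metis
  have tG: "t \<in> GG" by (rule Q_G[OF n(2)])
  have e: "act t bb = sp s 1 0 0" "act t v' = sp s x d 0" "act t w' = sp s x' y z"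
    using n(3,5,6) by (simp_all add: sp_def)
  have "prim (act t bb)" "prim (act t v')" "prim (act t w')"
    using prim_act[OF tG] p pt_bb by (auto simp: pt_def)
  then have "tri (act t bb) (act t v') (act t w')"
    unfolding e by (rule tri_sp[OF n(1)])
  then have "tri bb v' w'" by (rule tri_act[OF tG])
  then show ?thesis using tri_act[OF k(1), of u v w] k(2) by (simp add: v'_def w'_def)
qed

section \<open>Quadrangles\<close>

lemma adj_tri: "adj g1 g2 \<Longrightarrow> adj g2 g3 \<Longrightarrow> form (pos g1) (pos g3) = 0 \<Longrightarrow> adj g1 g3"
  using tri_all[of "pos g1" "pos g2" "pos g3"] pt_at adj_G adj_perp unfolding tri_def by blast

lemma form_sym0: "form v w = 0 \<Longrightarrow> form w v = 0"
  by (simp add: om_swap_eq_0)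

definition quad :: "(nat \<Rightarrow> 'b poly) \<Rightarrow> (nat \<Rightarrow> 'b poly) \<Rightarrow> (nat \<Rightarrow> 'b poly) \<Rightarrow> (nat \<Rightarrow> 'b poly) \<Rightarrow> bool" where
  "quad a b c d \<longleftrightarrow> (\<forall>ga gb gc gd. adj ga gb \<longrightarrow> adj gb gc \<longrightarrow> adj ga gd \<longrightarrow>
     pos ga = a \<longrightarrow> pos gb = b \<longrightarrow> pos gc = c \<longrightarrow> pos gd = d \<longrightarrow> adj gd gc)"

text \<open>Quadrangles are grouped by the diagonal \<open>a\<close>, \<open>c\<close>: a descent on
  \<open>form a c\<close> needs the statement for all choices of the other two vertices at
  once.\<close>

definition good :: "(nat \<Rightarrow> 'b poly) \<Rightarrow> (nat \<Rightarrow> 'b poly) \<Rightarrow> bool" where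
  "good a c \<longleftrightarrow> (\<forall>b d. form a b = 0 \<longrightarrow> form b c = 0 \<longrightarrow> form a d = 0 \<longrightarrow> form d c = 0 \<longrightarrow> quad a b c d)"

lemma goodD:
  assumes "good a c" "adj ga gb" "adj gb gc" "adj ga gd" "pos ga = a" "pos gc = c" "form (pos gd) c = 0"
  shows "adj gd gc"
proof -
  have "quad a (pos gb) c (pos gd)"
    using assms adj_perp unfolding good_def by metis
  then show ?thesis using assms unfolding quad_def by blast
qed

lemma quad_degenerate:
  assumes "form b d = 0" "form d c = 0"
  shows "quad a b c d"
  unfolding quad_def
proof (intro allI impI)
  fix ga gb gc gd
  assume *: "adj ga gb" "adj gb gc" "adj ga gd" "pos ga = a" "pos gb = b" "pos gc = c" "pos gd = d"
  have "adj gb gd" using * assms adj_sym by (intro adj_tri[of gb ga gd]) auto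
  then show "adj gd gc" using * assms adj_sym by (intro adj_tri[of gd gb gc]) auto
qed

lemma good_perp:
  assumes "form a c = 0"
  shows "good a c"
  unfolding good_def quad_def
proof (intro allI impI)
  fix b d ga gb gc gd
  assume *: "form a b = 0" "form b c = 0" "form a d = 0" "form d c = 0"
    "adj ga gb" "adj gb gc" "adj ga gd" "pos ga = a" "pos gb = b" "pos gc = c" "pos gd = d"
  have "adj ga gc" using * assms by (intro adj_tri[of ga gb gc]) auto
  then show "adj gd gc" using * adj_sym by (intro adj_tri[of gd ga gc]) auto
qed

text \<open>A Heisenberg element moves \<open>a\<close> and \<open>c\<close> into one hyperbolic
  plane. Their common neighbours lie in its complement, where \<open>G (Suc r)\<close> is transitive
  and commutes with the lift \<open>k\<close> of \<open>c\<close>. Thus one edge ending in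
  \<open>k\<close> can be moved to every common neighbour, and \<open>adj_replace\<close> compares
  with the given lifts.\<close>

lemma good_unit:
  assumes pts: "pt a" "pt c" and unit: "form a c dvd 1"
  shows "good a c"
  unfolding good_def quad_def
proof (intro allI impI)
  fix b d ga gb gc gd
  assume perp: "form a b = 0" "form b c = 0" "form a d = 0" "form d c = 0"
    and edges: "adj ga gb" "adj gb gc" "adj ga gd"
    and at: "pos ga = a" "pos gb = b" "pos gc = c" "pos gd = d"
  have ga: "ga \<in> GG" "- ga \<in> GG" using edges by (auto simp: adj_def G_minus)
  define c1 where "c1 = act (- ga) c"
  have bb: "act (- ga) a = bb" using at ga by auto
  have c1: "pt c1" using pts ga by (simp add: c1_def pt_act)
  have "form bb c1 = form a c" unfolding c1_def bb[symmetric] using ga by (simp add: form_act)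
  then have "c1 (2 * r + 3) dvd 1" using unit by (simp add: form_base)
  then obtain u where u: "c1 (2 * r + 3) * u = 1" by (metis dvdE)
  define lo where "lo = (\<lambda>i. if i < 2 * r + 2 then c1 i else 0)"
  \<comment> \<open>The factor 0 from \<open>2 * r + 2\<close> on is needed because
    \<open>sec 0\<close> may be a nonzero kernel element.\<close>
  define w where "w = (\<lambda>i. sec (- (u * lo i)) * (if i < 2 * r + 2 then 1 else 0))"
  have w: "supp_below (Suc r) w" by (simp add: w_def supp_below_def)
  have rw: "red w = (- u) *s lo" by (intro ext) (simp add: w_def red_def lo_def vec_simps)
  \<comment> \<open>The central parameter clears coordinate \<open>2 * r + 2\<close>, including what
    \<open>w\<close> itself adds to it.\<close>
  define z where "z = sec (- (u * (c1 (2 * r + 2) + om (Suc r) (red w) c1)))"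
  define t where "t = hs (Suc r) w z"
  have t: "t \<in> QQ" unfolding t_def using w by (rule Q_hs)
  have tG: "t \<in> GG" using t by (rule Q_G)
  define f where "f = c1 (Suc (Suc (Suc (2 * r))))"
  have uf: "f * u = 1" "u * f = 1" using u by (simp_all add: f_def mult.commute numeral_3_eq_3)
  have c2: "act t c1 = f *s bv (2 * r + 3)"
  proof
    fix i
    have fu: "f * (u * x) = x" for x using uf(1) by (rule unit_cancel)
    consider "i < 2 * r + 2" | "i = 2 * r + 2" | "i = 2 * r + 3" | "2 * r + 4 \<le> i" by linarith
    then show "act t c1 i = (f *s bv (2 * r + 3)) i"
    proof cases
      case 1
      then show ?thesis using w fu[of "c1 i"]
        by (simp add: t_def act_hs hsf_def vec_simps rw lo_def f_def[symmetric] numeral_3_eq_3)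
    next
      case 2
      have "act t c1 i = c1 (2 * r + 2) + om (Suc r) (red w) c1 - f * (u * (c1 (2 * r + 2) + om (Suc r) (red w) c1))"
        using w 2 by (simp add: t_def act_hs hsf_def vec_simps z_def f_def[symmetric] numeral_3_eq_3 red_def w_def)
      then show ?thesis using 2 unfolding fu by (simp add: vec_simps)
    next
      case 3
      then show ?thesis using w by (simp add: t_def act_hs hsf_def vec_simps rw lo_def f_def numeral_3_eq_3)
    next
      case 4
      then show ?thesis using w c1
        by (simp add: t_def act_hs hsf_def vec_simps rw lo_def pt_def supp_below_def)
    qed
  qed
  define T where "T = t + - ga"
  have T: "T \<in> GG" using tG ga by (simp add: T_def G_diff)
  have Ta: "act T a = bb" and Tc: "act T c = f *s bv (2 * r + 3)"
    using tG QQ_fix[OF t] c2 by (simp_all only: T_def act_addG bb c1_def)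
  have Tga: "T + ga = t" by (simp add: T_def add.assoc)
  define hb hc hd where "hb = T + gb" and "hc = T + gc" and "hd = T + gd"
  have h: "adj 0 hb" "adj hb hc" "adj 0 hd"
  proof -
    have "adj t hb" "adj t hd" using adj_trans_left[OF T edges(1)] adj_trans_left[OF T edges(3)] by (simp_all add: Tga hb_def hd_def)
    then show "adj 0 hb" "adj 0 hd" using adj_Q_left[of t _ "- t"] t by (auto simp: Q_minus)
    show "adj hb hc" unfolding hb_def hc_def by (rule adj_trans_left[OF T edges(2)])
  qed
  have hat: "pos hb = act T b" "pos hc = f *s bv (2 * r + 3)" "pos hd = act T d"
    using at Tc T by (simp_all add: hb_def hc_def hd_def act_addG)
  define s where "s = rho r (- W :: (nat \<Rightarrow> 'a) aut)"
  have mW: "(- W :: (nat \<Rightarrow> 'a) aut) \<in> G (Suc 0)" by (simp add: G_minus)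
  have aW: "act (- W) v = v(0 := - v 1, 1 := v 0)" for v
    by (rule ext) (simp add: act_def ap_minus_W red_def)
  have s: "s \<in> GG" unfolding s_def using mW by (rule rho_G) simp
  have s_at: "pos s = bv (2 * r)"
    unfolding s_def using mW by (subst act_rho_base) (simp_all add: aW bv_apply)
  have "prim (pr2 0 f)" unfolding prim_def
  proof (intro allI impI)
    fix e assume "\<forall>i. e dvd pr2 0 f i"
    then have "e dvd pr2 0 f 1" by blast
    then show "e dvd 1" using dvd_trans[of e f 1] dvdI[OF uf(1)[symmetric]] by simp
  qed
  then obtain l where l: "l \<in> G (Suc 0)" "act l (bv 0) = pr2 0 f" using G1_trans by blast
  define k where "k = kap (Suc r) l"
  have k: "k \<in> GG" unfolding k_def using l(1) by (rule kap_G) simp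
  have k_at: "pos k = f *s bv (2 * r + 3)"
    unfolding k_def using l by (intro ext) (simp add: act_kap kapf_def pr2_bv vec_simps numeral_3_eq_3 act_zero[OF l(1)])
  \<comment> \<open>\<open>s\<close> exchanges the planes \<open>r\<close> and \<open>r + 1\<close>,
    hence \<open>kap (Suc r)\<close> and \<open>kap r\<close>; the signs it introduces cancel
    because \<open>l\<close> is linear.\<close>
  have ks: "k + s = s + kap r l"
  proof (rule aut_eqI)
    fix v
    have neg: "ap l (pr2 (- x) (- y)) i = - ap l (pr2 x y) i" for x y i
    proof -
      have "pr2 (- x) (- y) = (- 1) *s pr2 x y" by (rule ext) (simp add: pr2_def vec_simps)
      then have "ap l (pr2 (- x) (- y)) = (- 1) *s ap l (pr2 x y)" by (simp only: G_scale[OF l(1)])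
      then show ?thesis by (simp add: uminus_apply)
    qed
    show "ap (k + s) v = ap (s + kap r l) v"
      unfolding k_def s_def
      by (intro ext) (simp add: ap_rho ap_kap mW l(1) rhof_def kapf_def ap_minus_W numeral_3_eq_3 neg)
  qed
  have sk: "adj s k"
  proof (rule adjI[of s "kap r l" W 0])
    have "k = s + kap r l + - s" unfolding ks[symmetric] by simp
    then have "- s + k = - s + (s + kap r l + - s)" by simp
    also have "\<dots> = kap r l + - s" by (simp only: add.assoc minus_add_cancel)
    finally have *: "- s + k = kap r l + - s" .
    have ms: "- s = rho r W" unfolding s_def by (simp add: rho_minus)
    show "- s + k = kap r l + rho r W + 0" using * by (simp only: ms add_0_right)
  qed (use s l in \<open>auto intro!: lower_G(2) kap_G\<close>)
  have key: "\<exists>h. adj 0 h \<and> pos h = v \<and> adj h k" if v: "pt v" "form bb v = 0" "form v (f *s bv (2 * r + 3)) = 0" for v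
  proof -
    have "f \<noteq> 0" using uf by auto
    have v1: "v (2 * r + 3) = 0" using v(2) by (simp add: form_base)
    have "f * v (2 * r + 2) = 0" using v(3) by (simp add: om_bv_right)
    then have v2: "v (2 * r + 2) = 0" using \<open>f \<noteq> 0\<close> by simp
    have "supp_below (Suc r) v"
      unfolding supp_below_def
    proof (intro allI impI)
      fix i assume "2 * Suc r \<le> i"
      then consider "i = 2 * r + 2" | "i = 2 * r + 3" | "2 * r + 4 \<le> i" by fastforce
      then show "v i = 0" using v1 v2 v(1) by cases (auto simp: pt_def supp_below_def)
    qed
    then obtain g where g: "g \<in> G (Suc r)" "act g (bv (2 * r)) = v" using G_trans v(1) by (auto simp: pt_def)
    note gG = lower_G[OF g(1)]
    have "adj 0 (g + s)" using adj_0_Q[OF gG(2)] adj_rho[OF mW, of 0] by (simp add: s_def G_0)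
    moreover have "pos (g + s) = v" using gG g by (simp add: act_addG s_at)
    moreover have "adj (g + s) k"
    proof -
      have "adj (g + s) (g + k)" by (rule adj_trans_left[OF gG(1) sk])
      then have "adj (g + s) (k + g)" unfolding k_def kap_comm[OF g(1) l(1)] .
      then show ?thesis using adj_Q[of "g + s" "k + g" "- g"] gG by (simp add: Q_minus)
    qed
    ultimately show ?thesis by blast
  qed
  have fr: "pt (act T b)" "pt (act T d)" "form bb (act T b) = 0" "form (act T b) (f *s bv (2 * r + 3)) = 0"
     "form bb (act T d) = 0" "form (act T d) (f *s bv (2 * r + 3)) = 0"
    using perp at edges pt_at adj_G T unfolding Ta[symmetric] Tc[symmetric] by (auto simp: form_act pt_act)
  obtain kb where kb: "adj 0 kb" "pos kb = act T b" "adj kb k" using key fr by blast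
  obtain kd where kd: "adj 0 kd" "pos kd = act T d" "adj kd k" using key fr by blast
  have "adj hb k" using adj_replace[of 0 kb hb k] kb h hat adj_sym by auto
  have "adj hd k" using adj_replace[of 0 kd hd k] kd h hat adj_sym by auto
  then have "adj hd hc" using adj_replace[of hb k hc hd] \<open>adj hb k\<close> h hat k_at by auto
  then show "adj gd gc" unfolding hd_def hc_def using T by (simp add: adj_shift_iff)
qed

lemma supp_scaled: "c \<noteq> 0 \<Longrightarrow> supp_below k (c *s v) \<Longrightarrow> supp_below k v" for c :: "'b poly"
  by (simp add: supp_below_def vec_simps)

lemma pt_factor:
  assumes "v \<noteq> 0" "supp_below (Suc (Suc r)) v"
  obtains q where "pt q" "\<And>x. dg (form x q) \<le> dg (form x v)" "\<And>x. form x v = 0 \<Longrightarrow> form x q = 0"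
proof -
  obtain e q where q: "e \<noteq> 0" "v = e *s q" "prim q" using prim_factor assms(1) by blast
  have "pt q" using q assms(2) supp_scaled by (auto simp: pt_def)
  moreover have "dg (form x q) \<le> dg (form x v)" for x
    using dg_mult_le[OF q(1), of "form x q"] by (simp add: q(2))
  moreover have "form x v = 0 \<Longrightarrow> form x q = 0" for x using q by simp
  ultimately show ?thesis using that by blast
qed

text \<open>A combination of \<open>a\<close> and \<open>b\<close> is made orthogonal to
  \<open>p\<close>. Its pairing with \<open>c\<close> shows that it is nonzero, and its primitive
  part is the required vertex.\<close>

lemma line_point:
  assumes "form a c \<noteq> 0" "form b c = 0" "pt a" "pt b" "form a b = 0"
  shows "\<exists>q. pt q \<and> form p q = 0 \<and> form a q = 0 \<and> form b q = 0"
proof (cases "form p b = 0")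
  case True
  then show ?thesis using assms by (intro exI[of _ b]) auto
next
  case False
  define q where "q = form p b *s a - form p a *s b"
  have "form q c \<noteq> 0" using assms False by (simp add: q_def)
  then have "q \<noteq> 0" by auto
  moreover have "supp_below (Suc (Suc r)) q"
    unfolding q_def using assms by (intro supp_below_diff supp_below_scale) (auto simp: pt_def)
  ultimately obtain u where u: "pt u" "\<And>x. form x q = 0 \<Longrightarrow> form x u = 0" using pt_factor by metis
  have "form p q = 0" "form a q = 0" "form b q = 0"
    using assms form_sym0[OF assms(5)] by (simp_all add: q_def mult.commute)
  then show ?thesis using u by blast
qed

text \<open>Each side carries a vertex orthogonal to the apex \<open>p\<close>. This cuts the
  quadrangle into triangles at the sides and four quadrangles with diagonals from \<open>p\<close>
  to \<open>a\<close>, \<open>b\<close>, \<open>c\<close>, \<open>d\<close>; a lift of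
  \<open>p\<close> is carried around through them.\<close>

lemma quad_cone:
  assumes f: "form a c \<noteq> 0" "form b d \<noteq> 0" and perp: "form a b = 0" "form b c = 0" "form a d = 0" "form d c = 0"
    and p: "pt p" "good a p" "good b p" "good c p" "good d p"
  shows "quad a b c d"
  unfolding quad_def
proof (intro allI impI)
  fix ga gb gc gd
  assume e: "adj ga gb" "adj gb gc" "adj ga gd" and at: "pos ga = a" "pos gb = b" "pos gc = c" "pos gd = d"
  note perp' = perp[THEN form_sym0]
  have f': "form c a \<noteq> 0" "form d b \<noteq> 0" using f by (auto simp: om_swap_eq_0)
  have pts: "pt a" "pt b" "pt c" "pt d" using at e pt_at adj_G by metis+
  obtain p1 where p1: "pt p1" "form p p1 = 0" "form a p1 = 0" "form b p1 = 0"
    using line_point[of a c b] f perp pts by metis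
  obtain p2 where p2: "pt p2" "form p p2 = 0" "form b p2 = 0" "form c p2 = 0"
    using line_point[of b d c] f perp perp' pts by metis
  obtain p3 where p3: "pt p3" "form p p3 = 0" "form c p3 = 0" "form d p3 = 0"
    using line_point[of c a d] f' perp perp' pts by metis
  obtain p4 where p4: "pt p4" "form p p4 = 0" "form d p4 = 0" "form a p4 = 0"
    using line_point[of d b a] f' perp perp' pts by metis
  have G: "ga \<in> GG" "gb \<in> GG" "gc \<in> GG" "gd \<in> GG" using e by (auto simp: adj_def)
  obtain g1 where g1: "adj gb g1" "pos g1 = p1" using edge_lift[of gb p1] G p1 at by auto
  have a1: "adj ga g1" using adj_tri[of ga gb g1] e g1 p1 at by simp
  obtain g2 where g2: "adj gb g2" "pos g2 = p2" using edge_lift[of gb p2] G p2 at by auto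
  have c2: "adj gc g2" using adj_tri[of gc gb g2] e g2 p2 at adj_sym by simp
  obtain g3 where g3: "adj gc g3" "pos g3 = p3" using edge_lift[of gc p3] G p3 at by auto
  obtain g4 where g4: "adj ga g4" "pos g4 = p4" using edge_lift[of ga p4] G p4 at by auto
  have d4: "adj gd g4" using adj_tri[of gd ga g4] e g4 p4 at adj_sym by simp
  obtain h where h: "adj g1 h" "pos h = p" using edge_lift[of g1 p] p p1 g1 adj_G form_sym0 by metis
  have h2: "adj g2 h" using goodD[OF p(3) g1(1) h(1) g2(1)] at h g2 p2 form_sym0 by auto
  have h4: "adj g4 h" using goodD[OF p(2) a1 h(1) g4(1)] at h g4 p4 form_sym0 by auto
  have h3: "adj g3 h" using goodD[OF p(4) c2 h2 g3(1)] at h g3 p3 form_sym0 by auto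
  \<comment> \<open>\<open>g3\<close> was lifted from \<open>gc\<close>, \<open>g3'\<close> from
    \<open>gd\<close>. Adjacency of both to \<open>h\<close> identifies their cosets and closes the
    circuit.\<close>
  obtain g3' where g3': "adj gd g3'" "pos g3' = p3" using edge_lift[of gd p3] G p3 at by auto
  have "adj g3' h" using goodD[OF p(5) d4 h4 g3'(1)] at h g3' p3 form_sym0 by auto
  then have "adj gd g3" using adj_replace[of h g3' g3 gd] h3 g3 g3' adj_sym by auto
  then show "adj gd gc" using adj_tri[of gd g3 gc] g3 at perp adj_sym by simp
qed

lemma form_bv: "j < 2 * Suc (Suc r) \<Longrightarrow> \<exists>i. form v (bv i) = - ((- 1) ^ i * v j) \<and> i < 2 * Suc (Suc r)"
proof -
  assume "j < 2 * Suc (Suc r)"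
  then have j: "sigma j < 2 * Suc (Suc r)" by (simp only: sigma_less)
  show ?thesis using om_bv_sigma[OF j, of v] j by (intro exI[of _ "sigma j"]) (simp only: sigma_sigma)
qed

text \<open>The multipliers \<open>z\<close> with \<open>f'\<close> dividing \<open>f * z\<close>
  form an ideal. A nonzero element of least degree generates it, divides all coordinates of
  \<open>b\<close> and is therefore a unit.\<close>

lemma prim_dvd_cancel:
  assumes b: "prim b" and dv: "\<And>i. f' dvd f * b i"
  shows "f' dvd (f :: 'b poly)"
proof -
  have "b \<noteq> 0" using b by (rule prim_nonzero)
  then obtain j where "b j \<noteq> 0" by (auto simp: fun_eq_iff vec_simps)
  then obtain z where z: "z \<noteq> 0" "f' dvd f * z" and min: "\<And>y. y \<noteq> 0 \<Longrightarrow> f' dvd f * y \<Longrightarrow> dg z \<le> dg y"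
    using arg_min_natI[of "\<lambda>z. z \<noteq> 0 \<and> f' dvd f * z" "b j" dg]
      arg_min_nat_le[of "\<lambda>z. z \<noteq> 0 \<and> f' dvd f * z" _ dg] dv by blast
  have "z dvd b i" for i
  proof -
    have "f * (b i mod z) = f * b i - f * z * (b i div z)"
      by (simp add: minus_div_mult_eq_mod[symmetric] algebra_simps)
    then have "f' dvd f * (b i mod z)" using dv z by (metis dvd_diff dvd_mult2)
    then have "b i mod z = 0" using min dg_mod[OF z(1), of "b i"] by (metis not_le)
    then show ?thesis by (simp add: mod_eq_0_iff_dvd)
  qed
  then have "z dvd 1" using b by (auto simp: prim_def)
  then show ?thesis using z by (metis dvd_mult_unit_iff mult_unit_dvd_iff)
qed

text \<open>Induction on the degree of \<open>form a c\<close>, and inside on that of \<open>form b d\<close>. If the latter degree is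
  larger, a vector orthogonal to \<open>a\<close> and \<open>c\<close> splits the quadrangle; otherwise a basis vector that
  \<open>a\<close> does not pair to \<open>0\<close> modulo \<open>form a c\<close>, reduced against all four vertices, is the apex of a cone.\<close>

lemma good_all: "pt a \<Longrightarrow> pt c \<Longrightarrow> good a c"
proof (induction "dg (form a c)" arbitrary: a c rule: less_induct)
  case less
  note IH = less.hyps and pts = less.prems
  define f where "f = form a c"
  consider "f = 0" | "f \<noteq> 0" "f dvd 1" | "f \<noteq> 0" "\<not> f dvd 1" by blast
  then show ?case
  proof cases
    case 1
    then show ?thesis by (simp add: f_def good_perp)
  next
    case 2
    then show ?thesis using pts by (simp add: f_def good_unit)
  next
    case 3
    have ca: "form c a = - f" unfolding f_def by (rule om_swap)
    have quad: "quad a b c d" if "form a b = 0" "form b c = 0" "form a d = 0" "form d c = 0" "pt b" "pt d" for b d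
      using that
    proof (induction "dg (form b d)" arbitrary: b d rule: less_induct)
      case (less b d)
      note perp = less.prems(1-4) and ptbd = less.prems(5,6)
      note perp' = perp[THEN form_sym0]
      define f' where "f' = form b d"
      have db: "form d b = - f'" unfolding f'_def by (rule om_swap)
      consider "f' = 0" | "f' \<noteq> 0" "dg f' \<le> dg f" | "f' \<noteq> 0" "dg f < dg f'" by linarith
      then show ?case
      proof cases
        case 1
        then show ?thesis using perp by (intro quad_degenerate) (auto simp: f'_def)
      next
        case 2
        obtain j where j: "\<not> f dvd a j"
          using pts(1) 3 unfolding pt_def prim_def by blast
        then have "j < 2 * Suc (Suc r)" using pts(1) unfolding pt_def supp_below_def by (metis dvd_0_right linorder_not_less)
        then obtain i where i: "form a (bv i) = - ((- 1) ^ i * a j)" "i < 2 * Suc (Suc r)" using form_bv by blast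
        define v where "v = (bv i :: nat \<Rightarrow> 'b poly)"
        have fv: "\<not> f dvd form v a"
        proof
          assume "f dvd form v a"
          then have "f dvd (- 1) ^ i * a j" using i om_swap[of _ v a] by (simp add: v_def)
          then have "f dvd (- 1) ^ i * ((- 1) ^ i * a j)" by (rule dvd_mult)
          then show False using j by (simp add: mult.assoc[symmetric] power_add[symmetric])
        qed
        \<comment> \<open>Since \<open>a\<close> and \<open>c\<close> are orthogonal to
          \<open>b\<close> and \<open>d\<close>, corrections by one pair leave the pairings with the
          other intact, so all four pairings become remainders at once.\<close>
        define p where "p = v - (form v c div f) *s a + (form v a div f) *s c - (form v d div f') *s b + (form v b div f') *s d"
        have pa: "form p a = form v a mod f" and pc: "form p c = form v c mod f"
          and pb: "form p b = form v b mod f'" and pd: "form p d = form v d mod f'"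
          using perp perp' by (simp_all add: p_def ca db f_def[symmetric] f'_def[symmetric] minus_div_mult_eq_mod)
        have "form p a \<noteq> 0" using fv pa by (simp add: mod_eq_0_iff_dvd)
        then have "p \<noteq> 0" by auto
        moreover have "supp_below (Suc (Suc r)) p"
          unfolding p_def v_def using pts ptbd i
          by (intro supp_below_add supp_below_diff supp_below_scale supp_below_bv) (auto simp: pt_def)
        ultimately obtain q where ptq: "pt q" and le: "\<And>x. dg (form x q) \<le> dg (form x p)"
          using pt_factor by metis
        have sw: "dg (form x p) = dg (form p x)" for x by (subst om_swap) simp
        have "dg (form a q) < dg f" "dg (form c q) < dg f" "dg (form b q) < dg f" "dg (form d q) < dg f"
          using le[of a] le[of b] le[of c] le[of d] dg_mod[OF 3(1), of "form v a"] dg_mod[OF 3(1), of "form v c"]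
            dg_mod[OF 2(1), of "form v b"] dg_mod[OF 2(1), of "form v d"] 2(2)
          unfolding sw pa pb pc pd by linarith+
        then have "good a q" "good b q" "good c q" "good d q"
          using IH ptq pts ptbd unfolding f_def by blast+
        then show ?thesis using 3(1) 2(1) perp ptq by (intro quad_cone) (auto simp: f_def f'_def)
      next
        case far: 3
        have "\<not> f' dvd f" using far 3(1) dvd_dg_le by (metis not_le)
        then obtain j where j: "\<not> f' dvd f * b j" using prim_dvd_cancel ptbd by (metis pt_def)
        then have "j < 2 * Suc (Suc r)" using ptbd(1) unfolding pt_def supp_below_def by (metis dvd_0_right linorder_not_less mult_zero_right)
        then obtain i where i: "form b (bv i) = - ((- 1) ^ i * b j)" "i < 2 * Suc (Suc r)" using form_bv by blast
        define v where "v = (bv i :: nat \<Rightarrow> 'b poly)"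
        have fv: "\<not> f' dvd f * form v b"
        proof
          assume "f' dvd f * form v b"
          then have "f' dvd f * ((- 1) ^ i * b j)" using i om_swap[of _ v b] by (simp add: v_def)
          then have "f' dvd (- 1) ^ i * (f * ((- 1) ^ i * b j))" by (rule dvd_mult)
          also have "(- 1) ^ i * (f * ((- 1) ^ i * b j)) = ((- 1) ^ i * (- 1) ^ i) * (f * b j)" by (simp only: mult_ac)
          finally show False using j by (simp add: power_add[symmetric])
        qed
        \<comment> \<open>Scaling \<open>v\<close> by \<open>f\<close> lets multiples of
          \<open>a\<close> and \<open>c\<close> cancel the pairings with them exactly; multiples of
          \<open>b\<close> and \<open>d\<close> then reduce the other two modulo
          \<open>f'\<close>.\<close>
        define p where "p = f *s v - form v c *s a + form v a *s c - ((f * form v d) div f') *s b + ((f * form v b) div f') *s d"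
        have pa: "form p a = 0" and pc: "form p c = 0"
          and pb: "form p b = (f * form v b) mod f'" and pd: "form p d = (f * form v d) mod f'"
          using perp perp' by (simp_all add: p_def ca db f_def[symmetric] f'_def[symmetric] minus_mult_div_eq_mod minus_div_mult_eq_mod mult.commute)
        have "form p b \<noteq> 0" using fv pb by (simp add: mod_eq_0_iff_dvd)
        then have "p \<noteq> 0" by auto
        moreover have "supp_below (Suc (Suc r)) p"
          unfolding p_def v_def using pts ptbd i
          by (intro supp_below_add supp_below_diff supp_below_scale supp_below_bv) (auto simp: pt_def)
        ultimately obtain q where ptq: "pt q" and le: "\<And>x. dg (form x q) \<le> dg (form x p)"
          and z: "\<And>x. form x p = 0 \<Longrightarrow> form x q = 0"
          using pt_factor by metis
        have sw: "dg (form x p) = dg (form p x)" "dg (form q x) = dg (form x q)" for x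
          by (subst om_swap, simp)+
        have qa': "form a q = 0" "form c q = 0" using pa pc z form_sym0 by blast+
        note qa = qa'[THEN form_sym0]
        have small: "dg (form b q) < dg f'" "dg (form q d) < dg f'"
          using le[of b] le[of d] dg_mod[OF far(1), of "f * form v b"] dg_mod[OF far(1), of "f * form v d"]
          unfolding sw pb pd by linarith+
        \<comment> \<open>\<open>q\<close> is a further common neighbour of \<open>a\<close> and
          \<open>c\<close>. It splits the quadrangle into two with the same diagonal and smaller
          inner measure.\<close>
        have q1: "quad a b c q" using less.hyps[of b q] small perp qa qa' ptbd ptq by (simp add: f'_def)
        have q2: "quad a q c d" using less.hyps[of q d] small perp qa qa' ptbd ptq by (simp add: f'_def)
        show ?thesis
          unfolding quad_def
        proof (intro allI impI)
          fix ga gb gc gd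
          assume e: "adj ga gb" "adj gb gc" "adj ga gd" and at: "pos ga = a" "pos gb = b" "pos gc = c" "pos gd = d"
          obtain h where h: "adj ga h" "pos h = q"
            using edge_lift[of ga q] e at ptq qa' by (auto simp: adj_def)
          have "adj h gc" using q1 e at h unfolding quad_def by blast
          then show "adj gd gc" using q2 e at h unfolding quad_def by blast
        qed
      qed
    qed
    show ?thesis
      unfolding good_def
    proof (intro allI impI)
      fix b d assume *: "form a b = 0" "form b c = 0" "form a d = 0" "form d c = 0"
      show "quad a b c d"
      proof (cases "pt b \<and> pt d")
        case True
        then show ?thesis using quad * by blast
      next
        case False
        then show ?thesis unfolding quad_def using pt_at adj_G by blast
      qed
    qed
  qed
qed

lemma adj_quad:
  assumes "adj g1 g2" "adj g2 g3" "adj g3 g4" "form (pos g1) (pos g4) = 0"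
  shows "adj g1 g4"
proof (rule goodD[of "pos g2" "pos g4" g2 g3 g4 g1])
  show "good (pos g2) (pos g4)" using good_all assms pt_at adj_G by blast
qed (use assms adj_sym in auto)

section \<open>Lifting paths\<close>

text \<open>Any two primitive vectors have a common neighbour, so \<open>S\<close> meets every fibre, and \<open>S_unique\<close> says
  that it meets it once.\<close>

definition S :: "(nat \<Rightarrow> 'a) aut set" where
  "S = {g. \<exists>w. adj 0 w \<and> adj w g}"

text \<open>A vertex adjacent to \<open>0\<close>, \<open>g\<close> and \<open>h\<close> is sought
  on the line through \<open>pos g\<close> and \<open>pos h\<close>. The construction breaks down
  when \<open>q = 0\<close>; then \<open>pos h\<close> is proportional to \<open>pos g\<close>, and
  \<open>w\<close> is already adjacent to \<open>h\<close>.\<close>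

lemma S_adj:
  assumes "g \<in> S" "adj g h"
  shows "h \<in> S"
proof -
  obtain w where w: "adj 0 w" "adj w g" using assms by (auto simp: S_def)
  have G: "g \<in> GG" "h \<in> GG" using assms by (auto simp: adj_def)
  have pts: "pt (pos g)" "pt (pos h)" using G pt_at by auto
  have gh: "form (pos g) (pos h) = 0" using assms adj_perp by blast
  define q where "q = form bb (pos h) *s pos g - form bb (pos g) *s pos h"
  have "(\<exists>u. pt u \<and> form bb u = 0 \<and> form (pos g) u = 0 \<and> form (pos h) u = 0) \<or> adj w h"
  proof (cases "form bb (pos g) = 0 \<or> q \<noteq> 0")
    case True
    then show ?thesis
    proof
      assume "form bb (pos g) = 0"
      then show ?thesis using pts gh form_sym0 by (intro disjI1 exI[of _ "pos g"]) auto
    next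
      assume "q \<noteq> 0"
      moreover have "supp_below (Suc (Suc r)) q"
        unfolding q_def using pts by (intro supp_below_diff supp_below_scale) (auto simp: pt_def)
      ultimately obtain u where u: "pt u" "\<And>x. form x q = 0 \<Longrightarrow> form x u = 0" using pt_factor by metis
      have "form bb q = 0" "form (pos g) q = 0" "form (pos h) q = 0"
        using gh form_sym0[OF gh] by (simp_all add: q_def mult.commute)
      then show ?thesis using u by blast
    qed
  next
    case False
    have "form (pos w) q = 0" using False by simp
    moreover have "form (pos w) (pos g) = 0" using w adj_perp by blast
    ultimately have "form (pos w) (pos h) = 0" using False by (simp add: q_def)
    then show ?thesis using adj_tri[OF w(2) assms(2)] by blast
  qed
  then show ?thesis
  proof
    assume "adj w h"
    then show ?thesis using w by (auto simp: S_def)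
  next
    assume "\<exists>u. pt u \<and> form bb u = 0 \<and> form (pos g) u = 0 \<and> form (pos h) u = 0"
    then obtain u where u: "pt u" "form bb u = 0" "form (pos g) u = 0" "form (pos h) u = 0" by blast
    obtain k where k: "adj g k" "pos k = u" using edge_lift[OF G(1) u(1,3)] by blast
    have "adj h k" using adj_tri[of h g k] assms k u adj_sym by blast
    moreover have "adj 0 k" using adj_quad[OF w k(1)] k u by simp
    ultimately show ?thesis using adj_sym by (auto simp: S_def)
  qed
qed

text \<open>The two paths from \<open>0\<close> form a quadrangle, so \<open>adj_quad\<close> makes
  \<open>g\<close> a neighbour of \<open>w'\<close>; edges lifted from \<open>w'\<close> are
  unique.\<close>

lemma S_unique:
  assumes "g \<in> S" "h \<in> S" "pos g = pos h"
  shows "- g + h \<in> QQ"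
proof -
  obtain w where w: "adj 0 w" "adj w g" using assms by (auto simp: S_def)
  obtain w' where w': "adj 0 w'" "adj w' h" using assms by (auto simp: S_def)
  have "form (pos g) (pos w') = 0" using adj_perp[OF w'(2)] assms(3) form_sym0 by simp
  then have "adj g w'" using w w' adj_sym adj_quad[of g w 0 w'] by blast
  then show ?thesis using edge_unique[OF _ w'(2)] assms(3) adj_sym by blast
qed

text \<open>Right multiplication by elements of \<open>QQ\<close> and \<open>rho r\<close> follows
  edges, so it preserves \<open>S\<close>; it remains to generate \<open>GG\<close> by these
  two.\<close>

definition moves :: "(nat \<Rightarrow> 'a) aut set" where
  "moves = {g \<in> GG. \<forall>p\<in>S. p + g \<in> S}"

lemma S_GG: "g \<in> S \<Longrightarrow> g \<in> GG"
  by (auto simp: S_def adj_def)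

lemma moves_add: "g \<in> moves \<Longrightarrow> h \<in> moves \<Longrightarrow> g + h \<in> moves"
  by (auto simp: moves_def G_add add.assoc[symmetric])

lemma moves_QQ: "q \<in> QQ \<Longrightarrow> q \<in> moves"
  using S_adj[OF _ adj_QQ] S_GG by (auto simp: moves_def Q_G)

lemma moves_rho: "l \<in> G (Suc 0) \<Longrightarrow> rho r l \<in> moves"
  using S_adj[OF _ adj_rho] S_GG by (auto simp: moves_def rho_G)

lemma el_swap: "i \<noteq> sigma j \<Longrightarrow> el i j x = el (sigma j) (sigma i) (- ((- 1) ^ (i + j) * x))"
proof (cases "i = j")
  case False
  assume i: "i \<noteq> sigma j"
  have e: "(- 1) ^ sigma k = - ((- 1) ^ k :: 'c::comm_ring_1)" for k
    by (cases "even k") (auto simp: sigma_def)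
  have s: "(- 1) ^ k * ((- 1) ^ k * y) = y" for k and y :: "'c::comm_ring_1"
    by (simp add: mult.assoc[symmetric] power_add[symmetric])
  show ?thesis
    by (rule aut_eqI, rule ext) (use i False in \<open>auto simp: elf_def sigma_eq_swap vec_simps power_add e s mult_ac\<close>)
qed simp

text \<open>Row \<open>2 * r + 2\<close> lies in \<open>QQ\<close>, and Weyl elements of
  \<open>rho r\<close> and \<open>kap r\<close> reduce column \<open>2 * r + 2\<close> to
  \<open>QQ\<close> or \<open>rho r\<close>. \<open>el_swap\<close> transfers both to the index
  \<open>2 * r + 3\<close>; the other generators have lower rank.\<close>

lemma moves_el:
  assumes "i < 2 * Suc (Suc r)" "j < 2 * Suc (Suc r)" "i \<noteq> j"
  shows "el i j x \<in> moves"
proof -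
  have row: "el (2 * r + 2) j x \<in> moves" if "j < 2 * r + 4" "j \<noteq> 2 * r + 2" for j and x :: 'a
  proof (cases "j < 2 * r + 2")
    case True
    then show ?thesis by (intro moves_QQ el_QQ)
  next
    case False
    then have "j = 2 * Suc r + 1" using that by simp
    then show ?thesis using Q_hs[OF supp_below_0, of "Suc r" x] by (intro moves_QQ) (simp add: hs_centre)
  qed
  have mW: "(- W :: (nat \<Rightarrow> 'a) aut) \<in> G (Suc 0)" by (simp add: G_minus)
  have col: "el i (2 * r + 2) x \<in> moves" if i: "i < 2 * r + 4" "i \<noteq> 2 * r + 2" for i and x :: 'a
  proof -
    consider "i < 2 * r" | "i = 2 * r" | "i = 2 * r + 1" | "i = 2 * r + 3" using i by linarith
    then show ?thesis
    proof cases
      case 1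
      have "el i (2 * r + 2) x = rho r W + el i (2 * r) x + rho r (- W)"
      proof (rule aut_eqI)
        fix v
        have n: "i \<noteq> k" "sigma i \<noteq> k" if "2 * r \<le> k" for k using 1 sigma_less[of i r] that by (auto simp del: sigma_less)
        have s0: "sigma (2 * r) = Suc (2 * r)" and s2: "sigma (Suc (Suc (2 * r))) = Suc (Suc (Suc (2 * r)))"
          by (auto simp: sigma_def)
        show "ap (el i (2 * r + 2) x) v = ap (rho r W + el i (2 * r) x + rho r (- W)) v"
          using 1 n n[THEN not_sym] by (intro ext) (auto simp: ap_rho mW rhof_def elf_def s0 s2 ap_W ap_minus_W vec_simps numeral_3_eq_3)
      qed
      moreover have "el i (2 * r) x \<in> QQ" using 1 by (intro lower_G(2) G_el) auto
      ultimately show ?thesis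
        using moves_add[OF moves_add[OF moves_rho[OF W_G] moves_QQ] moves_rho[OF mW]] by simp
    next
      case 2
      then show ?thesis using moves_rho[of "Y x"] by (simp add: rho_Y)
    next
      case 3
      have "el i (2 * r + 2) x = kap r (- W) + el (2 * r) (2 * r + 2) x + kap r W"
        unfolding 3 by (intro aut_eqI ext) (auto simp: ap_kap mW kapf_def elf_def sigma_def ap_W ap_minus_W vec_simps)
      moreover have "kap r (- W) \<in> QQ" "kap r W \<in> QQ" using mW by (auto intro!: lower_G(2) kap_G)
      ultimately show ?thesis
        using moves_add[OF moves_add[OF moves_QQ moves_rho[OF Y_G]] moves_QQ] by (simp add: rho_Y)
    next
      case 4
      have "el i (2 * r + 2) x = rho r (- W) + el (2 * r + 1) (2 * r) x + rho r W"
        unfolding 4 by (intro aut_eqI ext) (auto simp: ap_rho mW rhof_def elf_def sigma_def ap_W ap_minus_W vec_simps numeral_3_eq_3)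
      moreover have "el (2 * r + 1) (2 * r) x \<in> QQ" by (intro lower_G(2) G_el) auto
      ultimately show ?thesis
        using moves_add[OF moves_add[OF moves_rho[OF mW] moves_QQ] moves_rho[OF W_G]] by simp
    qed
  qed
  have sg: "sigma (2 * r + 3) = 2 * r + 2" "sigma (2 * r + 2) = 2 * r + 3" by (auto simp: sigma_def)
  have lt: "sigma k < 2 * r + 4" if "k < 2 * r + 4" for k
    using sigma_less[of k "Suc (Suc r)"] that by (simp del: sigma_less)
  consider "i = 2 * r + 2" | "j = 2 * r + 2" | "i = 2 * r + 3" "j \<noteq> 2 * r + 2" | "j = 2 * r + 3" "i \<noteq> 2 * r + 2"
    | "i < 2 * r + 2" "j < 2 * r + 2" using assms by fastforce
  then show ?thesis
  proof cases
    case 1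
    then show ?thesis using row assms by simp
  next
    case 2
    then show ?thesis using col assms by simp
  next
    case 3
    then have "i \<noteq> sigma j" using sg by (metis sigma_sigma)
    moreover have "sigma j \<noteq> 2 * r + 2" using sg 3 assms by (metis sigma_sigma)
    ultimately show ?thesis
      using col[of "sigma j"] lt[of j] assms 3 sg by (subst el_swap) auto
  next
    case 4
    then have "i \<noteq> sigma j" using sg by simp
    moreover have "sigma i \<noteq> 2 * r + 2" using sg 4 assms by (metis sigma_sigma)
    ultimately show ?thesis
      using row[of "sigma i"] lt[of i] assms 4 sg by (subst el_swap) auto
  next
    case 5
    then show ?thesis using assms by (intro moves_QQ lower_G(2) G_el) auto
  qed
qed

lemma GG_moves: "g \<in> GG \<Longrightarrow> g \<in> moves"
proof (induction rule: G.induct)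
  case G_0
  show ?case by (rule moves_QQ[OF Q_0])
next
  case (G_step i j g x)
  then show ?case by (intro moves_add moves_el)
qed

text \<open>\<open>S\<close> contains \<open>0\<close> and is stable under right multiplication, so
  it contains \<open>g\<close>, and \<open>S_unique\<close> compares \<open>g\<close> with
  \<open>0\<close>.\<close>

theorem stab_step: "g \<in> GG \<Longrightarrow> pos g = bb \<Longrightarrow> g \<in> QQ"
proof -
  assume g: "g \<in> GG" "pos g = bb"
  have 0: "0 \<in> S" using adj_refl[of 0] by (auto simp: S_def G_0)
  then have "0 + g \<in> S" using GG_moves[OF g(1)] unfolding moves_def by blast
  then show ?thesis using S_unique[OF 0, of g] g by simp
qed

end

context reduction begin

lemma stab_base: "g \<in> G (Suc 0) \<Longrightarrow> act g (bv 0) = bv 0 \<Longrightarrow> g \<in> Q 0"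
proof -
  assume "g \<in> G (Suc 0)" "act g (bv 0) = bv 0"
  then obtain f \<epsilon> where "\<epsilon> \<in> E (Suc 0)" "g = X f + \<epsilon>" using stab_G1 by blast
  then show ?thesis using Q_I[of 0 0 0 \<epsilon> f] by (simp add: G_0 hs_centre)
qed

lemma stabilizer: "g \<in> G (Suc r) \<Longrightarrow> act g (bv (2 * r)) = bv (2 * r) \<Longrightarrow> g \<in> Q r"
proof (induction r arbitrary: g)
  case 0
  then show ?case by (simp add: stab_base)
next
  case (Suc r)
  interpret rank_step \<pi> r by unfold_locales (rule Suc.IH)
  show ?case using stab_step[of g] Suc.prems by simp
qed

text \<open>For an element of \<open>Q\<close> the Heisenberg parameters modulo the kernel can be
  read off one vector. Once they vanish, the Levi factor acts trivially too and falls under the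
  induction hypothesis.\<close>

theorem act_trivial_imp_E: "g \<in> G k \<Longrightarrow> (\<And>w. act g w = w) \<Longrightarrow> g \<in> E k"
proof (induction k arbitrary: g)
  case 0
  have "g = 0" using 0(1) by (induction rule: G.induct) auto
  then show ?case by (simp add: E_0)
next
  case (Suc r)
  obtain w c h \<epsilon> where w: "supp_below r w" and h: "h \<in> G r" and \<epsilon>: "\<epsilon> \<in> E (Suc r)" and g: "g = hs r w c + h + \<epsilon>"
    using stabilizer[OF Suc.prems(1)] Suc.prems(2) by (blast elim: Q_E)
  have hG: "h \<in> G (Suc r)" using h by (rule G_mono) simp
  have e: "hsf r (red w) (\<pi> c) (act h v) = v" for v
    using Suc.prems(2)[of v] hs_G[OF w] hG w act_E[OF \<epsilon>] by (simp add: g add.assoc act_add[of _ "Suc r"] act_hs)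
  have f: "act h (bv (2 * r + 1)) = bv (2 * r + 1)" by (rule act_fix_bv[OF h]) simp
  \<comment> \<open>This sum is what the element adds to \<open>bv (2 * r + 1)\<close>.\<close>
  have ef: "red w + \<pi> c *s bv (2 * r) = 0"
    using e[of "bv (2 * r + 1)"] unfolding f by (simp add: hsf_def om_bv_high) (simp add: fun_eq_iff vec_simps)
  have w0: "\<pi> (w i) = 0" for i
    using fun_cong[OF ef, of i] w by (cases "i < 2 * r") (auto simp: vec_simps red_apply supp_below_def)
  then have rw: "red w = 0" by (intro ext) (simp add: red_apply vec_simps)
  have c0: "\<pi> c = 0" using fun_cong[OF ef, of "2 * r"] by (simp add: vec_simps rw)
  have "act h v = v" for v using e[of v] by (simp add: rw c0)
  then have "h \<in> E r" using Suc.IH h by blast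
  then have "h \<in> E (Suc r)" by (rule E_mono) simp
  then show ?case using hs_E[OF w w0 c0] \<epsilon> by (simp add: g E_add)
qed

end

section \<open>The residue field\<close>

lemma ideal_class_ring_iff:
  "ideal I (class_ring :: 'a::comm_ring_1 ring) \<longleftrightarrow>
     0 \<in> I \<and> (\<forall>x\<in>I. \<forall>y\<in>I. x + y \<in> I) \<and> (\<forall>x\<in>I. \<forall>a. a * x \<in> I)"
proof
  assume I: "ideal I (class_ring :: 'a ring)"
  then interpret ideal I "class_ring :: 'a ring" .
  show "0 \<in> I \<and> (\<forall>x\<in>I. \<forall>y\<in>I. x + y \<in> I) \<and> (\<forall>x\<in>I. \<forall>a. a * x \<in> I)"
    using zero_closed a_closed I_l_closed by simp
next
  assume *: "0 \<in> I \<and> (\<forall>x\<in>I. \<forall>y\<in>I. x + y \<in> I) \<and> (\<forall>x\<in>I. \<forall>a. a * x \<in> I)"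
  have ring: "ring (class_ring :: 'a ring)" by (rule class_ring.ring_axioms)
  have neg: "- x \<in> I" if "x \<in> I" for x
    using * that by (metis mult_minus1)
  show "ideal I (class_ring :: 'a ring)"
  proof (rule idealI[OF ring])
    have grp: "group (add_monoid (class_ring :: 'a ring))"
      by (rule abelian_group.a_group[OF ring.is_abelian_group[OF ring]])
    show "subgroup I (add_monoid (class_ring :: 'a ring))"
    proof (rule group.subgroupI[OF grp])
      fix a assume a: "a \<in> I"
      have "inv\<^bsub>add_monoid (class_ring :: 'a ring)\<^esub> a = - a"
        by (rule group.inv_equality[OF grp]) simp_all
      then show "inv\<^bsub>add_monoid (class_ring :: 'a ring)\<^esub> a \<in> I" using neg[OF a] by simp
    qed (use * in auto)
  qed (use * in \<open>auto simp: mult.commute\<close>)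
qed

lemma maximalideal_exists:
  assumes I: "ideal I (class_ring :: 'a::comm_ring_1 ring)" "1 \<notin> I"
  shows "\<exists>M. maximalideal M (class_ring :: 'a ring) \<and> I \<subseteq> M"
proof -
  define F where "F = {J. ideal J (class_ring :: 'a ring) \<and> I \<subseteq> J \<and> 1 \<notin> J}"
  have "\<exists>M\<in>F. \<forall>X\<in>F. M \<subseteq> X \<longrightarrow> X = M"
  proof (rule subset_Zorn_nonempty)
    show "F \<noteq> {}" using I by (auto simp: F_def)
    fix C assume C: "C \<noteq> {}" "subset.chain F C"
    then have sub: "C \<subseteq> F" and tot: "\<And>X Y. X \<in> C \<Longrightarrow> Y \<in> C \<Longrightarrow> X \<subseteq> Y \<or> Y \<subseteq> X"
      by (auto simp: subset_chain_def)
    have "ideal (\<Union>C) (class_ring :: 'a ring)"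
      unfolding ideal_class_ring_iff
    proof (intro conjI ballI allI)
      show "0 \<in> \<Union>C" using C(1) sub by (auto simp: F_def ideal_class_ring_iff)
      fix x assume "x \<in> \<Union>C"
      then obtain X where X: "X \<in> C" "x \<in> X" by blast
      then have XI: "ideal X (class_ring :: 'a ring)" using sub by (auto simp: F_def)
      show "a * x \<in> \<Union>C" for a using X XI unfolding ideal_class_ring_iff by blast
      fix y assume "y \<in> \<Union>C"
      then obtain Y where Y: "Y \<in> C" "y \<in> Y" by blast
      then have YI: "ideal Y (class_ring :: 'a ring)" using sub by (auto simp: F_def)
      show "x + y \<in> \<Union>C" using tot[OF X(1) Y(1)] X Y XI YI unfolding ideal_class_ring_iff by blast
    qed
    then show "\<Union>C \<in> F" using C(1) sub by (auto simp: F_def)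
  qed
  then obtain M where M: "M \<in> F" "\<And>X. X \<in> F \<Longrightarrow> M \<subseteq> X \<Longrightarrow> X = M" by blast
  have "maximalideal M (class_ring :: 'a ring)"
  proof (rule maximalidealI)
    show "ideal M (class_ring :: 'a ring)" using M by (simp add: F_def)
    show "carrier (class_ring :: 'a ring) \<noteq> M" using M by (auto simp: F_def)
    fix J assume J: "ideal J (class_ring :: 'a ring)" "M \<subseteq> J"
    show "J = M \<or> J = carrier (class_ring :: 'a ring)"
    proof (cases "1 \<in> J")
      case True
      then have "J = UNIV" using J(1) unfolding ideal_class_ring_iff by (metis UNIV_eq_I mult.right_neutral)
      then show ?thesis by simp
    next
      case False
      then show ?thesis using M J by (auto simp: F_def)
    qed
  qed
  then show ?thesis using M by (auto simp: F_def)
qed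

text \<open>Choosing a maximal ideal in every ring makes the residue field a type constructor; over a local
  ring there is no choice.\<close>

definition max_ideal :: "'a::comm_ring_1 set" where
  "max_ideal = (SOME M. maximalideal M (class_ring :: 'a ring))"

lemma maximalideal_max_ideal: "maximalideal max_ideal (class_ring :: 'a::comm_ring_1 ring)"
proof -
  have "ideal {0 :: 'a} class_ring" by (simp add: ideal_class_ring_iff)
  from maximalideal_exists[OF this] have "\<exists>M. maximalideal M (class_ring :: 'a ring)" by auto
  then show ?thesis unfolding max_ideal_def by (rule someI_ex)
qed

lemma max_ideal_closed:
  "(0 :: 'a::comm_ring_1) \<in> max_ideal"
  "x \<in> max_ideal \<Longrightarrow> y \<in> max_ideal \<Longrightarrow> x + y \<in> (max_ideal :: 'a set)"
  "x \<in> max_ideal \<Longrightarrow> a * x \<in> (max_ideal :: 'a set)"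
proof -
  have "ideal (max_ideal :: 'a set) class_ring"
    by (rule maximalideal.axioms(1)[OF maximalideal_max_ideal])
  then show "(0 :: 'a) \<in> max_ideal"
    "x \<in> max_ideal \<Longrightarrow> y \<in> max_ideal \<Longrightarrow> x + y \<in> (max_ideal :: 'a set)"
    "x \<in> max_ideal \<Longrightarrow> a * x \<in> (max_ideal :: 'a set)"
    unfolding ideal_class_ring_iff by auto
qed

lemma max_ideal_minus: "x \<in> max_ideal \<Longrightarrow> - x \<in> (max_ideal :: 'a::comm_ring_1 set)"
  using max_ideal_closed(3)[of x "- 1"] by simp

lemma max_ideal_diff: "x \<in> max_ideal \<Longrightarrow> y \<in> max_ideal \<Longrightarrow> x - y \<in> (max_ideal :: 'a::comm_ring_1 set)"
  unfolding diff_conv_add_uminus by (rule max_ideal_closed(2)[OF _ max_ideal_minus])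

lemma one_notin_max_ideal: "(1 :: 'a::comm_ring_1) \<notin> max_ideal"
proof
  assume "(1 :: 'a) \<in> max_ideal"
  then have "(max_ideal :: 'a set) = UNIV" using max_ideal_closed(3)[of 1] by (metis UNIV_eq_I mult.right_neutral)
  moreover have "maximalideal (max_ideal :: 'a set) class_ring" by (rule maximalideal_max_ideal)
  ultimately show False using maximalideal.I_notcarr by fastforce
qed

lemma max_ideal_inverse:
  fixes a :: "'a::comm_ring_1"
  assumes "a \<notin> max_ideal"
  shows "\<exists>b. a * b - 1 \<in> max_ideal"
proof -
  define J where "J = {x + a * y | x y. x \<in> max_ideal}"
  have "ideal J (class_ring :: 'a ring)"
    unfolding ideal_class_ring_iff
  proof (intro conjI ballI allI)
    show "0 \<in> J" unfolding J_def using max_ideal_closed(1) by (intro CollectI exI[of _ 0]) simp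
    fix u assume "u \<in> J"
    then obtain x y where u: "u = x + a * y" "x \<in> max_ideal" unfolding J_def by blast
    have "c * u = c * x + a * (c * y)" for c by (simp add: u algebra_simps)
    then show "c * u \<in> J" for c unfolding J_def using max_ideal_closed(3)[OF u(2)] by blast
    fix v assume "v \<in> J"
    then obtain x' y' where v: "v = x' + a * y'" "x' \<in> max_ideal" unfolding J_def by blast
    have "u + v = (x + x') + a * (y + y')" by (simp add: u v algebra_simps)
    then show "u + v \<in> J" unfolding J_def using max_ideal_closed(2)[OF u(2) v(2)] by blast
  qed
  moreover have "max_ideal \<subseteq> J"
    unfolding J_def by (rule subsetI, rule CollectI, rule exI, rule exI[of _ 0]) simp
  moreover have "a \<in> J" unfolding J_def using max_ideal_closed(1) by (intro CollectI exI[of _ 0] exI[of _ 1]) simp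
  ultimately have "J = UNIV"
    using maximalideal.I_maximal[OF maximalideal_max_ideal, of J] assms by auto
  then obtain x y where "1 = x + a * y" "x \<in> max_ideal" unfolding J_def by blast
  then have "a * y - 1 = - x" by (simp add: algebra_simps)
  then show ?thesis using max_ideal_minus \<open>x \<in> max_ideal\<close> by metis
qed

quotient_type (overloaded) 'a residue = "'a::comm_ring_1" / "\<lambda>x y. x - y \<in> max_ideal"
proof (rule equivpI)
  show "reflp (\<lambda>x y :: 'a. x - y \<in> max_ideal)" by (simp add: reflp_def max_ideal_closed)
  show "symp (\<lambda>x y :: 'a. x - y \<in> max_ideal)" unfolding symp_def using max_ideal_minus by fastforce
  show "transp (\<lambda>x y :: 'a. x - y \<in> max_ideal)" unfolding transp_def using max_ideal_closed(2) by fastforce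
qed

instantiation residue :: (comm_ring_1) field
begin

lift_definition zero_residue :: "'a residue" is 0 .
lift_definition one_residue :: "'a residue" is 1 .
lift_definition plus_residue :: "'a residue \<Rightarrow> 'a residue \<Rightarrow> 'a residue" is "(+)"
  using max_ideal_closed(2) by (metis add_diff_add)
lift_definition minus_residue :: "'a residue \<Rightarrow> 'a residue \<Rightarrow> 'a residue" is "(-)"
  using max_ideal_diff by (metis diff_diff_eq2 diff_diff_add add_diff_eq diff_add_eq)
lift_definition uminus_residue :: "'a residue \<Rightarrow> 'a residue" is uminus
  using max_ideal_minus by fastforce
lift_definition times_residue :: "'a residue \<Rightarrow> 'a residue \<Rightarrow> 'a residue" is "(*)"
proof -
  fix a b c d :: 'a assume *: "a - b \<in> max_ideal" "c - d \<in> max_ideal"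
  have "a * c - b * d = c * (a - b) + b * (c - d)" by (simp add: algebra_simps)
  then show "a * c - b * d \<in> max_ideal" using * max_ideal_closed by metis
qed

definition "inverse x = (if x = 0 then 0 else SOME y. x * y = 1)" for x :: "'a residue"
definition "x div y = x * inverse y" for x y :: "'a residue"

instance
proof
  fix a b c :: "'a residue"
  show "a * b * c = a * (b * c)" by transfer (simp add: mult.assoc max_ideal_closed)
  show "a * b = b * a" by transfer (simp add: mult.commute max_ideal_closed)
  show "1 * a = a" by transfer (simp add: max_ideal_closed)
  show "a + b + c = a + (b + c)" by transfer (simp add: add.assoc max_ideal_closed)
  show "a + b = b + a" by transfer (simp add: add.commute max_ideal_closed)
  show "0 + a = a" by transfer (simp add: max_ideal_closed)
  show "- a + a = 0" by transfer (simp add: max_ideal_closed)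
  show "a - b = a + - b" by transfer (simp add: max_ideal_closed)
  show "(a + b) * c = a * c + b * c" by transfer (simp add: distrib_right max_ideal_closed)
  show "(0 :: 'a residue) \<noteq> 1" by transfer (use one_notin_max_ideal max_ideal_minus in fastforce)
  show "inverse a * a = 1" if "a \<noteq> 0"
  proof -
    have "\<exists>y. a * y = 1" using that by transfer (simp add: max_ideal_inverse)
    then have "a * (SOME y. a * y = 1) = 1" by (rule someI_ex)
    moreover have "x * y = y * x" for x y :: "'a residue" by transfer (simp add: mult.commute max_ideal_closed)
    ultimately show ?thesis using that by (simp add: inverse_residue_def)
  qed
  show "a div b = a * inverse b" by (simp add: divide_residue_def)
  show "inverse (0 :: 'a residue) = 0" by (simp add: inverse_residue_def)
qed

end

lemma abs_residue_simps:
  "abs_residue (x + y) = abs_residue x + abs_residue y" "abs_residue (x * y) = abs_residue x * abs_residue y"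
  "abs_residue 0 = 0" "abs_residue 1 = 1"
  by (simp_all add: plus_residue.abs_eq times_residue.abs_eq zero_residue_def one_residue_def)

lemma abs_residue_eq_0: "abs_residue x = 0 \<longleftrightarrow> x \<in> max_ideal"
  unfolding zero_residue_def by (simp add: residue.abs_eq_iff)

lemma abs_residue_surj: "\<exists>x. abs_residue x = y"
  by (metis Quotient_abs_rep Quotient_residue)

lemma abs_residue_sum: "abs_residue (sum f A) = (\<Sum>i\<in>A. abs_residue (f i))"
  by (induction A rule: infinite_finite_induct) (simp_all add: abs_residue_simps)

lemma local_ring_max_ideal: "local_ring m \<Longrightarrow> m = max_ideal"
  unfolding local_ring_def using maximalideal_max_ideal by blast

text \<open>A nonunit generates a proper ideal, and the maximal ideal above it can only be
  \<open>m\<close>.\<close>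

lemma local_ring_unit:
  fixes a :: "'a::comm_ring_1"
  assumes m: "local_ring m" and a: "a \<notin> m"
  shows "\<exists>b. a * b = 1"
proof (rule ccontr)
  assume no: "\<nexists>b. a * b = 1"
  define J where "J = {a * y | y. True}"
  have "ideal J (class_ring :: 'a ring)"
    unfolding ideal_class_ring_iff
  proof (intro conjI ballI allI)
    show "0 \<in> J" unfolding J_def by (auto intro!: exI[of _ 0])
    fix u assume "u \<in> J"
    then obtain y where u: "u = a * y" unfolding J_def by blast
    have "c * u = a * (c * y)" for c by (simp add: u algebra_simps)
    then show "c * u \<in> J" for c unfolding J_def by blast
    fix v assume "v \<in> J"
    then obtain y' where v: "v = a * y'" unfolding J_def by blast
    have "u + v = a * (y + y')" by (simp add: u v algebra_simps)
    then show "u + v \<in> J" unfolding J_def by blast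
  qed
  moreover have "1 \<notin> J" using no unfolding J_def by auto
  ultimately obtain M where M: "maximalideal M (class_ring :: 'a ring)" "J \<subseteq> M" using maximalideal_exists by blast
  then have "M = m" using m by (auto simp: local_ring_def)
  moreover have "a \<in> J" unfolding J_def by (intro CollectI exI[of _ 1]) simp
  ultimately show False using M a by blast
qed

abbreviation residue_poly :: "'a::comm_ring_1 poly \<Rightarrow> 'a residue poly" where
  "residue_poly \<equiv> map_poly abs_residue"

lemma coeff_residue_poly: "coeff (residue_poly p) i = abs_residue (coeff p i)"
  by (simp add: coeff_map_poly abs_residue_simps)

lemma residue_poly_const: "residue_poly [:a:] = [:abs_residue a:]"
  by (rule poly_eqI) (simp add: coeff_residue_poly coeff_pCons abs_residue_simps split: nat.split)

lemma reduction_residue_poly: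
  assumes "local_ring (m :: 'a::comm_ring_1 set)"
  shows "reduction (residue_poly :: 'a poly \<Rightarrow> 'a residue poly)"
proof
  fix p q :: "'a poly"
  show "residue_poly (p + q) = residue_poly p + residue_poly q"
    by (rule poly_eqI) (simp add: coeff_residue_poly abs_residue_simps)
  show "residue_poly (p * q) = residue_poly p * residue_poly q"
    by (rule poly_eqI) (simp add: coeff_residue_poly abs_residue_simps coeff_mult abs_residue_sum)
  show "residue_poly (1 :: 'a poly) = 1"
    by (rule poly_eqI) (simp add: coeff_residue_poly abs_residue_simps)
  show "surj (residue_poly :: 'a poly \<Rightarrow> 'a residue poly)"
  proof (rule surjI)
    fix p :: "'a residue poly"
    \<comment> \<open>The value at 0 is set to 0, as \<open>coeff_map_poly\<close> requires.\<close>
    define f where "f = (\<lambda>y :: 'a residue. if y = 0 then 0 else SOME x. abs_residue x = y)"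
    have f: "abs_residue (f y) = y" for y
      unfolding f_def using someI_ex[OF abs_residue_surj[of y]] by (simp add: abs_residue_simps)
    have f0: "f 0 = 0" by (simp add: f_def)
    show "residue_poly (map_poly f p) = p"
      by (rule poly_eqI) (simp add: coeff_residue_poly coeff_map_poly f0 f)
  qed
  fix c :: "'a residue" assume c: "c \<noteq> 0"
  obtain a where a: "abs_residue a = c" using abs_residue_surj by blast
  then have "a \<notin> m" using c local_ring_max_ideal[OF assms] abs_residue_eq_0 by blast
  then obtain b where b: "a * b = 1" using local_ring_unit[OF assms] by blast
  show "\<exists>u u'. u * u' = 1 \<and> residue_poly u = [:c:]"
  proof -
    have "[:a:] * [:b:] = 1" using b by (simp add: one_pCons mult.commute)
    moreover have "residue_poly [:a:] = [:c:]" by (simp add: residue_poly_const a)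
    ultimately show ?thesis by blast
  qed
qed

lemma poly_ideal_eq:
  assumes "local_ring (m :: 'a::comm_ring_1 set)"
  shows "poly_ideal m = {p. residue_poly p = 0}"
proof -
  interpret reduction "residue_poly :: 'a poly \<Rightarrow> 'a residue poly" by (rule reduction_residue_poly[OF assms])
  have m: "m = max_ideal" by (rule local_ring_max_ideal[OF assms])
  show ?thesis
  proof (rule equalityI)
    have "ideal {p :: 'a poly. residue_poly p = 0} class_ring"
      by (simp add: ideal_class_ring_iff)
    moreover have "(\<lambda>a. [:a:]) ` m \<subseteq> {p. residue_poly p = 0}"
      by (auto simp: m residue_poly_const abs_residue_eq_0)
    ultimately show "poly_ideal m \<subseteq> {p. residue_poly p = 0}"
      unfolding poly_ideal_def genideal_def by blast
  next
    show "{p. residue_poly p = 0} \<subseteq> poly_ideal m"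
      unfolding poly_ideal_def genideal_def
    proof (rule subsetI, rule InterI)
      fix p :: "'a poly" and I assume p: "p \<in> {p. residue_poly p = 0}"
        and "I \<in> {I. ideal I class_ring \<and> (\<lambda>a. [:a:]) ` m \<subseteq> I}"
      then have I: "ideal I (class_ring :: 'a poly ring)" "\<And>a. a \<in> m \<Longrightarrow> [:a:] \<in> I" by auto
      have "coeff p i \<in> m" for i
        using p coeff_residue_poly[of p i] by (simp add: m abs_residue_eq_0)
      then show "p \<in> I"
      proof (induction p)
        case 0
        then show ?case using I by (simp add: ideal_class_ring_iff)
      next
        case (pCons a p)
        have "coeff p i \<in> m" for i using pCons.prems[of "Suc i"] by simp
        then have "p \<in> I" by (rule pCons.IH)
        then have "[:0, 1:] * p \<in> I" using I(1) unfolding ideal_class_ring_iff by blast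
        moreover have "[:a:] \<in> I" using pCons.prems[of 0] I(2) by simp
        moreover have "pCons a p = [:a:] + [:0, 1:] * p" by simp
        ultimately show ?case using I(1) unfolding ideal_class_ring_iff by metis
      qed
    qed
  qed
qed

section \<open>Matrices\<close>

text \<open>The continuation by the identity beyond \<open>2 * n\<close> matches the action of
  \<open>G n\<close>, so matrices and bijections are compared as functions.\<close>

definition mact :: "nat \<Rightarrow> 'a mat \<Rightarrow> (nat \<Rightarrow> 'a) \<Rightarrow> nat \<Rightarrow> 'a::comm_ring_1" where
  "mact n A v = (\<lambda>i. if i < 2 * n then (\<Sum>j<2 * n. A $$ (i, j) * v j) else v i)"

abbreviation sqmat :: "nat \<Rightarrow> 'a mat set" where
  "sqmat n \<equiv> carrier_mat (2 * n) (2 * n)"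

lemma mat_mult_entry:
  "A \<in> carrier_mat k k \<Longrightarrow> B \<in> carrier_mat k k \<Longrightarrow> i < k \<Longrightarrow> j < k \<Longrightarrow> (A * B) $$ (i, j) = (\<Sum>l<k. A $$ (i, l) * B $$ (l, j))"
  by (simp add: scalar_prod_def atLeast0LessThan)

lemma mact_mult:
  assumes "A \<in> sqmat n" "B \<in> sqmat n"
  shows "mact n (A * B) v = mact n A (mact n B v)"
proof
  fix i
  show "mact n (A * B) v i = mact n A (mact n B v) i"
  proof (cases "i < 2 * n")
    case True
    have "(\<Sum>j<2 * n. (A * B) $$ (i, j) * v j) = (\<Sum>j<2 * n. \<Sum>l<2 * n. A $$ (i, l) * (B $$ (l, j) * v j))"
      using assms True by (intro sum.cong) (simp_all add: mat_mult_entry[OF assms] sum_distrib_right mult.assoc del: index_mult_mat)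
    also have "\<dots> = (\<Sum>l<2 * n. A $$ (i, l) * (\<Sum>j<2 * n. B $$ (l, j) * v j))"
      by (subst sum.swap) (simp add: sum_distrib_left)
    also have "\<dots> = (\<Sum>l<2 * n. A $$ (i, l) * mact n B v l)"
      by (intro sum.cong) (simp_all add: mact_def)
    finally show ?thesis using True by (simp add: mact_def[of n "A * B"] mact_def[of n A])
  qed (simp add: mact_def)
qed

lemma mact_bv: "j < 2 * n \<Longrightarrow> i < 2 * n \<Longrightarrow> mact n A (bv j) i = A $$ (i, j)"
  by (simp add: mact_def bv_apply if_distrib[of "\<lambda>x. _ * x"] cong: if_cong)

lemma mact_inject: "A \<in> sqmat n \<Longrightarrow> B \<in> sqmat n \<Longrightarrow> mact n A = mact n B \<Longrightarrow> A = B"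
  by (rule eq_matI) (auto simp: mact_bv[symmetric, of _ n])

lemma mact_one [simp]: "mact n (1\<^sub>m (2 * n)) v = v"
  by (rule ext) (simp add: mact_def if_distrib[of "\<lambda>x. x * _"] cong: if_cong)

lemma se_carrier [simp]: "se n i j x \<in> sqmat n"
  by (auto simp: se_def mat_unit_def)

lemma mact_se:
  assumes "i < 2 * n" "j < 2 * n" "i \<noteq> j"
  shows "mact n (se n i j x) v = ap (el i j x) v"
proof
  fix a
  show "mact n (se n i j x) v a = ap (el i j x) v a"
  proof (cases "a < 2 * n")
    case True
    have u: "mat_unit (2 * n) k l $$ (a, b) = (if a = k then (if b = l then 1 else 0) else 0)" if "b < 2 * n" for b k l
      using that True by (simp add: mat_unit_def)
    have dim: "mat_unit (2 * n) k l \<in> sqmat n" for k l :: nat by (simp add: mat_unit_def)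
    have one: "1\<^sub>m (2 * n) $$ (a, b) = (if b = a then 1 else 0 :: 'a)" if "b < 2 * n" for b
      using that True by auto
    have sij: "sigma i < 2 * n" "sigma j < 2 * n" using assms by simp_all
    show ?thesis
    proof (cases "i = sigma j")
      case True': True
      have "mact n (se n i j x) v a = (\<Sum>b<2 * n. ((if b = a then 1 else 0) + x * (if a = i then (if b = j then 1 else 0) else 0)) * v b)"
        using True True' by (auto simp: mact_def se_def u one dim[THEN carrier_matD(1)] dim[THEN carrier_matD(2)] intro!: sum.cong)
      also have "\<dots> = v a + (if a = i then x * v j else 0)"
        using True assms by (auto simp: distrib_right sum.distrib if_distrib[of "\<lambda>x. x * _"] if_distrib[of "\<lambda>x. _ * x"] cong: if_cong)
      finally show ?thesis using True' assms by (simp add: elf_def vec_simps)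
    next
      case False
      have "mact n (se n i j x) v a = (\<Sum>b<2 * n. ((if b = a then 1 else 0) + x * (if a = i then (if b = j then 1 else 0) else 0)
          - (- 1) ^ (i + j) * x * (if a = sigma j then (if b = sigma i then 1 else 0) else 0)) * v b)"
        using True False by (auto simp: mact_def se_def u one dim[THEN carrier_matD(1)] dim[THEN carrier_matD(2)] intro!: sum.cong)
      also have "\<dots> = v a + (if a = i then x * v j else 0) - (if a = sigma j then (- 1) ^ (i + j) * x * v (sigma i) else 0)"
        using True assms sij by (auto simp: distrib_right left_diff_distrib sum.distrib sum_subtractf if_distrib[of "\<lambda>x. x * _"] if_distrib[of "\<lambda>x. _ * x"] cong: if_cong)
      finally show ?thesis using False assms by (simp add: elf_def vec_simps)
    qed
  next
    case False
    moreover have "a \<noteq> i" "a \<noteq> sigma j" using False assms sigma_less[of j n] by (auto simp del: sigma_less)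
    ultimately show ?thesis using assms by (simp add: mact_def elf_def vec_simps)
  qed
qed

lemma monoid_ring_mat: "Group.monoid (ring_mat TYPE('a::comm_ring_1) k ())"
  using ring.is_monoid[OF ring_mat] .

lemma group_GL: "Group.group (GL k :: 'a::comm_ring_1 mat monoid)"
  by (rule monoid.units_group[OF monoid_ring_mat])

lemma GL_mult: "mult (GL k) = (*)"
  by (simp add: units_of_def ring_mat_def)

lemma GL_one: "one (GL k) = 1\<^sub>m k"
  by (simp add: units_of_def ring_mat_def)

lemma GL_carrier: "A \<in> carrier (GL k) \<Longrightarrow> A \<in> carrier_mat k k"
  by (simp add: units_of_def Units_def ring_mat_def)

lemma GL_I: "A \<in> carrier_mat k k \<Longrightarrow> B \<in> carrier_mat k k \<Longrightarrow> A * B = 1\<^sub>m k \<Longrightarrow> B * A = 1\<^sub>m k \<Longrightarrow> A \<in> carrier (GL k)"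
  by (auto simp: units_of_def Units_def ring_mat_def)

lemma se_mult: "i < 2 * n \<Longrightarrow> j < 2 * n \<Longrightarrow> i \<noteq> j \<Longrightarrow> se n i j x * se n i j y = se n i j (x + y)"
  by (rule mact_inject[of _ n]) (auto intro!: mult_carrier_mat[OF se_carrier se_carrier] simp: mact_mult mact_se elf_elf fun_eq_iff)

lemma se_0: "se n i j 0 = 1\<^sub>m (2 * n)"
  by (rule eq_matI) (auto simp: se_def mat_unit_def)

lemma se_GL: "i < 2 * n \<Longrightarrow> j < 2 * n \<Longrightarrow> i \<noteq> j \<Longrightarrow> se n i j x \<in> carrier (GL (2 * n))"
  by (rule GL_I[of _ _ "se n i j (- x)"]) (simp_all add: se_mult se_0)

lemma mact_inv:
  assumes A: "A \<in> carrier (GL (2 * n))" and g: "mact n A = ap g"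
  shows "mact n (inv\<^bsub>GL (2 * n)\<^esub> A) = ap (- g)"
proof -
  have iA: "inv\<^bsub>GL (2 * n)\<^esub> A \<in> carrier (GL (2 * n))" using group.inv_closed[OF group_GL A] .
  have "A * inv\<^bsub>GL (2 * n)\<^esub> A = 1\<^sub>m (2 * n)"
    using group.r_inv[OF group_GL A] by (simp add: GL_mult GL_one)
  then have "ap g (mact n (inv\<^bsub>GL (2 * n)\<^esub> A) v) = v" for v
    using mact_mult[OF GL_carrier[OF A] GL_carrier[OF iA], of v] g by simp
  then show ?thesis by (metis ap_minus_ap ext)
qed

text \<open>The bridge from generated matrix groups to bijections, applied with \<open>G n\<close>
  for \<open>ESp n\<close> and with \<open>E n\<close> for the relative group.\<close>

lemma generate_GL:
  assumes H: "H \<subseteq> carrier (GL (2 * n))" and gens: "\<And>A. A \<in> H \<Longrightarrow> \<exists>g\<in>K. mact n A = ap g"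
    and K: "0 \<in> K" "\<And>g h. g \<in> K \<Longrightarrow> h \<in> K \<Longrightarrow> g + h \<in> K" "\<And>g. g \<in> K \<Longrightarrow> - g \<in> K"
    and A: "A \<in> generate (GL (2 * n)) H"
  shows "A \<in> carrier (GL (2 * n)) \<and> (\<exists>g\<in>K. mact n A = ap g)"
  using A
proof (induction rule: generate.induct)
  case one
  have "mact n (1\<^sub>m (2 * n)) = ap 0" by (auto simp: fun_eq_iff)
  moreover have "\<one>\<^bsub>GL (2 * n)\<^esub> \<in> carrier (GL (2 * n))"
    using monoid.one_closed[OF group.is_monoid[OF group_GL]] .
  ultimately show ?case unfolding GL_one using K(1) by blast
next
  case (incl h)
  then show ?case using H gens by blast
next
  case (inv h)
  then obtain g where g: "g \<in> K" "mact n h = ap g" using gens by blast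
  have h: "h \<in> carrier (GL (2 * n))" using inv H by blast
  show ?case using mact_inv[OF h g(2)] K(3)[OF g(1)] group.inv_closed[OF group_GL h] by blast
next
  case (eng h1 h2)
  then obtain g1 g2 where g: "g1 \<in> K" "mact n h1 = ap g1" "g2 \<in> K" "mact n h2 = ap g2" by blast
  have c: "h1 \<in> carrier (GL (2 * n))" "h2 \<in> carrier (GL (2 * n))" using eng by blast+
  have "mact n (h1 * h2) = ap (g1 + g2)"
    using mact_mult[OF GL_carrier[OF c(1)] GL_carrier[OF c(2)]] g by (simp add: fun_eq_iff)
  moreover have "h1 * h2 \<in> carrier (GL (2 * n))"
    using monoid.m_closed[OF group.is_monoid[OF group_GL] c] by (simp add: GL_mult)
  ultimately show ?case unfolding GL_mult using K(2)[OF g(1,3)] by blast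
qed

abbreviation "se_gens n \<equiv> {se n i j x | i j x. i < 2 * n \<and> j < 2 * n \<and> i \<noteq> j}"

lemma se_gens_GL: "se_gens n \<subseteq> carrier (GL (2 * n))"
  by (auto intro: se_GL)

lemma ESp_G: "A \<in> ESp n \<Longrightarrow> A \<in> carrier (GL (2 * n)) \<and> (\<exists>g\<in>G n. mact n A = ap g)"
  unfolding ESp_def
  by (rule generate_GL[OF se_gens_GL]) (auto intro!: G_0 G_add G_minus G_el simp: mact_se fun_eq_iff simp del: ap_el)

lemma ESp_subgroup: "subgroup (ESp n) (GL (2 * n))"
  unfolding ESp_def by (rule group.generate_is_subgroup[OF group_GL se_gens_GL])

lemma ESp_mult: "A \<in> ESp n \<Longrightarrow> B \<in> ESp n \<Longrightarrow> A * B \<in> ESp n"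
  using subgroup.m_closed[OF ESp_subgroup] by (simp add: GL_mult)

lemma se_ESp: "i < 2 * n \<Longrightarrow> j < 2 * n \<Longrightarrow> i \<noteq> j \<Longrightarrow> se n i j x \<in> ESp n"
  unfolding ESp_def by (rule generate.incl) blast

lemma G_ESp: "g \<in> G n \<Longrightarrow> \<exists>A\<in>ESp n. mact n A = ap g"
proof (induction rule: G.induct)
  case G_0
  have "1\<^sub>m (2 * n) \<in> ESp n" using subgroup.one_closed[OF ESp_subgroup] by (simp add: GL_one)
  then show ?case by (intro bexI[of _ "1\<^sub>m (2 * n)"]) (auto simp: fun_eq_iff)
next
  case (G_step i j g x)
  then obtain A where A: "A \<in> ESp n" "mact n A = ap g" by blast
  have "A \<in> sqmat n" using A(1) ESp_G GL_carrier by blast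
  then have "mact n (se n i j x * A) v = ap (el i j x + g) v" for v
    using mact_mult[OF se_carrier \<open>A \<in> sqmat n\<close>, of i j x v] G_step(1-3) A(2) by (simp add: mact_se del: ap_el)
  then have "mact n (se n i j x * A) = ap (el i j x + g)" by (rule ext)
  then show ?case using A se_ESp ESp_mult G_step by metis
qed

lemma om_conv_sum: "om k v w = (\<Sum>i<2 * k. (- 1) ^ i * (v i * w (sigma i)))"
  by (induction k) (simp_all add: om_Suc om_def[of 0] sigma_def)

lemma chi_carrier: "chi n \<in> sqmat n"
proof (induction n)
  case (Suc n)
  note carrier_matD[OF Suc.IH]
  moreover have "dim_row chi1 = 2" "dim_col chi1 = 2" by (auto simp: chi1_def mat_of_rows_list_def)
  ultimately show ?case by (intro carrier_matI) (simp_all add: Let_def)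
qed simp

lemma chi_entry: "i < 2 * n \<Longrightarrow> j < 2 * n \<Longrightarrow> chi n $$ (i, j) = (if j = sigma i then (- 1) ^ i else 0)"
proof (induction n arbitrary: i j)
  case (Suc n)
  have d: "dim_row (chi n) = 2 * n" "dim_col (chi n) = 2 * n" for n :: nat
    by (simp_all only: carrier_matD[OF chi_carrier])
  have d1: "dim_row chi1 = 2" "dim_col chi1 = 2" by (auto simp: chi1_def mat_of_rows_list_def)
  have e: "chi (Suc n) $$ (i, j) = (if i < 2 * n then if j < 2 * n then chi n $$ (i, j) else 0
     else if j < 2 * n then 0 else chi1 $$ (i - 2 * n, j - 2 * n))"
  proof -
    have "i - 2 * n < 2" "j - 2 * n < 2" using Suc.prems by auto
    then show ?thesis using Suc.prems by (simp add: d d1 Let_def)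
  qed
  have c1: "chi1 $$ (0, 0) = 0" "chi1 $$ (0, 1) = 1" "chi1 $$ (1, 0) = - 1" "chi1 $$ (1, 1) = 0"
    by (auto simp: chi1_def mat_of_rows_list_def)
  show ?case
  proof (cases "i < 2 * n")
    case True
    then show ?thesis unfolding e using Suc.IH[of i j] sigma_less[of i n] by (auto simp del: sigma_less)
  next
    case False
    then consider "i = 2 * n" | "i = 2 * n + 1" using Suc.prems by fastforce
    then show ?thesis
    proof cases
      case 1
      then consider "j < 2 * n" | "j = 2 * n" | "j = 2 * n + 1" using Suc.prems by fastforce
      then show ?thesis unfolding e using 1 c1 by cases (auto simp: sigma_def)
    next
      case 2
      then consider "j < 2 * n" | "j = 2 * n" | "j = 2 * n + 1" using Suc.prems by fastforce
      then show ?thesis unfolding e using 2 c1 by cases (auto simp: sigma_def)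
    qed
  qed
qed simp

lemma symplectic_entry:
  assumes A: "A \<in> sqmat n" and i: "i < 2 * n" and j: "j < 2 * n"
  shows "(transpose_mat A * chi n * A) $$ (i, j) = om n (mact n A (bv i)) (mact n A (bv j))"
proof -
  have T: "transpose_mat A \<in> sqmat n" using A by simp
  have TC: "transpose_mat A * chi n \<in> sqmat n" by (rule mult_carrier_mat[OF T chi_carrier])
  have inner: "(transpose_mat A * chi n) $$ (i, l) = (- 1) ^ sigma l * A $$ (sigma l, i)" if l: "l < 2 * n" for l
  proof -
    have "(transpose_mat A * chi n) $$ (i, l) = (\<Sum>k<2 * n. A $$ (k, i) * (if k = sigma l then (- 1) ^ k else 0))"
      unfolding mat_mult_entry[OF T chi_carrier i l]
      using A i l by (intro sum.cong) (auto simp: chi_entry sigma_eq_swap)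
    also have "\<dots> = (- 1) ^ sigma l * A $$ (sigma l, i)"
      using l by (simp add: if_distrib[of "\<lambda>x. _ * x"] cong: if_cong)
    finally show ?thesis .
  qed
  have "(transpose_mat A * chi n * A) $$ (i, j) = (\<Sum>l<2 * n. (- 1) ^ sigma l * (A $$ (sigma l, i) * A $$ (l, j)))"
    unfolding mat_mult_entry[OF TC A i j] by (intro sum.cong) (auto simp: inner mult.assoc)
  also have "\<dots> = (\<Sum>l<2 * n. (- 1) ^ l * (A $$ (l, i) * A $$ (sigma l, j)))"
    by (rule sum.reindex_bij_witness[of _ sigma sigma]) auto
  also have "\<dots> = om n (mact n A (bv i)) (mact n A (bv j))"
    unfolding om_conv_sum using i j by (intro sum.cong) (auto simp: mact_bv)
  finally show ?thesis .
qed

lemma ESp_symplectic: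
  assumes "A \<in> ESp n"
  shows "transpose_mat A * chi n * A = chi n"
proof -
  obtain g where A: "A \<in> carrier (GL (2 * n))" and g: "g \<in> G n" "mact n A = ap g"
    using ESp_G[OF assms] by blast
  note A' = GL_carrier[OF A]
  show ?thesis
  proof (rule eq_matI)
    fix i j assume "i < dim_row (chi n)" "j < dim_col (chi n)"
    then have ij: "i < 2 * n" "j < 2 * n" by (simp_all add: carrier_matD[OF chi_carrier])
    have "(transpose_mat A * chi n * A) $$ (i, j) = om n (bv i) (bv j)"
      unfolding symplectic_entry[OF A' ij] g(2) om_G[OF g(1)] ..
    also have "\<dots> = (transpose_mat (1\<^sub>m (2 * n)) * chi n * 1\<^sub>m (2 * n)) $$ (i, j)"
      by (rule trans[OF _ symplectic_entry[OF one_carrier_mat ij, symmetric]]) simp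
    also have "\<dots> = chi n $$ (i, j)"
      by (simp add: left_mult_one_mat[OF chi_carrier] right_mult_one_mat[OF chi_carrier])
    finally show "(transpose_mat A * chi n * A) $$ (i, j) = chi n $$ (i, j)" .
  qed (use A' in \<open>simp_all add: carrier_matD[OF chi_carrier]\<close>)
qed

section \<open>The matrix groups compared with \<open>G n\<close> and \<open>E n\<close>\<close>

context reduction begin

abbreviation "ker_pi \<equiv> {x. \<pi> x = 0}"

text \<open>The columns of \<open>A\<close> are the images of the basis vectors, and coordinates
  beyond \<open>2 * n\<close> are fixed by construction.\<close>

lemma cong_one_iff:
  assumes "g \<in> G n" "mact n A = ap g"
  shows "mat_cong_one (2 * n) ker_pi A \<longleftrightarrow> (\<forall>w. act g w = w)"
proof
  assume A: "mat_cong_one (2 * n) ker_pi A"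
  have e: "\<pi> (A $$ (i, j)) = (if i = j then 1 else 0)" if "i < 2 * n" "j < 2 * n" for i j
    using A that unfolding mat_cong_one_def by (auto split: if_splits)
  show "\<forall>w. act g w = w"
  proof (intro allI ext)
    fix w i
    have "act g w i = \<pi> (mact n A (\<lambda>i. sec (w i)) i)" by (simp add: act_def assms red_def)
    also have "\<dots> = w i"
      by (cases "i < 2 * n") (simp_all add: mact_def pi_sum e if_distrib[of "\<lambda>x. x * _"] cong: if_cong)
    finally show "act g w i = w i" .
  qed
next
  assume fx: "\<forall>w. act g w = w"
  show "mat_cong_one (2 * n) ker_pi A"
    unfolding mat_cong_one_def
  proof (intro allI impI)
    fix i j assume ij: "i < 2 * n" "j < 2 * n"
    have "\<pi> (A $$ (i, j)) = red (ap g (bv j)) i"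
      using mact_bv[OF ij(2,1), of A] by (simp add: assms red_def)
    also have "\<dots> = bv j i" using red_ap[OF assms(1), of "bv j"] fx by simp
    finally show "A $$ (i, j) - 1\<^sub>m (2 * n) $$ (i, j) \<in> ker_pi" using ij by (simp add: bv_apply)
  qed
qed

abbreviation "rel_gens n \<equiv> {A * se n i j x * inv\<^bsub>GL (2 * n)\<^esub> A | A i j x.
  A \<in> ESp n \<and> i < 2 * n \<and> j < 2 * n \<and> i \<noteq> j \<and> x \<in> ker_pi}"

lemma rel_gen:
  assumes "A \<in> ESp n" "mact n A = ap g" "i < 2 * n" "j < 2 * n" "i \<noteq> j"
  shows "A * se n i j x * inv\<^bsub>GL (2 * n)\<^esub> A \<in> ESp n"
    "mact n (A * se n i j x * inv\<^bsub>GL (2 * n)\<^esub> A) = ap (g + el i j x - g)"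
proof -
  have A: "A \<in> carrier (GL (2 * n))" using ESp_G[OF assms(1)] by blast
  have iA: "inv\<^bsub>GL (2 * n)\<^esub> A \<in> ESp n" using subgroup.m_inv_closed[OF ESp_subgroup assms(1)] .
  then have iA': "inv\<^bsub>GL (2 * n)\<^esub> A \<in> sqmat n" using ESp_G GL_carrier by blast
  show "A * se n i j x * inv\<^bsub>GL (2 * n)\<^esub> A \<in> ESp n"
    using assms iA by (intro ESp_mult se_ESp)
  show "mact n (A * se n i j x * inv\<^bsub>GL (2 * n)\<^esub> A) = ap (g + el i j x - g)"
    by (rule ext) (simp only: mact_mult[OF mult_carrier_mat[OF GL_carrier[OF A] se_carrier] iA']
        mact_mult[OF GL_carrier[OF A] se_carrier] mact_inv[OF A assms(2)] mact_se[OF assms(3-5)] assms(2) ap_diff ap_add)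
qed

lemma rel_gens_ESp: "rel_gens n \<subseteq> ESp n"
proof
  fix B assume "B \<in> rel_gens n"
  then obtain A i j x where B: "B = A * se n i j x * inv\<^bsub>GL (2 * n)\<^esub> A" "A \<in> ESp n"
    "i < 2 * n" "j < 2 * n" "i \<noteq> j" by blast
  moreover obtain g where "mact n A = ap g" using ESp_G[OF B(2)] by blast
  ultimately show "B \<in> ESp n" using rel_gen(1) by blast
qed

lemma ESp_rel_subset: "ESp_rel n ker_pi \<subseteq> ESp n"
  unfolding ESp_rel_def by (rule group.generate_subgroup_incl[OF group_GL rel_gens_ESp ESp_subgroup])

lemma ESp_rel_E:
  assumes "A \<in> ESp_rel n ker_pi"
  shows "\<exists>\<epsilon>\<in>E n. mact n A = ap \<epsilon>"
proof -
  have "A \<in> carrier (GL (2 * n)) \<and> (\<exists>g\<in>E n. mact n A = ap g)"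
  proof (rule generate_GL[OF _ _ E_0 E_add E_minus])
    show "rel_gens n \<subseteq> carrier (GL (2 * n))" using rel_gens_ESp ESp_G by blast
    show "A \<in> generate (GL (2 * n)) (rel_gens n)" using assms by (simp add: ESp_rel_def)
    fix B assume "B \<in> rel_gens n"
    then obtain A i j x where B: "B = A * se n i j x * inv\<^bsub>GL (2 * n)\<^esub> A" "A \<in> ESp n"
      "i < 2 * n" "j < 2 * n" "i \<noteq> j" "\<pi> x = 0" by blast
    moreover obtain g where "g \<in> G n" "mact n A = ap g" using ESp_G[OF B(2)] by blast
    ultimately show "\<exists>g\<in>E n. mact n B = ap g" using rel_gen(2) E_conj_el by blast
  qed
  then show ?thesis by blast
qed

lemma E_ESp_rel: "\<epsilon> \<in> E n \<Longrightarrow> \<exists>A\<in>ESp_rel n ker_pi. mact n A = ap \<epsilon>"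
proof (induction rule: E.induct)
  case E_0
  have "1\<^sub>m (2 * n) \<in> ESp_rel n ker_pi"
    unfolding ESp_rel_def using generate.one[of "GL (2 * n)"] by (simp add: GL_one)
  then show ?case by (intro bexI[of _ "1\<^sub>m (2 * n)"]) (auto simp: fun_eq_iff)
next
  case (E_step g i j x h)
  obtain A where A: "A \<in> ESp n" "mact n A = ap g" using G_ESp[OF E_step(1)] by blast
  obtain B where B: "B \<in> ESp_rel n ker_pi" "mact n B = ap h" using E_step by blast
  define C where "C = A * se n i j x * inv\<^bsub>GL (2 * n)\<^esub> A"
  have C: "C \<in> ESp n" "mact n C = ap (g + el i j x - g)"
    unfolding C_def using rel_gen[OF A E_step(2-4)] by blast+
  have "C \<in> rel_gens n" unfolding C_def using A E_step by blast
  then have "C * B \<in> ESp_rel n ker_pi"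
    using generate.eng[OF generate.incl B(1)[unfolded ESp_rel_def]] by (simp add: ESp_rel_def GL_mult)
  moreover have "mact n (C * B) = ap (g + el i j x - g + h)"
  proof
    fix v
    have "C \<in> sqmat n" "B \<in> sqmat n" using C(1) B(1) ESp_rel_subset ESp_G GL_carrier by blast+
    then show "mact n (C * B) v = ap (g + el i j x - g + h) v"
      using C(2) B(2) by (simp add: mact_mult)
  qed
  ultimately show ?case by blast
qed

text \<open>Elements of \<open>ESp n\<close> are symplectic by \<open>ESp_symplectic\<close>, so the
  intersection is cut out by the congruence, that is, by trivial action on vectors over the residue
  field; \<open>act_trivial_imp_E\<close> turns this into membership in \<open>E n\<close>, and
  \<open>mact_inject\<close> returns to matrices.\<close>

theorem Sp_rel_Int_ESp: "Sp_rel n ker_pi \<inter> ESp n = ESp_rel n ker_pi"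
proof (rule equalityI; rule subsetI)
  fix A assume A: "A \<in> Sp_rel n ker_pi \<inter> ESp n"
  then obtain g where g: "g \<in> G n" "mact n A = ap g" using ESp_G by blast
  have "mat_cong_one (2 * n) ker_pi A" using A by (simp add: Sp_rel_def)
  then have "g \<in> E n" using cong_one_iff[OF g] act_trivial_imp_E[OF g(1)] by blast
  then obtain B where B: "B \<in> ESp_rel n ker_pi" "mact n B = ap g" using E_ESp_rel by blast
  have "A \<in> sqmat n" "B \<in> sqmat n" using A B(1) ESp_rel_subset ESp_G GL_carrier by blast+
  then have "A = B" using g B by (intro mact_inject[of A n B]) simp_all
  then show "A \<in> ESp_rel n ker_pi" using B by simp
next
  fix A assume A: "A \<in> ESp_rel n ker_pi"
  then have A': "A \<in> ESp n" using ESp_rel_subset by blast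
  obtain \<epsilon> where e: "\<epsilon> \<in> E n" "mact n A = ap \<epsilon>" using ESp_rel_E[OF A] by blast
  have "mat_cong_one (2 * n) ker_pi A" using cong_one_iff[OF E_G[OF e(1)] e(2)] act_E[OF e(1)] by simp
  then show "A \<in> Sp_rel n ker_pi \<inter> ESp n"
    using A' ESp_G[OF A'] ESp_symplectic[OF A'] by (simp add: Sp_rel_def)
qed

end

theorem theorem1p3:
  fixes m :: "'a::comm_ring_1 set" and n :: nat
  assumes "local_ring m"
    and "n \<ge> 3"
  shows "Sp_rel n (poly_ideal m) \<inter> ESp n = ESp_rel n (poly_ideal m)"
proof -
  interpret reduction "residue_poly :: 'a poly \<Rightarrow> 'a residue poly"
    by (rule reduction_residue_poly[OF assms(1)])
  show ?thesis unfolding poly_ideal_eq[OF assms(1)] by (rule Sp_rel_Int_ESp)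
qed

end
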